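(* For every $L\ge0$ there is a constant $\alpha=\alpha(L)>0$, depending only on $L$ (not on the dimension), such that for every $d\ge1$ and every probability measure $d\mu=e^{-W}d\gamma_d$ on $\mathbb{R}^d$, with $\gamma_d$ the standard Gaussian measure on $\mathbb{R}^d$ and $|\nabla W|\le L$, the measure $\mu$ satisfies a Gaussian isoperimetric inequality with constant $\alpha$: for every Borel set $A\subset\mathbb{R}^d$, $$\mu^+(A)\ge\alpha\, I(\mu(A)).$$
   Context: For a Borel set $A$ in a metric space and $t>0$, $A^t:=\{x: d(x,A)\le t\}$, and $\mu^+(A):=\liminf_{t\to0^+}t^{-1}\mu(A^t\setminus A)$. The function $I:[0,1]\to\mathbb{R}$ is $I=\varphi\circ\phi^{-1}$, where $\varphi(x)=(2\pi)^{-1/2}e^{-x^2/2}$ and $\phi(x)=\int_{-\infty}^x\varphi(t)\,dt$ (with $I(0)=I(1)=0$). *)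

theory Defs
  imports "HOL-Probability.Probability"
begin

text \<open>
  The dimension \<open>d\<close> is quantified inside the statement, after the constant, so it cannot be a
  type-level index. The space \<open>\<real>\<^sup>d\<close> is the set of functions \<open>nat \<Rightarrow> real\<close> that are
  \<open>undefined\<close> outside \<open>{..<d}\<close> (the space of the product measures \<open>Pi\<^sub>M {..<d}\<close>), with the
  Euclidean distance.
\<close>

definition eucl :: "nat \<Rightarrow> (nat \<Rightarrow> real) metric" where
  "eucl d = metric ({..<d} \<rightarrow>\<^sub>E UNIV, \<lambda>x y. L2_set (\<lambda>i. x i - y i) {..<d})"

lemma Metric_space_eucl:
  "Metric_space ({..<d} \<rightarrow>\<^sub>E UNIV) (\<lambda>x y :: nat \<Rightarrow> real. L2_set (\<lambda>i. x i - y i) {..<d})"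
proof
  fix x y z :: "nat \<Rightarrow> real"
  show "0 \<le> L2_set (\<lambda>i. x i - y i) {..<d}"
    by (rule L2_set_nonneg)
  show "L2_set (\<lambda>i. x i - y i) {..<d} = L2_set (\<lambda>i. y i - x i) {..<d}"
    by (simp add: L2_set_def power2_commute)
  show "L2_set (\<lambda>i. x i - z i) {..<d}
      \<le> L2_set (\<lambda>i. x i - y i) {..<d} + L2_set (\<lambda>i. y i - z i) {..<d}"
    using L2_set_triangle_ineq[of "\<lambda>i. x i - y i" "\<lambda>i. y i - z i" "{..<d}"] by simp
  show "L2_set (\<lambda>i. x i - y i) {..<d} = 0 \<longleftrightarrow> x = y"
    if "x \<in> {..<d} \<rightarrow>\<^sub>E UNIV" "y \<in> {..<d} \<rightarrow>\<^sub>E UNIV"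
    using that by (auto simp: L2_set_eq_0_iff intro: PiE_ext)
qed

lemma mspace_eucl [simp]: "mspace (eucl d) = {..<d} \<rightarrow>\<^sub>E UNIV"
  and mdist_eucl [simp]: "mdist (eucl d) = (\<lambda>x y. L2_set (\<lambda>i. x i - y i) {..<d})"
  by (simp_all add: eucl_def Metric_space.mspace_metric Metric_space.mdist_metric Metric_space_eucl)

definition borel_sets_of :: "'a metric \<Rightarrow> 'a set set" where
  "borel_sets_of m = sigma_sets (mspace m) {U. openin (mtopology_of m) U}"

text \<open>
  The distance to a set is taken in \<open>ereal\<close>, so that the empty set is at distance \<open>\<infinity>\<close> from every
  point and its enlargements are empty (\<open>infdist\<close> would give distance \<open>0\<close>).
\<close>

definition enlargement :: "'a metric \<Rightarrow> 'a set \<Rightarrow> real \<Rightarrow> 'a set" where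
  "enlargement m A t = {x \<in> mspace m. (INF a\<in>A. ereal (mdist m x a)) \<le> ereal t}"

definition boundary_measure :: "'a metric \<Rightarrow> 'a measure \<Rightarrow> 'a set \<Rightarrow> ereal" where
  "boundary_measure m \<mu> A =
     Liminf (at_right 0) (\<lambda>t. ereal (measure \<mu> (enlargement m A t - A) / t))"

definition std_normal_cdf :: "real \<Rightarrow> real" where
  "std_normal_cdf x = (LINT t:{..x}|lborel. std_normal_density t)"

definition gauss_iso :: "real \<Rightarrow> real" where
  "gauss_iso p = (if 0 < p \<and> p < 1 then std_normal_density (inv std_normal_cdf p) else 0)"

definition std_gaussian :: "nat \<Rightarrow> (nat \<Rightarrow> real) measure" where
  "std_gaussian d = (\<Pi>\<^sub>M i\<in>{..<d}. density lborel std_normal_density)"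

text \<open>\<open>W\<close> is Frechet differentiable at \<open>x\<close>, with gradient \<open>g\<close>.\<close>

definition has_gradient ::
  "nat \<Rightarrow> ((nat \<Rightarrow> real) \<Rightarrow> real) \<Rightarrow> (nat \<Rightarrow> real) \<Rightarrow> (nat \<Rightarrow> real) \<Rightarrow> bool" where
  "has_gradient d W g x \<longleftrightarrow>
     ((\<lambda>y. (W y - W x - (\<Sum>i<d. g i * (y i - x i))) / mdist (eucl d) y x) \<longlongrightarrow> 0)
       (atin (mtopology_of (eucl d)) x)"

text \<open>
  The product \<open>\<sigma>\<close>-algebra carried by the Gaussian measure is the Borel \<open>\<sigma>\<close>-algebra of the
  Euclidean metric.
\<close>

lemma sets_std_gaussian: "sets (std_gaussian d) = borel_sets_of (eucl d)"
proof -
  define E where "E = ({..<d} \<rightarrow>\<^sub>E (UNIV :: real set))"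
  define \<delta> where "\<delta> = (\<lambda>x y :: nat \<Rightarrow> real. L2_set (\<lambda>i. x i - y i) {..<d})"
  interpret M: Metric_space E \<delta>
    unfolding E_def \<delta>_def by (rule Metric_space_eucl)
  have top: "mtopology_of (eucl d) = M.mtopology"
    by (simp add: mtopology_of_def E_def \<delta>_def)
  define N where "N = sigma E {U. openin M.mtopology U}"
  have sub: "{U. openin M.mtopology U} \<subseteq> Pow E"
    using openin_subset by fastforce
  have N: "sets N = borel_sets_of (eucl d)" "space N = E"
    using sub unfolding N_def borel_sets_of_def top by (simp_all add: E_def)
  define P where "P = (\<Pi>\<^sub>M i\<in>{..<d}. (borel :: real measure))"
  have P: "sets (std_gaussian d) = sets P"
    unfolding std_gaussian_def P_def by (intro sets_PiM_cong) auto
  have spP: "space P = E"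
    by (simp add: P_def space_PiM E_def)
  have coord: "(\<lambda>x. x i) \<in> borel_measurable N" if i: "i < d" for i
  proof (rule borel_measurableI)
    fix S :: "real set" assume S: "open S"
    have "openin M.mtopology ((\<lambda>x. x i) -` S \<inter> E)"
      unfolding M.openin_mtopology
    proof (intro conjI allI impI)
      fix x assume "x \<in> (\<lambda>x. x i) -` S \<inter> E"
      then obtain r where r: "r > 0" "\<And>u. dist u (x i) < r \<Longrightarrow> u \<in> S"
        using S by (auto simp: open_dist)
      have le: "\<bar>x i - y i\<bar> \<le> \<delta> x y" for y
        unfolding \<delta>_def using member_le_L2_set[of "{..<d}" i "\<lambda>i. \<bar>x i - y i\<bar>"] i
        by (simp add: L2_set_def)
      have "M.mball x r \<subseteq> (\<lambda>x. x i) -` S \<inter> E"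
      proof
        fix y assume "y \<in> M.mball x r"
        then have "y \<in> E" "dist (y i) (x i) < r"
          using le[of y] by (auto simp: dist_real_def)
        then show "y \<in> (\<lambda>x. x i) -` S \<inter> E"
          using r(2) by simp
      qed
      then show "\<exists>r>0. M.mball x r \<subseteq> (\<lambda>x. x i) -` S \<inter> E"
        using r(1) by blast
    qed auto
    then show "(\<lambda>x. x i) -` S \<inter> space N \<in> sets N"
      unfolding N(2) unfolding N_def using sub by (simp add: sigma_sets.Basic)
  qed
  have "(\<lambda>x. x) \<in> measurable N P"
    unfolding P_def by (rule measurable_PiM_single') (auto simp: coord N E_def)
  then have 1: "sets P \<subseteq> sets N"
    using spP N(2) measurable_sets[of "\<lambda>x. x" N P] sets.sets_into_space[of _ P]
    by (metis Int_absorb2 subsetI vimage_ident)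
  have meas: "(\<lambda>y. \<delta> q y) \<in> borel_measurable P" for q
    unfolding \<delta>_def L2_set_def P_def by measurable
  have ball: "M.mball q r \<in> sets P" if "q \<in> E" for q r
  proof -
    have "M.mball q r = {y \<in> space P. \<delta> q y < r}"
      using that by (auto simp: spP)
    also have "\<dots> \<in> sets P"
      using meas by measurable
    finally show ?thesis .
  qed
  define Q where "Q = ({..<d} \<rightarrow>\<^sub>E (\<rat> :: real set))"
  have Q: "countable Q" "Q \<subseteq> E"
    by (auto simp: Q_def E_def countable_rat intro!: countable_PiE)
  have dense: "\<exists>q\<in>Q. \<delta> q x < e" if "e > 0" "x \<in> E" for x e
  proof -
    have "\<exists>u\<in>\<rat>. \<bar>u - x i\<bar> < e / real (Suc d)" for i
    proof -
      have "x i < x i + e / real (Suc d)" using \<open>e > 0\<close> by simp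
      then obtain u where "u \<in> \<rat>" "x i < u" "u < x i + e / real (Suc d)"
        using Rats_dense_in_real by blast
      then show ?thesis by (intro bexI[of _ u]) auto
    qed
    then obtain u where u: "\<And>i. u i \<in> \<rat>" "\<And>i. \<bar>u i - x i\<bar> < e / real (Suc d)"
      by metis
    have "\<delta> (restrict u {..<d}) x \<le> (\<Sum>i<d. \<bar>restrict u {..<d} i - x i\<bar>)"
      unfolding \<delta>_def by (rule L2_set_le_sum_abs)
    also have "\<dots> \<le> (\<Sum>i<d. e / real (Suc d))"
      using u(2) by (intro sum_mono) (auto intro: less_imp_le)
    also have "\<dots> < e"
      using \<open>e > 0\<close> by (simp add: field_simps)
    finally show ?thesis
      using u(1) by (intro bexI[of _ "restrict u {..<d}"]) (auto simp: Q_def)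
  qed
  have 2: "U \<in> sets P" if U: "openin M.mtopology U" for U
  proof -
    define I where "I = {(q, r). q \<in> Q \<and> r \<in> (\<rat> :: real set) \<and> M.mball q r \<subseteq> U}"
    have "countable I"
      by (rule countable_subset[of _ "Q \<times> \<rat>"]) (auto simp: I_def Q countable_rat)
    have "U = (\<Union>(q, r)\<in>I. M.mball q r)"
    proof (intro equalityI subsetI)
      fix x assume x: "x \<in> U"
      then obtain e where e: "e > 0" "M.mball x e \<subseteq> U" and xE: "x \<in> E"
        using U unfolding M.openin_mtopology by blast
      obtain r where r: "r \<in> \<rat>" "0 < r" "r < e / 2"
        using Rats_dense_in_real[of 0 "e / 2"] e(1) by auto
      obtain q where q: "q \<in> Q" "\<delta> q x < r"
        using dense[OF r(2) xE] by blast
      have "M.mball q r \<subseteq> M.mball x e"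
      proof
        fix y assume "y \<in> M.mball q r"
        then have y: "y \<in> E" "q \<in> E" "\<delta> q y < r" by auto
        have "\<delta> x y \<le> \<delta> x q + \<delta> q y"
          using xE y by (intro M.triangle)
        then show "y \<in> M.mball x e"
          using xE y q(2) r(3) M.commute[of x q] by auto
      qed
      then have "(q, r) \<in> I"
        using q r e by (auto simp: I_def)
      moreover have "x \<in> M.mball q r"
        using q Q(2) xE by auto
      ultimately show "x \<in> (\<Union>(q, r)\<in>I. M.mball q r)" by blast
    qed (auto simp: I_def)
    also have "\<dots> \<in> sets P"
      using \<open>countable I\<close> Q(2) ball by (intro sets.countable_UN'') (auto simp: I_def)
    finally show ?thesis .
  qed
  have "sigma_sets (space P) {U. openin M.mtopology U} \<subseteq> sets P"
    using 2 by (intro sets.sigma_sets_subset) auto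
  then have "sets N \<subseteq> sets P"
    using N(1) spP unfolding borel_sets_of_def top by (simp add: E_def)
  with 1 show ?thesis
    using N(1) P by simp
qed

end

theory Submission
  imports Defs "HOL-Real_Asymp.Real_Asymp"
begin

text \<open>
  Let \<open>X\<close>, \<open>Y\<close> be independent standard Gaussian vectors and \<open>X\<^sub>\<theta> = cos \<theta> X + sin \<theta> Y\<close>. For a set \<open>A\<close> and
  the complement \<open>B\<close> of its enlargement, take a function \<open>F\<close> that equals \<open>exp (- W)\<close> on \<open>A\<close>, vanishes on \<open>B\<close> and
  has slope at most of order \<open>exp (- W) / t\<close> in between. The mean of \<open>|F X - F X\<^sub>\<theta>|\<close> is estimated in two ways.

  From above, by stationarity the path from \<open>0\<close> to \<open>\<theta>\<close> is cut into many small symmetric rotations. Such an increment is an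
  odd Lipschitz function of \<open>Y\<close>, so concentration bounds its mean independently of the dimension, and the
  total is at most \<open>4 \<theta>\<close> times the mean slope of \<open>F\<close>, i.e. of order \<open>\<theta> (\<mu>\<^sup>+(A) + L \<mu>(A))\<close>.

  From below, the Prekopa-Leindler inequality shows that only a small part of the mass of \<open>F\<close> persists under a rotation
  by an angle \<open>\<theta>\<close> of order \<open>1 / sqrt (ln (1 / \<mu>(A)))\<close>. For small \<open>\<mu>(A)\<close> this yields
  \<open>\<mu>\<^sup>+(A) \<ge> c \<mu>(A) sqrt (ln (1 / \<mu>(A)))\<close>, which is of the order of the Gaussian profile. When neither
  \<open>\<mu>(A)\<close> nor its complement is small, \<open>\<theta> = \<pi>/2\<close> and a cutoff of \<open>W\<close> in place of \<open>exp (- W)\<close> suffice.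
\<close>

section \<open>The Prekopa-Leindler inequality\<close>

text \<open>The main dimension-free input is the quadratic gain in the Gaussian Prekopa-Leindler
  inequality: equal weights give concentration, the weights \<open>c^2\<close> and
  \<open>s^2\<close> of a rotation give the persistence estimate. Errors that depend on the
  dimension occur when increments are localized, but they vanish as the angle is subdivided in a
  fixed dimension.

  The obstacle is that \<open>exp (- W)\<close> may be unbounded and may approach zero, so \<mu> and
  the Gaussian measure are not comparable up to constants. What depends on \<open>L\<close> alone is
  a bound \<open>expC\<close> for the Gaussian means of \<open>exp (2 * W)\<close> and
  \<open>exp (- 2 * W)\<close>. It limits the mass sitting where the density is small and converts
  lower bounds on \<mu> into lower bounds on the Gaussian measure.

  A Borel set has no smooth boundary, so the argument runs at fixed \<open>t\<close> with two sets
  at distance at least \<open>t\<close> and the layer \<open>C\<close> between them, and bounds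
  \<open>measure \<mu> C / t\<close> from below; the lower limit is taken only at the end. Either
  set may play the role of \<open>A\<close>, so for small measures the lighter of the two is
  used.\<close>

abbreviation lborel2 :: "(real \<times> real) measure" where "lborel2 \<equiv> lborel \<Otimes>\<^sub>M lborel"

abbreviation borel2 :: "(real \<times> real) measure" where "borel2 \<equiv> borel \<Otimes>\<^sub>M borel"

lemma emeasure_lborel_affine_image:
  fixes A :: "real set"
  assumes c: "c > 0" and [measurable]: "A \<in> sets borel" "(\<lambda>x. t + c * x) ` A \<in> sets borel"
  shows "emeasure lborel ((\<lambda>x. t + c * x) ` A) = ennreal c * emeasure lborel A"
proof -
  have "emeasure lborel ((\<lambda>x. t + c * x) ` A) = (\<integral>\<^sup>+x. indicator ((\<lambda>x. t + c * x) ` A) x \<partial>lborel)"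
    by simp
  also have "... = ennreal \<bar>c\<bar> * (\<integral>\<^sup>+x. indicator ((\<lambda>x. t + c * x) ` A) (t + c * x) \<partial>lborel)"
    using c by (intro nn_integral_real_affine) auto
  also have "(\<lambda>x. indicator ((\<lambda>x. t + c * x) ` A) (t + c * x) :: ennreal) = indicator A"
    using c by (auto simp: fun_eq_iff indicator_def image_iff)
  finally show ?thesis using c by simp
qed

text \<open>In one dimension two pieces suffice: the copy of \<open>K\<close> shifted by the minimum
  of \<open>K'\<close> and the copy of \<open>K'\<close> shifted by the maximum of \<open>K\<close>,
  suitably scaled. Both lie in \<open>C\<close>, and they meet in at most one point, so their
  measures add.\<close>

lemma brunn_minkowski_compact:
  fixes K K' C :: "real set"
  assumes K: "compact K" "K \<noteq> {}" and K': "compact K'" "K' \<noteq> {}" and C[measurable]: "C \<in> sets borel"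
    and s: "0 < s" "s < 1" and sub: "\<And>a b. a \<in> K \<Longrightarrow> b \<in> K' \<Longrightarrow> (1 - s) * a + s * b \<in> C"
  shows "ennreal (1 - s) * emeasure lborel K + ennreal s * emeasure lborel K' \<le> emeasure lborel C"
proof -
  obtain a0 where a0: "a0 \<in> K" "\<And>a. a \<in> K \<Longrightarrow> a \<le> a0"
    using compact_attains_sup[OF K] by blast
  obtain b0 where b0: "b0 \<in> K'" "\<And>b. b \<in> K' \<Longrightarrow> b0 \<le> b"
    using compact_attains_inf[OF K'] by blast
  define S1 where "S1 = (\<lambda>x. s * b0 + (1 - s) * x) ` K"
  define S2 where "S2 = (\<lambda>x. (1 - s) * a0 + s * x) ` K'"
  have "compact S1" "compact S2"
    unfolding S1_def S2_def by (intro compact_continuous_image continuous_intros K K')+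
  then have S[measurable]: "S1 \<in> sets borel" "S2 \<in> sets borel"
    by (auto simp: borel_compact)
  have KK: "K \<in> sets borel" "K' \<in> sets borel"
    using K K' by (auto simp: borel_compact)
  have e1: "emeasure lborel S1 = ennreal (1 - s) * emeasure lborel K"
    using S KK s unfolding S1_def by (intro emeasure_lborel_affine_image) auto
  have e2: "emeasure lborel S2 = ennreal s * emeasure lborel K'"
    using S KK s unfolding S2_def by (intro emeasure_lborel_affine_image) auto
  have "S1 \<inter> S2 \<subseteq> {s * b0 + (1 - s) * a0}"
  proof
    fix z assume "z \<in> S1 \<inter> S2"
    then obtain a b where "a \<in> K" "b \<in> K'" "z = s * b0 + (1 - s) * a" "z = (1 - s) * a0 + s * b"
      by (auto simp: S1_def S2_def)
    moreover have "(1 - s) * a \<le> (1 - s) * a0" "s * b0 \<le> s * b"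
      using a0 b0 calculation s by (auto intro!: mult_left_mono)
    ultimately have "z = s * b0 + (1 - s) * a0" by linarith
    then show "z \<in> {s * b0 + (1 - s) * a0}" by simp
  qed
  then have "S1 \<inter> S2 \<in> null_sets lborel"
    by (meson finite.emptyI finite.insertI finite_imp_null_set_lborel finite_subset)
  then have "emeasure lborel (S1 \<union> S2) = emeasure lborel S1 + emeasure lborel S2"
    by (intro emeasure_Un') auto
  moreover have "emeasure lborel (S1 \<union> S2) \<le> emeasure lborel C"
    using sub a0 b0 by (intro emeasure_mono) (auto simp: S1_def S2_def add.commute)
  ultimately show ?thesis by (simp add: e1 e2)
qed

lemma emeasure_lborel_inner_regular:
  fixes A :: "real set"
  assumes A[measurable]: "A \<in> sets borel" and fin: "emeasure lborel A < \<infinity>"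
  shows "emeasure lborel A = (SUP K\<in>{K. K \<subseteq> A \<and> compact K}. emeasure lborel K)"
proof -
  \<comment> \<open>Restricting Lebesgue measure to \<open>A\<close> gives a finite Borel measure,
    for which inner regularity by compact sets is available.\<close>
  define M where "M = density lborel (indicator A)"
  have *: "emeasure M B = emeasure lborel (A \<inter> B)" if [measurable]: "B \<in> sets borel" for B
    unfolding M_def by (subst emeasure_density) (auto simp flip: indicator_inter_arith)
  have "emeasure M A = (SUP K\<in>{K. K \<subseteq> A \<and> compact K}. emeasure M K)"
    using fin by (intro inner_regular) (auto simp: M_def emeasure_density)
  also have "... = (SUP K\<in>{K. K \<subseteq> A \<and> compact K}. emeasure lborel K)"
    by (intro SUP_cong refl) (auto simp: * borel_compact Int_absorb1)
  finally show ?thesis by (simp add: *)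
qed

lemma brunn_minkowski_real:
  fixes A B C :: "real set"
  assumes [measurable]: "A \<in> sets borel" "B \<in> sets borel" "C \<in> sets borel"
    and ne: "A \<noteq> {}" "B \<noteq> {}"
    and fin: "emeasure lborel A < \<infinity>" "emeasure lborel B < \<infinity>"
    and s: "0 < s" "s < 1" and sub: "\<And>a b. a \<in> A \<Longrightarrow> b \<in> B \<Longrightarrow> (1 - s) * a + s * b \<in> C"
  shows "ennreal (1 - s) * emeasure lborel A + ennreal s * emeasure lborel B \<le> emeasure lborel C"
proof -
  obtain a b where ab: "a \<in> A" "b \<in> B" using ne by auto
  have *: "ennreal (1 - s) * emeasure lborel K + ennreal s * emeasure lborel K' \<le> emeasure lborel C"
    if K: "K \<subseteq> A" "compact K" "K' \<subseteq> B" "compact K'" for K K'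
  proof -
    have [measurable]: "K \<in> sets borel" "K' \<in> sets borel"
      using K by (auto simp: borel_compact)
    \<comment> \<open>The compact subsets may be empty. Adding one point of \<open>A\<close> and one
      of \<open>B\<close> makes the compact case applicable.\<close>
    have "ennreal (1 - s) * emeasure lborel K + ennreal s * emeasure lborel K'
      \<le> ennreal (1 - s) * emeasure lborel (insert a K) + ennreal s * emeasure lborel (insert b K')"
      by (intro add_mono mult_left_mono emeasure_mono) auto
    also have "... \<le> emeasure lborel C"
      using K ab s sub by (intro brunn_minkowski_compact) auto
    finally show ?thesis .
  qed
  let ?KA = "{K. K \<subseteq> A \<and> compact K}" and ?KB = "{K. K \<subseteq> B \<and> compact K}"
  have neK: "?KA \<noteq> {}" "?KB \<noteq> {}" by auto
  have "ennreal (1 - s) * emeasure lborel A + ennreal s * emeasure lborel B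
      = (SUP K\<in>?KA. ennreal (1 - s) * emeasure lborel K + ennreal s * emeasure lborel B)"
    by (subst ennreal_SUP_add_left[OF neK(1)])
       (simp add: emeasure_lborel_inner_regular[OF _ fin(1)] SUP_mult_left_ennreal)
  also have "... = (SUP K\<in>?KA. SUP K'\<in>?KB. ennreal (1 - s) * emeasure lborel K + ennreal s * emeasure lborel K')"
    by (subst ennreal_SUP_add_right[OF neK(2), symmetric])
       (simp add: emeasure_lborel_inner_regular[OF _ fin(2)] SUP_mult_left_ennreal)
  also have "... \<le> emeasure lborel C"
    using * by (intro SUP_least) auto
  finally show ?thesis .
qed

text \<open>Layer-cake formula with the levels cut off at 1, since functions will be normalized to
  have supremum 1.\<close>

lemma nn_integral_level_sets:
  fixes u :: "real \<Rightarrow> real"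
  assumes [measurable]: "u \<in> borel_measurable borel" and u: "\<And>x. 0 \<le> u x"
  shows "(\<integral>\<^sup>+r. emeasure lborel {x. r < u x} * indicator {0<..<1} r \<partial>lborel) =
    (\<integral>\<^sup>+x. ennreal (min 1 (u x)) \<partial>lborel)"
proof -
  have "(\<integral>\<^sup>+r. emeasure lborel {x. r < u x} * indicator {0<..<1} r \<partial>lborel)
      = (\<integral>\<^sup>+r. \<integral>\<^sup>+x. indicator {x. r < u x} x * indicator {0<..<1} r \<partial>lborel \<partial>lborel)"
    by (intro nn_integral_cong) (simp add: nn_integral_multc)
  also have "... = (\<integral>\<^sup>+r. \<integral>\<^sup>+x. indicator {0<..<min 1 (u x)} r \<partial>lborel \<partial>lborel)"
    by (intro nn_integral_cong) (auto simp: indicator_def)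
  also have "... = (\<integral>\<^sup>+x. \<integral>\<^sup>+r. indicator {0<..<min 1 (u x)} r \<partial>lborel \<partial>lborel)"
  proof (rule lborel_pair.Fubini')
    have "(\<lambda>(x, r). indicator {0<..<min 1 (u x)} r :: ennreal)
       = (\<lambda>p. indicator {p. 0 < snd p \<and> snd p < min 1 (u (fst p))} p)"
      by (auto simp: fun_eq_iff indicator_def)
    also have "... \<in> borel_measurable lborel2" by measurable
    finally show "(\<lambda>(x, r). indicator {0<..<min 1 (u x)} r :: ennreal) \<in> borel_measurable lborel2" .
  qed
  also have "... = (\<integral>\<^sup>+x. ennreal (min 1 (u x)) \<partial>lborel)"
    using u by (intro nn_integral_cong) (simp)
  finally show ?thesis .
qed

lemma weighted_AM_GM:
  fixes a b :: real
  assumes "0 \<le> a" "0 \<le> b" "0 < s" "s < 1"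
  shows "a powr (1 - s) * b powr s \<le> (1 - s) * a + s * b"
  using Youngs_inequality_0[of "1 - s" s a b] assms by (cases "a = 0 \<or> b = 0") auto

text \<open>Dividing \<open>f\<close> and \<open>g\<close> by their suprema makes the superlevel
  sets nonempty at every level in (0,1), so Brunn-Minkowski applies to each level. Integrating over
  the levels gives an arithmetic-mean inequality, which weighted AM-GM turns into the geometric one;
  the normalizations then cancel.\<close>

theorem prekopa_leindler_real:
  fixes f g h :: "real \<Rightarrow> real"
  assumes [measurable]: "f \<in> borel_measurable borel" "g \<in> borel_measurable borel" "h \<in> borel_measurable borel"
    and int: "integrable lborel f" "integrable lborel g" "integrable lborel h"
    and f: "\<And>x. 0 \<le> f x" "\<And>x. f x \<le> K" and g: "\<And>x. 0 \<le> g x" "\<And>x. g x \<le> K"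
    and s: "0 < s" "s < 1"
    and h: "\<And>x y. f x powr (1 - s) * g y powr s \<le> h ((1 - s) * x + s * y)"
  shows "(LINT x|lborel. f x) powr (1 - s) * (LINT x|lborel. g x) powr s \<le> (LINT x|lborel. h x)"
proof -
  have h0: "0 \<le> h x" for x
    using h[of x x] by (simp add: algebra_simps) (meson mult_nonneg_nonneg order_trans powr_ge_zero)
  show ?thesis
  proof (cases "(\<forall>x. f x = 0) \<or> (\<forall>x. g x = 0)")
    case True
    then show ?thesis using h0 by (auto intro!: integral_nonneg)
  next
    case False
    define a b where "a = (SUP x. f x)" and "b = (SUP x. g x)"
    have bdd: "bdd_above (range f)" "bdd_above (range g)"
      using f g by (auto intro!: bdd_aboveI[of _ K])
    have le: "f x \<le> a" "g x \<le> b" for x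
      unfolding a_def b_def using bdd by (auto intro: cSUP_upper)
    have pos: "a > 0" "b > 0"
      using False le f(1) g(1) by (metis order_le_less order_less_le_trans)+
    define c where "c = a powr (1 - s) * b powr s"
    have c: "c > 0" using pos by (simp add: c_def)
    have level: "ennreal (1 - s) * emeasure lborel {x. r < f x / a} + ennreal s * emeasure lborel {x. r < g x / b}
        \<le> emeasure lborel {x. r < h x / c}" if r: "0 < r" "r < 1" for r
    proof (rule brunn_minkowski_real)
      have "r * a < a" "r * b < b" using r pos by auto
      then obtain x y where "r * a < f x" "r * b < g y"
        unfolding a_def b_def using bdd by (metis UNIV_not_empty imageE less_cSUP_iff)
      then show "{x. r < f x / a} \<noteq> {}" "{x. r < g x / b} \<noteq> {}"
        using pos by (auto simp: field_simps)
      have "emeasure lborel {x. r < f x / a} \<le> emeasure lborel {x \<in> space lborel. r * a \<le> f x}"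
        using pos by (intro emeasure_mono) (auto simp: field_simps)
      also have "... < \<infinity>"
        using int(1) r pos f(1) by (intro order.strict_trans1[OF integral_Markov_inequality]) auto
      finally show "emeasure lborel {x. r < f x / a} < \<infinity>" .
      have "emeasure lborel {x. r < g x / b} \<le> emeasure lborel {x \<in> space lborel. r * b \<le> g x}"
        using pos by (intro emeasure_mono) (auto simp: field_simps)
      also have "... < \<infinity>"
        using int(2) r pos g(1) by (intro order.strict_trans1[OF integral_Markov_inequality]) auto
      finally show "emeasure lborel {x. r < g x / b} < \<infinity>" .
      fix x y assume "x \<in> {x. r < f x / a}" "y \<in> {x. r < g x / b}"
      then have xy: "r * a < f x" "r * b < g y" using pos by (auto simp: field_simps)
      have "r * c = (r * a) powr (1 - s) * (r * b) powr s"
        using r pos unfolding c_def by (simp add: powr_mult) (simp add: powr_diff algebra_simps)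
      also have "... < f x powr (1 - s) * g y powr s"
      proof (intro mult_strict_mono powr_less_mono2 xy)
        have "0 < r * a" "0 < r * b" using r pos by auto
        then show "0 < f x powr (1 - s)" using xy by simp
      qed (use r pos s in auto)
      also have "... \<le> h ((1 - s) * x + s * y)" by (rule h)
      finally show "(1 - s) * x + s * y \<in> {x. r < h x / c}"
        using c by (auto simp: field_simps)
    qed (use s in auto)
    have "ennreal ((1 - s) * (integral\<^sup>L lborel f / a) + s * (integral\<^sup>L lborel g / b))
        = ennreal (1 - s) * (\<integral>\<^sup>+x. ennreal (f x / a) \<partial>lborel) + ennreal s * (\<integral>\<^sup>+x. ennreal (g x / b) \<partial>lborel)"
      using s int pos f g
      by (subst (1 2) nn_integral_eq_integral)
         (auto simp: ennreal_plus ennreal_mult integral_nonneg simp del: times_divide_eq_right)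
    also have "... = ennreal (1 - s) * (\<integral>\<^sup>+x. ennreal (min 1 (f x / a)) \<partial>lborel)
        + ennreal s * (\<integral>\<^sup>+x. ennreal (min 1 (g x / b)) \<partial>lborel)"
      using le pos by (simp add: min_absorb2)
    also have "... = (\<integral>\<^sup>+r. (ennreal (1 - s) * emeasure lborel {x. r < f x / a} +
        ennreal s * emeasure lborel {x. r < g x / b}) * indicator {0<..<1} r \<partial>lborel)"
      using pos f(1) g(1)
      by (simp add: nn_integral_level_sets[symmetric] nn_integral_add[symmetric]
          nn_integral_cmult[symmetric] distrib_right mult.assoc)
    also have "... \<le> (\<integral>\<^sup>+r. emeasure lborel {x. r < h x / c} * indicator {0<..<1} r \<partial>lborel)"
      using level by (intro nn_integral_mono) (auto simp: indicator_def)
    also have "... = (\<integral>\<^sup>+x. ennreal (min 1 (h x / c)) \<partial>lborel)"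
      using c h0 by (intro nn_integral_level_sets) auto
    also have "... \<le> (\<integral>\<^sup>+x. ennreal (h x / c) \<partial>lborel)"
      by (intro nn_integral_mono ennreal_leI) auto
    also have "... = ennreal (integral\<^sup>L lborel h / c)"
      using int(3) h0 c by (subst nn_integral_eq_integral) auto
    finally have "(1 - s) * (integral\<^sup>L lborel f / a) + s * (integral\<^sup>L lborel g / b) \<le> integral\<^sup>L lborel h / c"
      using c h0 by (subst (asm) ennreal_le_iff) (auto intro!: divide_nonneg_pos integral_nonneg)
    moreover have "(integral\<^sup>L lborel f / a) powr (1 - s) * (integral\<^sup>L lborel g / b) powr s \<le>
        (1 - s) * (integral\<^sup>L lborel f / a) + s * (integral\<^sup>L lborel g / b)"
      using pos f g s by (intro weighted_AM_GM) (auto intro!: divide_nonneg_pos integral_nonneg)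
    ultimately have "(integral\<^sup>L lborel f / a) powr (1 - s) * (integral\<^sup>L lborel g / b) powr s \<le> integral\<^sup>L lborel h / c"
      by linarith
    moreover have "(integral\<^sup>L lborel f / a) powr (1 - s) * (integral\<^sup>L lborel g / b) powr s
       = (integral\<^sup>L lborel f) powr (1 - s) * (integral\<^sup>L lborel g) powr s / c"
      using pos f g by (simp add: c_def powr_divide integral_nonneg)
    ultimately show ?thesis using c by (simp add: divide_le_cancel)
  qed
qed

section \<open>Gaussian product measures and the tensorized Prekopa-Leindler inequality\<close>

abbreviation gauss1 :: "real measure" where
  "gauss1 \<equiv> density lborel std_normal_density"

text \<open>An arbitrary index set, rather than a dimension, allows induction by inserting one
  coordinate.\<close>

definition gauss :: "nat set \<Rightarrow> (nat \<Rightarrow> real) measure" where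
  "gauss I = (\<Pi>\<^sub>M i\<in>I. gauss1)"

text \<open>The restriction to \<open>I\<close> puts the result into the space of
  \<open>gauss I\<close> whatever the arguments are outside \<open>I\<close>. Rotations, shifts,
  segments and reflections are all written with \<open>comb\<close>.\<close>

definition comb :: "nat set \<Rightarrow> real \<Rightarrow> (nat \<Rightarrow> real) \<Rightarrow> real \<Rightarrow> (nat \<Rightarrow> real) \<Rightarrow> nat \<Rightarrow> real" where
  "comb I a x b y = (\<lambda>i\<in>I. a * x i + b * y i)"

lemma comb_apply [simp]: "i \<in> I \<Longrightarrow> comb I a x b y i = a * x i + b * y i"
  by (simp add: comb_def)

lemma comb_insert:
  "i \<notin> I \<Longrightarrow> comb (insert i I) a (x(i := u)) b (y(i := v)) = (comb I a x b y)(i := a * u + b * v)"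
  by (auto simp: comb_def fun_eq_iff restrict_def)

interpretation gauss1: prob_space gauss1
  by (rule prob_space_normal_density) simp

interpretation gauss_prod: product_sigma_finite "\<lambda>_::nat. gauss1"
  by standard

lemma prob_space_gauss: "prob_space (gauss I)"
  unfolding gauss_def by (rule prob_space_PiM) (rule gauss1.prob_space_axioms)

interpretation gauss: prob_space "gauss I" for I
  by (rule prob_space_gauss)

abbreviation Rn :: "nat set \<Rightarrow> (nat \<Rightarrow> real) set" where "Rn I \<equiv> space (gauss I)"

lemma space_gauss: "Rn I = I \<rightarrow>\<^sub>E UNIV"
  by (simp add: gauss_def space_PiM)

lemma std_gaussian_eq: "std_gaussian d = gauss {..<d}"
  by (simp add: std_gaussian_def gauss_def)

lemma comb_in_space [simp]: "comb I a x b y \<in> Rn I"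
  by (simp add: space_gauss comb_def)

lemma measurable_comb [measurable (raw)]:
  assumes [measurable]: "f \<in> measurable M (gauss I)" "g \<in> measurable M (gauss I)"
  shows "(\<lambda>w. comb I a (f w) b (g w)) \<in> measurable M (gauss I)"
proof -
  have "(\<lambda>w. f w i) \<in> borel_measurable M" "(\<lambda>w. g w i) \<in> borel_measurable M" if "i \<in> I" for i
    using measurable_compose[OF assms(1)[unfolded gauss_def] measurable_component_singleton[OF that]]
      measurable_compose[OF assms(2)[unfolded gauss_def] measurable_component_singleton[OF that]]
    by simp_all
  then show ?thesis
    unfolding comb_def gauss_def by (intro measurable_restrict) simp
qed

lemma measurable_gauss_component [measurable]: "i \<in> I \<Longrightarrow> (\<lambda>x. x i) \<in> borel_measurable (gauss I)"
  unfolding gauss_def using measurable_component_singleton[of i I "\<lambda>_. gauss1"] by simp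

lemma measurable_gauss_update:
  "(\<lambda>p. (fst p)(i := snd p)) \<in> measurable (gauss I \<Otimes>\<^sub>M gauss1) (gauss (insert i I))"
  unfolding gauss_def using measurable_add_dim[of i I "\<lambda>_. gauss1"] by (simp add: case_prod_beta')

lemma update_in_space: "x \<in> Rn I \<Longrightarrow> x(i := u) \<in> Rn (insert i I)"
  by (auto simp: space_gauss PiE_def extensional_def)

lemma borel_measurable_gauss_section:
  assumes x: "x \<in> Rn I" and f: "f \<in> borel_measurable (gauss (insert i I))"
  shows "(\<lambda>u. f (x(i := u))) \<in> borel_measurable borel"
proof -
  have "(\<lambda>u. x(i := u)) \<in> measurable gauss1 (gauss (insert i I))"
    using measurable_compose[OF measurable_Pair1'[OF x] measurable_gauss_update]
    by (simp only: fst_conv snd_conv)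
  from measurable_compose[OF this f] show ?thesis
    by (simp del: fun_upd_apply)
qed

lemma borel_measurable_gauss_partial_integral:
  fixes f :: "_ \<Rightarrow> real"
  assumes f: "f \<in> borel_measurable (gauss (insert i I))"
  shows "(\<lambda>x. LINT u|gauss1. f (x(i := u))) \<in> borel_measurable (gauss I)"
proof (rule gauss1.borel_measurable_lebesgue_integral)
  show "(\<lambda>(x, u). f (x(i := u))) \<in> borel_measurable (gauss I \<Otimes>\<^sub>M gauss1)"
    using measurable_compose[OF measurable_gauss_update f] by (simp add: case_prod_beta')
qed

lemma gauss_integral_insert:
  fixes f :: "_ \<Rightarrow> real"
  assumes "finite I" "i \<notin> I" "f \<in> borel_measurable (gauss (insert i I))"
    and "\<And>x. x \<in> Rn (insert i I) \<Longrightarrow> \<bar>f x\<bar> \<le> K"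
  shows "integral\<^sup>L (gauss (insert i I)) f = (LINT x|gauss I. (LINT u|gauss1. f (x(i := u))))"
proof -
  have "integrable (gauss (insert i I)) f"
    using assms by (intro gauss.integrable_const_bound[of _ K]) auto
  then show ?thesis
    using assms unfolding gauss_def by (intro gauss_prod.product_integral_insert)
qed

lemma gauss_nn_integral_insert:
  assumes "finite I" "i \<notin> I" "f \<in> borel_measurable (gauss (insert i I))"
  shows "integral\<^sup>N (gauss (insert i I)) f = (\<integral>\<^sup>+x. (\<integral>\<^sup>+u. f (x(i := u)) \<partial>gauss1) \<partial>gauss I)"
  using assms unfolding gauss_def by (intro gauss_prod.product_nn_integral_insert)

abbreviation "\<phi> \<equiv> std_normal_density"

text \<open>This is the identity \<open>(1 - s) * x^2 + s * y^2 = ((1 - s) * x + s * y)^2 + s * (1 -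
  s) * (x - y)^2\<close> in exponential form. Its last term is the gain that Lebesgue measure does
  not offer.\<close>

lemma std_normal_density_interpolate:
  "\<phi> x powr (1 - s) * \<phi> y powr s =
   \<phi> ((1 - s) * x + s * y) * exp (- (s * (1 - s) / 2 * (x - y)^2))"
proof -
  let ?c = "1 / sqrt (2 * pi)"
  have *: "\<phi> x = ?c * exp (- x\<^sup>2 / 2)" for x
    by (simp add: std_normal_density_def)
  have "\<phi> x powr (1 - s) * \<phi> y powr s
      = (?c powr (1 - s) * ?c powr s) * (exp (- x\<^sup>2 / 2 * (1 - s)) * exp (- y\<^sup>2 / 2 * s))"
    unfolding * by (subst (1 2) powr_mult) (simp_all add: powr_def mult_ac)
  also have "?c powr (1 - s) * ?c powr s = ?c"
    by (simp flip: powr_add)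
  also have "exp (- x\<^sup>2 / 2 * (1 - s)) * exp (- y\<^sup>2 / 2 * s) =
     exp (- ((1 - s) * x + s * y)\<^sup>2 / 2) * exp (- (s * (1 - s) / 2 * (x - y)\<^sup>2))"
    unfolding exp_add[symmetric] by (rule arg_cong[of _ _ exp]) (simp add: field_simps power2_eq_square)
  finally show ?thesis unfolding * by simp
qed

lemma std_normal_density_le_1: "\<phi> x \<le> 1"
proof -
  have "1 \<le> sqrt (2 * pi)" using pi_ge_two by simp
  then show ?thesis unfolding std_normal_density_def by (intro mult_le_one) auto
qed

text \<open>The density is absorbed into the three functions. The constant \<open>c\<close> will
  carry the Gaussian factor of the remaining coordinates in the induction.\<close>

lemma prekopa_leindler_gauss1:
  fixes f g h :: "real \<Rightarrow> real"
  assumes [measurable]: "f \<in> borel_measurable borel" "g \<in> borel_measurable borel" "h \<in> borel_measurable borel"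
    and f: "\<And>x. 0 \<le> f x" "\<And>x. f x \<le> K" and g: "\<And>x. 0 \<le> g x" "\<And>x. g x \<le> K"
    and h: "\<And>x. 0 \<le> h x" "\<And>x. h x \<le> K"
    and s: "0 < s" "s < 1" and c: "c > 0"
    and fgh: "\<And>x y. f x powr (1 - s) * g y powr s * exp (- (s * (1 - s) / 2 * (x - y)^2)) * c
                \<le> h ((1 - s) * x + s * y)"
  shows "(LINT x|gauss1. f x) powr (1 - s) * (LINT x|gauss1. g x) powr s * c \<le> (LINT x|gauss1. h x)"
proof -
  have \<phi>: "0 \<le> \<phi> x" "\<phi> x \<le> 1" for x
    by (simp_all add: std_normal_density_le_1)
  have K: "0 \<le> K" using f order_trans by blast
  have i\<phi>: "integrable lborel \<phi>" by (rule integrable_normal_density) simp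
  have int: "integrable lborel (\<lambda>x. \<phi> x * u x)"
    if [measurable]: "u \<in> borel_measurable borel" and u: "\<And>x. 0 \<le> u x" "\<And>x. u x \<le> K" for u
    using u \<phi> K by (intro Bochner_Integration.integrable_bound[OF integrable_mult_left[OF i\<phi>, of K]])
       (auto simp: abs_mult intro!: mult_left_mono AE_I2)
  have eq: "(LINT x|gauss1. u x) = (LINT x|lborel. \<phi> x * u x)"
    if [measurable]: "u \<in> borel_measurable borel" for u :: "real \<Rightarrow> real"
    by (subst integral_density) auto
  have "(LINT x|lborel. \<phi> x * f x) powr (1 - s) * (LINT x|lborel. \<phi> x * g x) powr s \<le> (LINT x|lborel. (\<phi> x * h x) / c)"
  proof (rule prekopa_leindler_real[where K = K])
    fix x y :: real
    show "\<phi> x * f x \<le> K" "\<phi> x * g x \<le> K"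
      using \<phi> f g mult_left_le_one_le order_trans by metis+
    let ?z = "(1 - s) * x + s * y"
    have "(\<phi> x * f x) powr (1 - s) * (\<phi> y * g y) powr s =
      (\<phi> x powr (1 - s) * \<phi> y powr s) * (f x powr (1 - s) * g y powr s)"
      using \<phi> f g by (simp add: powr_mult mult_ac)
    also have "\<phi> x powr (1 - s) * \<phi> y powr s = \<phi> ?z * exp (- (s * (1 - s) / 2 * (x - y)^2))"
      by (rule std_normal_density_interpolate)
    also have "\<phi> ?z * exp (- (s * (1 - s) / 2 * (x - y)^2)) * (f x powr (1 - s) * g y powr s)
       = \<phi> ?z * (f x powr (1 - s) * g y powr s * exp (- (s * (1 - s) / 2 * (x - y)^2)) * c) / c"
      using c by simp
    also have "... \<le> \<phi> ?z * h ?z / c"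
      using fgh[of x y] \<phi> c by (intro divide_right_mono mult_left_mono) auto
    finally show "(\<phi> x * f x) powr (1 - s) * (\<phi> y * g y) powr s \<le> \<phi> ?z * h ?z / c" .
  qed (use \<phi> f g h s int in auto)
  then show ?thesis using c by (simp add: eq field_simps)
qed

text \<open>Induction on coordinates: the one-dimensional inequality in the new coordinate, with the
  other coordinates frozen, says that the partial integrals again satisfy the hypothesis. The
  exponential factor splits because squared distances add.\<close>

theorem prekopa_leindler_gauss:
  assumes "finite I"
    and "f \<in> borel_measurable (gauss I)" "g \<in> borel_measurable (gauss I)" "h \<in> borel_measurable (gauss I)"
    and "\<And>x. x \<in> Rn I \<Longrightarrow> 0 \<le> f x \<and> f x \<le> K"
    and "\<And>x. x \<in> Rn I \<Longrightarrow> 0 \<le> g x \<and> g x \<le> K"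
    and "\<And>x. x \<in> Rn I \<Longrightarrow> 0 \<le> h x \<and> h x \<le> K"
    and s: "0 < s" "s < 1"
    and "\<And>x y. x \<in> Rn I \<Longrightarrow> y \<in> Rn I \<Longrightarrow>
       f x powr (1 - s) * g y powr s * exp (- (s * (1 - s) / 2 * (\<Sum>i\<in>I. (x i - y i)^2)))
         \<le> h (comb I (1 - s) x s y)"
  shows "(LINT x|gauss I. f x) powr (1 - s) * (LINT x|gauss I. g x) powr s \<le> (LINT x|gauss I. h x)"
  using assms(1-7,10)
proof (induction I arbitrary: f g h rule: finite_induct)
  case empty
  have e: "gauss {} = count_space {\<lambda>_. undefined}"
    by (simp add: gauss_def PiM_empty)
  have *: "comb {} (1 - s) (\<lambda>_. undefined) s (\<lambda>_. undefined) = (\<lambda>_. undefined)"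
    by (simp add: comb_def restrict_def)
  show ?case
    using empty(7)[of "\<lambda>_. undefined" "\<lambda>_. undefined"] empty(4-6)
    by (simp add: e * lebesgue_integral_count_space_finite)
next
  case (insert i I)
  let ?G = "gauss (insert i I)"
  have bnd: "0 \<le> (LINT u|gauss1. k (x(i := u))) \<and> (LINT u|gauss1. k (x(i := u))) \<le> K"
    if "\<And>x. x \<in> space ?G \<Longrightarrow> 0 \<le> k x \<and> k x \<le> K" "k \<in> borel_measurable ?G" "x \<in> Rn I"
    for k :: "_ \<Rightarrow> real" and x
  proof
    have b: "0 \<le> k (x(i := u))" "k (x(i := u)) \<le> K" for u
      using that update_in_space by auto
    then show "0 \<le> (LINT u|gauss1. k (x(i := u)))" by simp
    show "(LINT u|gauss1. k (x(i := u))) \<le> K"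
      using b borel_measurable_gauss_section[OF that(3,2)]
      by (intro gauss1.integral_le_const gauss1.integrable_const_bound[of _ K]) auto
  qed
  have "(LINT x|gauss I. (LINT u|gauss1. f (x(i := u)))) powr (1 - s) *
      (LINT x|gauss I. (LINT u|gauss1. g (x(i := u)))) powr s \<le> (LINT x|gauss I. (LINT u|gauss1. h (x(i := u))))"
  proof (rule insert.IH)
    show "(\<lambda>x. LINT u|gauss1. f (x(i := u))) \<in> borel_measurable (gauss I)"
      "(\<lambda>x. LINT u|gauss1. g (x(i := u))) \<in> borel_measurable (gauss I)"
      "(\<lambda>x. LINT u|gauss1. h (x(i := u))) \<in> borel_measurable (gauss I)"
      using insert.prems(1-3) by (auto intro: borel_measurable_gauss_partial_integral)
    fix x y assume xy: "x \<in> Rn I" "y \<in> Rn I"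
    show "0 \<le> (LINT u|gauss1. f (x(i := u))) \<and> (LINT u|gauss1. f (x(i := u))) \<le> K"
      "0 \<le> (LINT u|gauss1. g (x(i := u))) \<and> (LINT u|gauss1. g (x(i := u))) \<le> K"
      "0 \<le> (LINT u|gauss1. h (x(i := u))) \<and> (LINT u|gauss1. h (x(i := u))) \<le> K"
      by (rule bnd[OF insert.prems(4,1) xy(1)] bnd[OF insert.prems(5,2) xy(1)] bnd[OF insert.prems(6,3) xy(1)]; assumption)+
    let ?z = "comb I (1 - s) x s y" and ?c = "exp (- (s * (1 - s) / 2 * (\<Sum>i\<in>I. (x i - y i)^2)))"
    show "(LINT u|gauss1. f (x(i := u))) powr (1 - s) * (LINT u|gauss1. g (y(i := u))) powr s * ?c
       \<le> (LINT u|gauss1. h (?z(i := u)))"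
    proof (rule prekopa_leindler_gauss1[where K = K])
      show "(\<lambda>u. f (x(i := u))) \<in> borel_measurable borel" "(\<lambda>u. g (y(i := u))) \<in> borel_measurable borel"
        "(\<lambda>u. h (?z(i := u))) \<in> borel_measurable borel"
        by (rule borel_measurable_gauss_section insert.prems xy comb_in_space)+
      fix u v
      have "(\<Sum>j\<in>insert i I. ((x(i := u)) j - (y(i := v)) j)^2) = (u - v)^2 + (\<Sum>j\<in>I. (x j - y j)^2)"
        using insert.hyps by (auto intro!: sum.cong)
      then have "exp (- (s * (1 - s) / 2 * (\<Sum>j\<in>insert i I. ((x(i := u)) j - (y(i := v)) j)^2))) =
          exp (- (s * (1 - s) / 2 * (u - v)^2)) * ?c"
        by (simp only: exp_add[symmetric] distrib_left minus_add_distrib)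
      then show "f (x(i := u)) powr (1 - s) * g (y(i := v)) powr s * exp (- (s * (1 - s) / 2 * (u - v)^2)) * ?c
         \<le> h (?z(i := (1 - s) * u + s * v))"
        using insert.prems(7)[OF update_in_space[OF xy(1), of i u] update_in_space[OF xy(2), of i v]]
        by (simp only: comb_insert[OF insert.hyps(2)] mult.assoc)
    qed (simp_all add: insert.prems(4-6) update_in_space xy s del: fun_upd_apply)
  qed
  moreover have "integral\<^sup>L ?G k = (LINT x|gauss I. (LINT u|gauss1. k (x(i := u))))"
    if "\<And>x. x \<in> space ?G \<Longrightarrow> 0 \<le> k x \<and> k x \<le> K" "k \<in> borel_measurable ?G" for k
    using that insert.hyps by (intro gauss_integral_insert[where K = K]) auto
  ultimately show ?case
    using insert.prems(1-6) by simp
qed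

section \<open>Rotations and shifts of Gaussian measures\<close>

lemma sets_lborel2 [measurable_cong]: "sets lborel2 = sets borel2"
  by (intro sets_pair_measure_cong) auto

lemma nn_integral_shear_fst:
  assumes [measurable]: "k \<in> borel_measurable borel2"
  shows "(\<integral>\<^sup>+p. k (fst p + t * snd p, snd p) \<partial>lborel2) = (\<integral>\<^sup>+p. k p \<partial>lborel2)"
proof -
  have "(\<integral>\<^sup>+p. k (fst p + t * snd p, snd p) \<partial>lborel2) =
     (\<integral>\<^sup>+y. \<integral>\<^sup>+x. k (x + t * y, y) \<partial>lborel \<partial>lborel)"
    by (subst lborel_pair.nn_integral_snd[symmetric]) auto
  also have "... = (\<integral>\<^sup>+y. \<integral>\<^sup>+x. k (x, y) \<partial>lborel \<partial>lborel)"
  proof (rule nn_integral_cong)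
    fix y :: real
    have "(\<integral>\<^sup>+x. k (x, y) \<partial>lborel) = ennreal \<bar>1\<bar> * (\<integral>\<^sup>+x. k (t * y + 1 * x, y) \<partial>lborel)"
      by (rule nn_integral_real_affine) auto
    then show "(\<integral>\<^sup>+x. k (x + t * y, y) \<partial>lborel) = (\<integral>\<^sup>+x. k (x, y) \<partial>lborel)"
      by (simp add: add.commute)
  qed
  also have "... = (\<integral>\<^sup>+p. k p \<partial>lborel2)"
    by (subst lborel_pair.nn_integral_snd) auto
  finally show ?thesis .
qed

lemma nn_integral_shear_snd:
  assumes [measurable]: "k \<in> borel_measurable borel2"
  shows "(\<integral>\<^sup>+p. k (fst p, snd p + t * fst p) \<partial>lborel2) = (\<integral>\<^sup>+p. k p \<partial>lborel2)"
proof -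
  have "(\<integral>\<^sup>+p. k (fst p, snd p + t * fst p) \<partial>lborel2) =
     (\<integral>\<^sup>+x. \<integral>\<^sup>+y. k (x, y + t * x) \<partial>lborel \<partial>lborel)"
    by (subst lborel.nn_integral_fst[symmetric]) auto
  also have "... = (\<integral>\<^sup>+x. \<integral>\<^sup>+y. k (x, y) \<partial>lborel \<partial>lborel)"
  proof (rule nn_integral_cong)
    fix x :: real
    have "(\<integral>\<^sup>+y. k (x, y) \<partial>lborel) = ennreal \<bar>1\<bar> * (\<integral>\<^sup>+y. k (x, t * x + 1 * y) \<partial>lborel)"
      by (rule nn_integral_real_affine) auto
    then show "(\<integral>\<^sup>+y. k (x, y + t * x) \<partial>lborel) = (\<integral>\<^sup>+y. k (x, y) \<partial>lborel)"
      by (simp add: add.commute)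
  qed
  also have "... = (\<integral>\<^sup>+p. k p \<partial>lborel2)"
    by (subst lborel.nn_integral_fst) auto
  finally show ?thesis .
qed

text \<open>A rotation by an angle other than \<open>\<pi>\<close> is a product of three shears.\<close>

lemma nn_integral_lborel_rotation:
  fixes c s :: real
  assumes k: "k \<in> borel_measurable borel2" and cs: "c^2 + s^2 = 1"
  shows "(\<integral>\<^sup>+p. k (c * fst p + s * snd p, - s * fst p + c * snd p) \<partial>lborel2) =
    (\<integral>\<^sup>+p. k p \<partial>lborel2)"
proof -
  have *: "(\<integral>\<^sup>+p. k (c * fst p + s * snd p, - s * fst p + c * snd p) \<partial>lborel2) =
    (\<integral>\<^sup>+p. k p \<partial>lborel2)"
    if [measurable]: "k \<in> borel_measurable borel2" and cs: "c^2 + s^2 = 1" and c: "c \<noteq> -1"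
    for k and c s :: real
  proof -
    \<comment> \<open>The tangent of half the angle, the parameter of the two outer shears; the
      middle shear has parameter \<open>- s\<close>.\<close>
    define t where "t = s / (1 + c)"
    have c1: "1 + c \<noteq> 0" using c by linarith
    have "s * s = (1 - c) * (1 + c)" using cs by (simp add: power2_eq_square algebra_simps)
    then have t1: "1 - s * t = c"
      using c1 by (auto simp: t_def)
    have "t * (1 + c) = s" using c1 by (simp add: t_def)
    then have t2: "t + t * c = s" by (simp add: distrib_left)
    define k1 where "k1 = (\<lambda>p. k (fst p + t * snd p, snd p))"
    have [measurable]: "k1 \<in> borel_measurable borel2" unfolding k1_def by measurable
    define k2 where "k2 = (\<lambda>p. k1 (fst p, snd p + (- s) * fst p))"
    have [measurable]: "k2 \<in> borel_measurable borel2" unfolding k2_def by measurable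
    have "k2 (x + t * y, y) = k (c * x + s * y, - s * x + c * y)" for x y
    proof -
      have "x + t * y + t * (y + - s * (x + t * y)) = (1 - s * t) * x + (t + t * (1 - s * t)) * y"
        by (simp add: algebra_simps)
      also have "... = c * x + s * y" unfolding t1 t2 ..
      finally have 1: "x + t * y + t * (y + - s * (x + t * y)) = c * x + s * y" .
      have "y + - s * (x + t * y) = - s * x + (1 - s * t) * y" by (simp add: algebra_simps)
      then have 2: "y + - s * (x + t * y) = - s * x + c * y" unfolding t1 .
      show ?thesis unfolding k2_def k1_def using 1 2 by simp
    qed
    then show ?thesis
      using nn_integral_shear_fst[of k2 t] nn_integral_shear_snd[of k1 "- s"] nn_integral_shear_fst[of k t]
      by (simp add: k1_def k2_def)
  qed
  show ?thesis
  proof (cases "c = -1")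
    case True
    with cs have s0: "s = 0" by simp
    \<comment> \<open>The half turn is obtained as two quarter turns.\<close>
    define k1 where "k1 = (\<lambda>p. k (snd p, - fst p))"
    have [measurable]: "k1 \<in> borel_measurable borel2" unfolding k1_def using k by measurable
    show ?thesis
      using *[of k 0 1] *[of k1 0 1] k True s0 by (simp add: k1_def)
  qed (use * k cs in auto)
qed

lemma nn_integral_gauss1_rotation:
  fixes c s :: real
  assumes k[measurable]: "k \<in> borel_measurable borel2" and cs: "c^2 + s^2 = 1"
  shows "(\<integral>\<^sup>+x. \<integral>\<^sup>+y. k (c * x + s * y, - s * x + c * y) \<partial>gauss1 \<partial>gauss1) = (\<integral>\<^sup>+x. \<integral>\<^sup>+y. k (x, y) \<partial>gauss1 \<partial>gauss1)"
proof -
  define w where "w = (\<lambda>p. ennreal (\<phi> (fst p) * \<phi> (snd p)))"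
  have [measurable]: "w \<in> borel_measurable borel2" unfolding w_def by measurable
  have *: "(\<integral>\<^sup>+x. \<integral>\<^sup>+y. k (x, y) \<partial>gauss1 \<partial>gauss1) = (\<integral>\<^sup>+p. w p * k p \<partial>lborel2)"
    if [measurable]: "k \<in> borel_measurable borel2" for k
    by (subst lborel.nn_integral_fst[symmetric])
       (auto simp: nn_integral_density w_def ennreal_mult mult.assoc nn_integral_cmult)
  have w: "w (c * x + s * y, - s * x + c * y) = w (x, y)" for x y
  proof -
    have "(c * x + s * y)^2 + (- s * x + c * y)^2 = (c^2 + s^2) * (x^2 + y^2)"
      by (simp add: power2_eq_square algebra_simps)
    then have "exp (- (c * x + s * y)\<^sup>2 / 2) * exp (- (- s * x + c * y)\<^sup>2 / 2) = exp (- x\<^sup>2 / 2) * exp (- y\<^sup>2 / 2)"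
      unfolding exp_add[symmetric] cs by (intro arg_cong[of _ _ exp]) simp
    then show ?thesis by (simp add: w_def std_normal_density_def)
  qed
  show ?thesis
    using nn_integral_lborel_rotation[OF _ cs, of "\<lambda>p. w p * k p"]
    *[of k] *[of "\<lambda>p. k (c * fst p + s * snd p, - s * fst p + c * snd p)"]
    by (simp add: w[simplified])
qed

lemma measurable_gauss_fun_upd:
  assumes [measurable]: "f \<in> measurable M (gauss I)" "g \<in> borel_measurable M"
  shows "(\<lambda>w. (f w)(i := g w)) \<in> measurable M (gauss (insert i I))"
proof -
  have "(\<lambda>w. (f w, g w)) \<in> measurable M (gauss I \<Otimes>\<^sub>M gauss1)" by measurable
  from measurable_compose[OF this measurable_gauss_update] show ?thesis
    by (simp only: fst_conv snd_conv)
qed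

lemma sigma_finite_gauss: "sigma_finite_measure (gauss I)"
  by (intro prob_space_imp_sigma_finite prob_space_gauss)

lemma nn_integral_gauss_insert2:
  assumes I: "finite I" "i \<notin> I"
    and K[measurable]: "K \<in> borel_measurable (gauss (insert i I) \<Otimes>\<^sub>M gauss (insert i I))"
  shows "(\<integral>\<^sup>+x. \<integral>\<^sup>+y. K (x, y) \<partial>gauss (insert i I) \<partial>gauss (insert i I)) =
     (\<integral>\<^sup>+x. \<integral>\<^sup>+y. \<integral>\<^sup>+u. \<integral>\<^sup>+v. K (x(i := u), y(i := v)) \<partial>gauss1 \<partial>gauss1 \<partial>gauss I \<partial>gauss I)"
proof -
  note measurable_gauss_fun_upd[measurable (raw)]
  interpret P: pair_sigma_finite gauss1 "gauss I"
    by (intro pair_sigma_finite.intro sigma_finite_gauss gauss1.sigma_finite_measure_axioms)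
  have "(\<integral>\<^sup>+x. \<integral>\<^sup>+y. K (x, y) \<partial>gauss (insert i I) \<partial>gauss (insert i I)) =
    (\<integral>\<^sup>+x. \<integral>\<^sup>+u. (\<integral>\<^sup>+y. K (x(i := u), y) \<partial>gauss (insert i I)) \<partial>gauss1 \<partial>gauss I)"
    by (rule gauss_nn_integral_insert[OF I]) measurable
  also have "... = (\<integral>\<^sup>+x. \<integral>\<^sup>+u. (\<integral>\<^sup>+y. \<integral>\<^sup>+v. K (x(i := u), y(i := v)) \<partial>gauss1 \<partial>gauss I) \<partial>gauss1 \<partial>gauss I)"
  proof (intro nn_integral_cong gauss_nn_integral_insert[OF I])
    fix x u assume "x \<in> Rn I"
    then have [measurable]: "x(i := u) \<in> Rn (insert i I)" by (rule update_in_space)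
    show "(\<lambda>y. K (x(i := u), y)) \<in> borel_measurable (gauss (insert i I))" by measurable
  qed
  also have "... = (\<integral>\<^sup>+x. \<integral>\<^sup>+y. (\<integral>\<^sup>+u. \<integral>\<^sup>+v. K (x(i := u), y(i := v)) \<partial>gauss1 \<partial>gauss1) \<partial>gauss I \<partial>gauss I)"
  proof (intro nn_integral_cong P.Fubini'[symmetric])
    fix x assume [measurable]: "x \<in> Rn I"
    show "(\<lambda>(u, y). \<integral>\<^sup>+v. K (x(i := u), y(i := v)) \<partial>gauss1) \<in> borel_measurable (gauss1 \<Otimes>\<^sub>M gauss I)"
      by measurable
  qed
  finally show ?thesis .
qed

text \<open>The rotation mixes \<open>x i\<close> only with \<open>y i\<close>, so the plane case
  applies to one pair of coordinates at a time.\<close>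

lemma nn_integral_gauss_rotation:
  fixes c s :: real
  assumes "finite I" and "k \<in> borel_measurable (gauss I \<Otimes>\<^sub>M gauss I)" and cs: "c^2 + s^2 = 1"
  shows "(\<integral>\<^sup>+x. \<integral>\<^sup>+y. k (comb I c x s y, comb I (- s) x c y) \<partial>gauss I \<partial>gauss I) =
     (\<integral>\<^sup>+x. \<integral>\<^sup>+y. k (x, y) \<partial>gauss I \<partial>gauss I)"
  using assms(1,2)
proof (induction I arbitrary: k rule: finite_induct)
  case empty
  have e: "Rn {} = {\<lambda>_. undefined}" by (simp add: space_gauss)
  have "comb {} a x b y = (\<lambda>_. undefined)" for a b x y
    by (simp add: comb_def restrict_def)
  then show ?case
    by (intro nn_integral_cong) (simp add: e)
next
  case (insert i I)
  note measurable_gauss_fun_upd[measurable (raw)]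
  note [measurable] = insert.prems
  define k' where "k' p = (\<integral>\<^sup>+u. \<integral>\<^sup>+v. k ((fst p)(i := u), (snd p)(i := v)) \<partial>gauss1 \<partial>gauss1)" for p
  have k': "k' \<in> borel_measurable (gauss I \<Otimes>\<^sub>M gauss I)"
    unfolding k'_def by measurable
  have "(\<integral>\<^sup>+x. \<integral>\<^sup>+y. k (comb (insert i I) c x s y, comb (insert i I) (- s) x c y) \<partial>gauss (insert i I) \<partial>gauss (insert i I)) =
     (\<integral>\<^sup>+x. \<integral>\<^sup>+y. \<integral>\<^sup>+u. \<integral>\<^sup>+v. k (comb (insert i I) c (x(i := u)) s (y(i := v)),
        comb (insert i I) (- s) (x(i := u)) c (y(i := v))) \<partial>gauss1 \<partial>gauss1 \<partial>gauss I \<partial>gauss I)"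
  proof -
    have "(\<lambda>p. k (comb (insert i I) c (fst p) s (snd p), comb (insert i I) (- s) (fst p) c (snd p)))
        \<in> borel_measurable (gauss (insert i I) \<Otimes>\<^sub>M gauss (insert i I))"
      by measurable
    from nn_integral_gauss_insert2[OF insert.hyps this] show ?thesis
      by (simp only: fst_conv snd_conv)
  qed
  also have "... = (\<integral>\<^sup>+x. \<integral>\<^sup>+y. k' (comb I c x s y, comb I (- s) x c y) \<partial>gauss I \<partial>gauss I)"
  proof (intro nn_integral_cong)
    fix x y
    let ?x = "comb I c x s y" and ?y = "comb I (- s) x c y"
    have [measurable]: "?x \<in> Rn I" "?y \<in> Rn I" by simp_all
    have "(\<lambda>p. k (?x(i := fst p), ?y(i := snd p))) \<in> borel_measurable borel2"
      by measurable
    from nn_integral_gauss1_rotation[OF this cs]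
    show "(\<integral>\<^sup>+u. \<integral>\<^sup>+v. k (comb (insert i I) c (x(i := u)) s (y(i := v)),
        comb (insert i I) (- s) (x(i := u)) c (y(i := v))) \<partial>gauss1 \<partial>gauss1) = k' (?x, ?y)"
      by (simp only: k'_def comb_insert[OF insert.hyps(2)] fst_conv snd_conv)
  qed
  also have "... = (\<integral>\<^sup>+x. \<integral>\<^sup>+y. k' (x, y) \<partial>gauss I \<partial>gauss I)"
    by (rule insert.IH[OF k'])
  also have "... = (\<integral>\<^sup>+x. \<integral>\<^sup>+y. k (x, y) \<partial>gauss (insert i I) \<partial>gauss (insert i I))"
    using nn_integral_gauss_insert2[OF insert.hyps insert.prems] by (simp only: k'_def fst_conv snd_conv)
  finally show ?case .
qed

section \<open>Shifts, reflections and half-spaces\<close>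

lemma nn_integral_gauss1_shift:
  assumes [measurable]: "k \<in> borel_measurable borel"
  shows "(\<integral>\<^sup>+x. k (x + v) \<partial>gauss1) = (\<integral>\<^sup>+x. k x * ennreal (exp (v * x - v\<^sup>2 / 2)) \<partial>gauss1)"
proof -
  have "(\<integral>\<^sup>+x. k x * ennreal (exp (v * x - v\<^sup>2 / 2)) \<partial>gauss1) =
    (\<integral>\<^sup>+x. ennreal (\<phi> x) * (k x * ennreal (exp (v * x - v\<^sup>2 / 2))) \<partial>lborel)"
    by (subst nn_integral_density) auto
  also have "... = ennreal \<bar>1\<bar> * (\<integral>\<^sup>+x. ennreal (\<phi> (v + 1 * x)) *
      (k (v + 1 * x) * ennreal (exp (v * (v + 1 * x) - v\<^sup>2 / 2))) \<partial>lborel)"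
    by (rule nn_integral_real_affine) auto
  also have "... = (\<integral>\<^sup>+x. ennreal (\<phi> x) * k (x + v) \<partial>lborel)"
  proof -
    have "\<phi> (v + x) * exp (v * (v + x) - v\<^sup>2 / 2) = \<phi> x" for x
    proof -
      have "exp (- (v + x)\<^sup>2 / 2) * exp (v * (v + x) - v\<^sup>2 / 2) = exp (- x\<^sup>2 / 2)"
        unfolding exp_add[symmetric] by (intro arg_cong[of _ _ exp]) (simp add: power2_eq_square field_simps)
      then show ?thesis by (simp add: std_normal_density_def)
    qed
    then have "ennreal (\<phi> (v + x)) * ennreal (exp (v * (v + x) - v\<^sup>2 / 2)) =
        ennreal (\<phi> x)" for x
      by (subst ennreal_mult[symmetric]) auto
    then have "ennreal (\<phi> (v + x)) * (k (v + x) * ennreal (exp (v * (v + x) - v\<^sup>2 / 2))) =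
       ennreal (\<phi> x) * k (x + v)" for x
      by (metis mult.assoc mult.commute add.commute)
    then show ?thesis by simp
  qed
  also have "... = (\<integral>\<^sup>+x. k (x + v) \<partial>gauss1)"
    by (subst nn_integral_density) auto
  finally show ?thesis by simp
qed

text \<open>The Cameron-Martin formula, assembled coordinate by coordinate.\<close>

lemma nn_integral_gauss_shift:
  assumes "finite I" "k \<in> borel_measurable (gauss I)"
  shows "(\<integral>\<^sup>+x. k (comb I 1 x 1 v) \<partial>gauss I) =
     (\<integral>\<^sup>+x. k x * ennreal (exp ((\<Sum>i\<in>I. v i * x i) - (\<Sum>i\<in>I. (v i)^2) / 2)) \<partial>gauss I)"
  using assms
proof (induction I arbitrary: k rule: finite_induct)
  case empty
  have e: "Rn {} = {\<lambda>_. undefined}" by (simp add: space_gauss)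
  have "comb {} a x b y = (\<lambda>_. undefined)" for a b x y
    by (simp add: comb_def restrict_def)
  then show ?case
    by (intro nn_integral_cong) (simp add: e)
next
  case (insert i I)
  note measurable_gauss_fun_upd[measurable (raw)]
  note [measurable] = insert.prems
  let ?w = "\<lambda>I x. ennreal (exp ((\<Sum>i\<in>I. v i * x i) - (\<Sum>i\<in>I. (v i)^2) / 2))"
  \<comment> \<open>The shift \<open>v\<close> need not be extensional. Its restriction has the same
    effect and is a point of the space, as the measurability proofs require.\<close>
  define v' where "v' = restrict v (insert i I)"
  have [measurable]: "v' \<in> Rn (insert i I)" by (simp add: v'_def space_gauss)
  have v': "comb (insert i I) 1 x 1 v = comb (insert i I) 1 x 1 v'" for x
    by (auto simp: comb_def v'_def fun_eq_iff)
  define k' where "k' x = (\<integral>\<^sup>+u. k (x(i := u)) * ennreal (exp (v i * u - (v i)\<^sup>2 / 2)) \<partial>gauss1)" for x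
  have k': "k' \<in> borel_measurable (gauss I)"
    unfolding k'_def by measurable
  have "(\<integral>\<^sup>+x. k (comb (insert i I) 1 x 1 v) \<partial>gauss (insert i I)) =
      (\<integral>\<^sup>+x. \<integral>\<^sup>+u. k (comb (insert i I) 1 (x(i := u)) 1 v) \<partial>gauss1 \<partial>gauss I)"
    unfolding v' by (rule gauss_nn_integral_insert[OF insert.hyps]) measurable
  also have "... = (\<integral>\<^sup>+x. k' (comb I 1 x 1 v) \<partial>gauss I)"
  proof (intro nn_integral_cong)
    fix x
    let ?x = "comb I 1 x 1 v"
    have [measurable]: "?x \<in> Rn I" by simp
    have "comb (insert i I) 1 (x(i := u)) 1 v = ?x(i := u + v i)" for u
      using comb_insert[OF insert.hyps(2), of 1 x u 1 v "v i"] by simp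
    then show "(\<integral>\<^sup>+u. k (comb (insert i I) 1 (x(i := u)) 1 v) \<partial>gauss1) = k' ?x"
      using nn_integral_gauss1_shift[of "\<lambda>u. k (?x(i := u))" "v i"] borel_measurable_gauss_section[of ?x I k i]
        insert.prems by (simp add: k'_def del: fun_upd_apply)
  qed
  also have "... = (\<integral>\<^sup>+x. k' x * ?w I x \<partial>gauss I)"
    by (rule insert.IH[OF k'])
  also have "... = (\<integral>\<^sup>+x. \<integral>\<^sup>+u. k (x(i := u)) * ?w (insert i I) (x(i := u)) \<partial>gauss1 \<partial>gauss I)"
  proof (intro nn_integral_cong)
    fix x assume x: "x \<in> Rn I"
    have w: "?w (insert i I) (x(i := u)) = ennreal (exp (v i * u - (v i)\<^sup>2 / 2)) * ?w I x" for u
    proof -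
      have "(\<Sum>j\<in>insert i I. v j * (x(i := u)) j) = v i * u + (\<Sum>j\<in>I. v j * x j)"
        using insert.hyps by (auto intro!: sum.cong)
      then have "(\<Sum>j\<in>insert i I. v j * (x(i := u)) j) - (\<Sum>j\<in>insert i I. (v j)^2) / 2 =
          (v i * u - (v i)\<^sup>2 / 2) + ((\<Sum>j\<in>I. v j * x j) - (\<Sum>j\<in>I. (v j)\<^sup>2) / 2)"
        using insert.hyps by (simp add: add_divide_distrib del: fun_upd_apply)
      then show ?thesis
        by (simp only: exp_add ennreal_mult exp_ge_zero)
    qed
    have e: "(\<lambda>u. ennreal (exp (a * u - b))) \<in> borel_measurable borel" for a b :: real
      by measurable
    show "k' x * ?w I x = (\<integral>\<^sup>+u. k (x(i := u)) * ?w (insert i I) (x(i := u)) \<partial>gauss1)"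
      unfolding w k'_def mult.assoc[symmetric] using borel_measurable_gauss_section[OF x insert.prems] e
      by (intro nn_integral_multc[symmetric] borel_measurable_times_ennreal) (simp_all del: fun_upd_apply)
  qed
  also have "... = (\<integral>\<^sup>+x. k x * ?w (insert i I) x \<partial>gauss (insert i I))"
    by (rule gauss_nn_integral_insert[OF insert.hyps, symmetric]) measurable
  finally show ?case .
qed

abbreviation gauss2 :: "nat set \<Rightarrow> ((nat \<Rightarrow> real) \<times> (nat \<Rightarrow> real)) measure" where
  "gauss2 I \<equiv> gauss I \<Otimes>\<^sub>M gauss I"

lemma prob_space_gauss2: "prob_space (gauss2 I)"
proof -
  interpret P: pair_prob_space "gauss I" "gauss I" ..
  show ?thesis by (rule P.prob_space_axioms)
qed

lemma integrable_gauss_bounded: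
  fixes f :: "_ \<Rightarrow> real"
  assumes "f \<in> borel_measurable (gauss I)" "\<And>x. x \<in> Rn I \<Longrightarrow> \<bar>f x\<bar> \<le> K"
  shows "integrable (gauss I) f"
proof -
  show ?thesis using assms by (intro gauss.integrable_const_bound[of _ K]) auto
qed

lemma integrable_gauss2_bounded:
  fixes f :: "_ \<Rightarrow> real"
  assumes "f \<in> borel_measurable (gauss2 I)"
    "\<And>x y. x \<in> Rn I \<Longrightarrow> y \<in> Rn I \<Longrightarrow> \<bar>f (x, y)\<bar> \<le> K"
  shows "integrable (gauss2 I) f"
proof -
  interpret G: prob_space "gauss2 I" by (rule prob_space_gauss2)
  show ?thesis using assms
    by (intro G.integrable_const_bound[of _ K]) (auto simp: space_pair_measure)
qed

lemma gauss2_integral_fst: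
  fixes f :: "_ \<Rightarrow> real"
  assumes "integrable (gauss2 I) f"
  shows "(LINT p|gauss2 I. f p) = (LINT x|gauss I. LINT y|gauss I. f (x, y))"
proof -
  interpret P: pair_sigma_finite "gauss I" "gauss I" ..
  show ?thesis using P.integral_fst'[OF assms] by simp
qed

lemma distr_gauss2_rotation:
  assumes I: "finite I" and cs: "c^2 + s^2 = 1"
  shows "distr (gauss2 I) (gauss2 I) (\<lambda>p. (comb I c (fst p) s (snd p), comb I (- s) (fst p) c (snd p))) = gauss2 I"
    (is "distr _ _ ?r = _")
proof (rule measure_eqI)
  have r[measurable]: "?r \<in> measurable (gauss2 I) (gauss2 I)" by measurable
  fix A assume "A \<in> sets (distr (gauss2 I) (gauss2 I) ?r)"
  then have A[measurable]: "A \<in> sets (gauss2 I)" by simp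
  have "emeasure (distr (gauss2 I) (gauss2 I) ?r) A = (\<integral>\<^sup>+p. indicator A p \<partial>distr (gauss2 I) (gauss2 I) ?r)"
    by simp
  also have "... = (\<integral>\<^sup>+p. indicator A (?r p) \<partial>gauss2 I)"
    by (rule nn_integral_distr) measurable
  also have "... = (\<integral>\<^sup>+x. \<integral>\<^sup>+y. indicator A (?r (x, y)) \<partial>gauss I \<partial>gauss I)"
    by (rule gauss.nn_integral_fst[symmetric]) measurable
  also have "... = (\<integral>\<^sup>+x. \<integral>\<^sup>+y. indicator A (x, y) \<partial>gauss I \<partial>gauss I)"
    using nn_integral_gauss_rotation[OF I _ cs, of "indicator A"] by simp
  also have "... = (\<integral>\<^sup>+p. indicator A p \<partial>gauss2 I)"
    by (rule gauss.nn_integral_fst) measurable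
  finally show "emeasure (distr (gauss2 I) (gauss2 I) ?r) A = emeasure (gauss2 I) A"
    by simp
qed simp

lemma gauss2_integral_rotation:
  fixes k :: "_ \<Rightarrow> real"
  assumes I: "finite I" and cs: "c^2 + s^2 = 1" and [measurable]: "k \<in> borel_measurable (gauss2 I)"
  shows "(LINT p|gauss2 I. k (comb I c (fst p) s (snd p), comb I (- s) (fst p) c (snd p))) = (LINT p|gauss2 I. k p)"
  by (subst (2) distr_gauss2_rotation[OF I cs, symmetric]) (rule integral_distr[symmetric]; measurable)

text \<open>The reflection is the first component of the rotation of pairs by \<pi>, with cosine -1
  and sine 0.\<close>

lemma distr_gauss_neg:
  assumes I: "finite I"
  shows "distr (gauss I) (gauss I) (\<lambda>x. comb I (- 1) x 0 x) = gauss I"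
proof (rule measure_eqI)
  fix A assume "A \<in> sets (distr (gauss I) (gauss I) (\<lambda>x. comb I (- 1) x 0 x))"
  then have A[measurable]: "A \<in> sets (gauss I)" by simp
  have c: "comb I (- 1) x 0 y = (\<lambda>i\<in>I. - x i)" for x y by (simp add: comb_def)
  have "emeasure (distr (gauss I) (gauss I) (\<lambda>x. comb I (- 1) x 0 x)) A =
      (\<integral>\<^sup>+x. indicator A x \<partial>distr (gauss I) (gauss I) (\<lambda>x. comb I (- 1) x 0 x))"
    by simp
  also have "... = (\<integral>\<^sup>+x. indicator A (comb I (- 1) x 0 x) \<partial>gauss I)"
    by (rule nn_integral_distr) measurable
  also have "... = (\<integral>\<^sup>+x. \<integral>\<^sup>+y. indicator A (fst (comb I (- 1) x 0 y, comb I (- 0) x (- 1) y)) \<partial>gauss I \<partial>gauss I)"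
  proof -
    have "(\<integral>\<^sup>+y. indicator A (fst (comb I (- 1) x 0 y, comb I (- 0) x (- 1) y)) \<partial>gauss I) =
        (\<integral>\<^sup>+y. indicator A (comb I (- 1) x 0 x) \<partial>gauss I)" for x
      by (rule nn_integral_cong) (simp only: fst_conv c)
    then show ?thesis by (simp add: gauss.emeasure_space_1)
  qed
  also have "... = (\<integral>\<^sup>+x. \<integral>\<^sup>+y. indicator A (fst (x, y)) \<partial>gauss I \<partial>gauss I)"
  proof (rule nn_integral_gauss_rotation[OF I, of "\<lambda>p. indicator A (fst p)"])
    show "(\<lambda>p. indicator A (fst p)) \<in> borel_measurable (gauss2 I)" by measurable
  qed simp
  finally show "emeasure (distr (gauss I) (gauss I) (\<lambda>x. comb I (- 1) x 0 x)) A = emeasure (gauss I) A"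
    by (simp add: gauss.emeasure_space_1)
qed simp

lemma gauss_integral_neg:
  fixes k :: "_ \<Rightarrow> real"
  assumes I: "finite I" and [measurable]: "k \<in> borel_measurable (gauss I)"
  shows "(LINT x|gauss I. k (comb I (- 1) x 0 x)) = (LINT x|gauss I. k x)"
  by (subst (2) distr_gauss_neg[OF I, symmetric]) (rule integral_distr[symmetric]; measurable)

lemma measurable_gauss_linear [measurable]: "(\<lambda>x. \<Sum>i\<in>I. v i * x i) \<in> borel_measurable (gauss I)"
  by (intro borel_measurable_sum borel_measurable_times borel_measurable_const measurable_gauss_component)

text \<open>The half-space and its reflection have equal measure and together cover the
  space.\<close>

lemma gauss_half_space:
  assumes I: "finite I"
  shows "1 / 2 \<le> measure (gauss I) {x \<in> Rn I. 0 \<le> (\<Sum>i\<in>I. v i * x i)}"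
proof -
  let ?H = "{x \<in> Rn I. 0 \<le> (\<Sum>i\<in>I. v i * x i)}"
  let ?H' = "{x \<in> Rn I. (\<Sum>i\<in>I. v i * x i) \<le> 0}"
  have m: "?H \<in> sets (gauss I)" "?H' \<in> sets (gauss I)" by measurable
  have "measure (gauss I) ?H = measure (distr (gauss I) (gauss I) (\<lambda>x. comb I (- 1) x 0 x)) ?H"
    by (simp add: distr_gauss_neg[OF I])
  also have "... = measure (gauss I) ((\<lambda>x. comb I (- 1) x 0 x) -` ?H \<inter> Rn I)"
    by (rule measure_distr) measurable
  also have "(\<lambda>x. comb I (- 1) x 0 x) -` ?H \<inter> Rn I = ?H'"
    by (auto simp: sum_negf)
  finally have eq: "measure (gauss I) ?H = measure (gauss I) ?H'" .
  have "1 = measure (gauss I) (?H \<union> ?H')"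
  proof -
    have "?H \<union> ?H' = Rn I" by auto
    then show ?thesis using gauss.prob_space by simp
  qed
  also have "... \<le> measure (gauss I) ?H + measure (gauss I) ?H'"
    by (rule measure_Un_le) (use m in auto)
  finally show ?thesis using eq by simp
qed

text \<open>The Cameron-Martin density is at least \<open>exp (- |v|^2 / 2)\<close> on the
  half-space where the linear form of \<open>v\<close> is nonnegative, and \<open>B\<close> meets
  that half-space in mass at least 3/4 + 1/2 - 1 = 1/4. The bound depends on the length of
  \<open>v\<close> but not on the dimension.\<close>

lemma gauss_shift_lower_bound:
  assumes I: "finite I" and B[measurable]: "B \<in> sets (gauss I)" and big: "3 / 4 \<le> measure (gauss I) B"
  shows "exp (- (\<Sum>i\<in>I. (v i)^2) / 2) / 4 \<le> measure (gauss I) {y \<in> Rn I. comb I 1 y 1 v \<in> B}"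
proof -
  let ?H = "{x \<in> Rn I. 0 \<le> (\<Sum>i\<in>I. v i * x i)}"
  let ?e = "exp (- (\<Sum>i\<in>I. (v i)^2) / 2)"
  have [measurable]: "?H \<in> sets (gauss I)" by measurable
  define v' where "v' = restrict v I"
  have v'[measurable]: "v' \<in> Rn I" by (simp add: v'_def space_gauss)
  have cv: "comb I 1 x 1 v = comb I 1 x 1 v'" for x
    by (auto simp: comb_def v'_def fun_eq_iff)
  have mS[measurable]: "{y \<in> Rn I. comb I 1 y 1 v \<in> B} \<in> sets (gauss I)"
    unfolding cv by measurable
  have "measure (gauss I) (B \<union> ?H) = measure (gauss I) B + measure (gauss I) ?H - measure (gauss I) (B \<inter> ?H)"
    by (rule measure_Un3) (auto simp: gauss.fmeasurable_eq_sets)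
  moreover have "measure (gauss I) (B \<union> ?H) \<le> 1" by simp
  ultimately have "1 / 4 \<le> measure (gauss I) (B \<inter> ?H)"
    using big gauss_half_space[OF I, of v] by linarith
  then have "ennreal (?e / 4) \<le> ennreal ?e * emeasure (gauss I) (B \<inter> ?H)"
    by (simp add: gauss.emeasure_eq_measure ennreal_mult[symmetric])
  also have "... = (\<integral>\<^sup>+x. ennreal ?e * indicator (B \<inter> ?H) x \<partial>gauss I)"
    by (simp add: nn_integral_cmult)
  also have "... \<le> (\<integral>\<^sup>+x. indicator B x * ennreal (exp ((\<Sum>i\<in>I. v i * x i) - (\<Sum>i\<in>I. (v i)^2) / 2)) \<partial>gauss I)"
    by (intro nn_integral_mono) (auto simp: indicator_def)
  also have "... = (\<integral>\<^sup>+x. indicator B (comb I 1 x 1 v) \<partial>gauss I)"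
    by (rule nn_integral_gauss_shift[OF I, symmetric]) simp
  also have "... = (\<integral>\<^sup>+x. indicator {y \<in> Rn I. comb I 1 y 1 v \<in> B} x \<partial>gauss I)"
    by (intro nn_integral_cong) (auto simp: indicator_def)
  also have "... = ennreal (measure (gauss I) {y \<in> Rn I. comb I 1 y 1 v \<in> B})"
    by (simp add: gauss.emeasure_eq_measure)
  finally show ?thesis by (subst (asm) ennreal_le_iff) auto
qed

section \<open>Concentration of Lipschitz functions\<close>

definition ed :: "nat set \<Rightarrow> (nat \<Rightarrow> real) \<Rightarrow> (nat \<Rightarrow> real) \<Rightarrow> real" where
  "ed I x y = L2_set (\<lambda>i. x i - y i) I"

lemma ed_nonneg [simp]: "0 \<le> ed I x y"
  by (simp add: ed_def)

lemma ed_power2: "(ed I x y)^2 = (\<Sum>i\<in>I. (x i - y i)^2)"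
  by (simp add: ed_def L2_set_def sum_nonneg)

text \<open>Prekopa-Leindler with equal weights for \<open>exp D\<close>, \<open>exp (- D)\<close>
  and the constant \<open>exp (\<Lambda>^2 / 2)\<close>. Its hypothesis reads
  \<open>\<Lambda> * r / 2 - r^2 / 8 \<le> \<Lambda>^2 / 2\<close> for the distance
  \<open>r\<close>, which is a completed square.\<close>

lemma gauss_exp_lipschitz:
  assumes I: "finite I" and [measurable]: "D \<in> borel_measurable (gauss I)"
    and bnd: "\<And>x. x \<in> Rn I \<Longrightarrow> \<bar>D x\<bar> \<le> K"
    and lip: "\<And>x y. x \<in> Rn I \<Longrightarrow> y \<in> Rn I \<Longrightarrow> D x - D y \<le> \<Lambda> * ed I x y"
  shows "(LINT x|gauss I. exp (D x)) * (LINT x|gauss I. exp (- D x)) \<le> exp (\<Lambda>^2)"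
proof -
  define A where "A = (LINT x|gauss I. exp (D x))"
  define B where "B = (LINT x|gauss I. exp (- D x))"
  have "A powr (1 - 1/2) * B powr (1/2) \<le> (LINT x|gauss I. exp (\<Lambda>^2 / 2))"
    unfolding A_def B_def
  proof (rule prekopa_leindler_gauss[where K = "max (exp K) (exp (\<Lambda>^2 / 2))", OF I])
    fix x y assume xy: "x \<in> Rn I" "y \<in> Rn I"
    have "\<bar>D x\<bar> \<le> K" by (rule bnd[OF xy(1)])
    then have "D x \<le> K" "- D x \<le> K" by auto
    then have "exp (D x) \<le> exp K" "exp (- D x) \<le> exp K" by auto
    then show "0 \<le> exp (D x) \<and> exp (D x) \<le> max (exp K) (exp (\<Lambda>^2 / 2))"
      "0 \<le> exp (- D x) \<and> exp (- D x) \<le> max (exp K) (exp (\<Lambda>^2 / 2))"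
      by (simp_all add: le_max_iff_disj)
    have "0 \<le> (ed I x y - 2 * \<Lambda>)^2" by simp
    then have "4 * (\<Lambda> * ed I x y) - (ed I x y)\<^sup>2 \<le> 4 * \<Lambda>\<^sup>2"
      by (simp add: power2_eq_square algebra_simps)
    then have "D x * (1 - 1/2) + (- D y) * (1/2) + - (1/2 * (1 - 1/2) / 2 * (ed I x y)^2) \<le> \<Lambda>^2 / 2"
      using lip[OF xy] by simp
    then have "exp (D x * (1 - 1/2)) * exp ((- D y) * (1/2)) * exp (- (1/2 * (1 - 1/2) / 2 * (ed I x y)^2)) \<le> exp (\<Lambda>^2 / 2)"
      unfolding exp_add[symmetric] by (subst exp_le_cancel_iff)
    then show "exp (D x) powr (1 - 1/2) * exp (- D y) powr (1/2) *
        exp (- (1/2 * (1 - 1/2) / 2 * (\<Sum>i\<in>I. (x i - y i)^2))) \<le> exp (\<Lambda>^2 / 2)"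
      by (simp add: powr_def ed_power2 mult.commute)
  qed auto
  also have "... = exp (\<Lambda>^2 / 2)" by (simp add: gauss.prob_space)
  finally have *: "sqrt (A * B) \<le> exp (\<Lambda>^2 / 2)"
    by (simp add: powr_half_sqrt A_def B_def real_sqrt_mult)
  have "A * B = (sqrt (A * B))^2"
    by (simp add: A_def B_def)
  also have "... \<le> (exp (\<Lambda>^2 / 2))^2"
    using * by (intro power_mono) (auto simp: A_def B_def)
  also have "... = exp (\<Lambda>^2)"
    by (simp add: exp_double[symmetric])
  finally show ?thesis by (simp add: A_def B_def)
qed

text \<open>Rescaled to Lipschitz constant 1, oddness makes the two exponential moments equal, so
  each is at most \<open>exp (1 / 2) \<le> 2\<close>. The inequality
  \<open>\<bar>u\<bar> \<le> exp u + exp (- u)\<close> then yields the constant 4.\<close>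

lemma gauss_odd_lipschitz:
  assumes I: "finite I" and [measurable]: "D \<in> borel_measurable (gauss I)"
    and bnd: "\<And>x. x \<in> Rn I \<Longrightarrow> \<bar>D x\<bar> \<le> K"
    and lip: "\<And>x y. x \<in> Rn I \<Longrightarrow> y \<in> Rn I \<Longrightarrow> D x - D y \<le> \<Lambda> * ed I x y"
    and odd: "\<And>x. x \<in> Rn I \<Longrightarrow> D (comb I (- 1) x 0 x) = - D x"
    and \<Lambda>: "0 \<le> \<Lambda>"
  shows "(LINT x|gauss I. \<bar>D x\<bar>) \<le> 4 * \<Lambda>"
proof (cases "\<Lambda> = 0")
  case True
  have "D x = 0" if x: "x \<in> Rn I" for x
    using lip[OF x comb_in_space, of "- 1" x 0 x] lip[OF comb_in_space x, of "- 1" x 0 x] odd[OF x] True by auto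
  then have "(LINT x|gauss I. \<bar>D x\<bar>) = (LINT x|gauss I. 0)"
    by (intro Bochner_Integration.integral_cong) auto
  then show ?thesis using True by simp
next
  case False
  then have pos: "\<Lambda> > 0" using \<Lambda> by simp
  define E where "E x = D x / \<Lambda>" for x
  have [measurable]: "E \<in> borel_measurable (gauss I)" unfolding E_def by measurable
  have bE: "\<bar>E x\<bar> \<le> K / \<Lambda>" if "x \<in> Rn I" for x
    using bnd[OF that] pos by (simp add: E_def divide_right_mono)
  then have b2: "E x \<le> K / \<Lambda>" "- E x \<le> K / \<Lambda>" if "x \<in> Rn I" for x
    using that by (auto simp: abs_le_iff)
  have int: "integrable (gauss I) (\<lambda>x. exp (E x))" "integrable (gauss I) (\<lambda>x. exp (- E x))"
    using b2 by (auto intro!: integrable_gauss_bounded[of _ _ "exp (K / \<Lambda>)"])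
  have le: "(LINT x|gauss I. exp (E x)) * (LINT x|gauss I. exp (- E x)) \<le> exp (1^2)"
  proof (rule gauss_exp_lipschitz[OF I _ bE])
    show "E x - E y \<le> 1 * ed I x y" if "x \<in> Rn I" "y \<in> Rn I" for x y
      using lip[OF that] pos by (simp add: E_def field_simps)
  qed auto
  have "(LINT x|gauss I. exp (- E x)) = (LINT x|gauss I. exp (E (comb I (- 1) x 0 x)))"
    by (intro Bochner_Integration.integral_cong) (auto simp: E_def odd)
  also have "... = (LINT x|gauss I. exp (E x))"
    by (rule gauss_integral_neg[OF I]) measurable
  finally have eq: "(LINT x|gauss I. exp (- E x)) = (LINT x|gauss I. exp (E x))" .
  have "exp (1::real) \<le> 2^2" using exp_le by simp
  then have "(LINT x|gauss I. exp (E x))^2 \<le> 2^2"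
    using le eq by (simp add: power2_eq_square)
  then have E2: "(LINT x|gauss I. exp (E x)) \<le> 2"
    by (rule power2_le_imp_le) simp
  have "\<bar>u\<bar> \<le> exp u + exp (- u)" for u :: real
    using exp_ge_add_one_self[of u] exp_ge_add_one_self[of "- u"] exp_gt_zero[of u] exp_gt_zero[of "- u"]
    by linarith
  then have "(LINT x|gauss I. \<bar>E x\<bar>) \<le> (LINT x|gauss I. exp (E x) + exp (- E x))"
    using int integrable_gauss_bounded[of "\<lambda>x. \<bar>E x\<bar>" I "K / \<Lambda>"] bE by (intro integral_mono) auto
  also have "... \<le> 4"
    using int eq E2 by simp
  finally show ?thesis
    using pos by (simp add: E_def field_simps)
qed

section \<open>Noise stability\<close>

text \<open>
  If \<open>F (c x + s Y) > F x / 2\<close> has probability at least \<open>3/4\<close>, then by the shift bound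
  \<open>E F (c z + s Y) \<ge> F x / 8 * exp (- c\<^sup>2 |z - x|\<^sup>2 / (2 s\<^sup>2))\<close> for every \<open>z\<close>. This is the
  hypothesis of the Prekopa-Leindler inequality with weights \<open>c\<^sup>2\<close> and \<open>s\<^sup>2\<close>; the resulting bound
  plays the role of hypercontractivity.
\<close>

lemma gauss_persistent_set_bound:
  assumes I: "finite I" and F[measurable]: "F \<in> borel_measurable (gauss I)"
    and bnd: "\<And>x. x \<in> Rn I \<Longrightarrow> 0 \<le> F x \<and> F x \<le> M"
    and cs: "c^2 + s^2 = 1" "0 < c" "0 < s"
    and U: "U = {x \<in> Rn I. 3 / 4 \<le> measure (gauss I) {y \<in> Rn I. F x / 2 < F (comb I c x s y)}}"
  shows "(LINT x|gauss I. (F x * indicator U x) powr (1 / c^2)) powr c^2 \<le> 8 * (LINT x|gauss I. F x)"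
    and "U \<in> sets (gauss I)"
proof -
  have s2: "s\<^sup>2 = 1 - c\<^sup>2" "c\<^sup>2 = 1 - s\<^sup>2" using cs by auto
  have c2: "0 < c^2" "0 < s^2" using cs by auto
  have meas: "(\<lambda>x. measure (gauss I) {y \<in> Rn I. F x / 2 < F (comb I c x s y)}) \<in> borel_measurable (gauss I)"
  proof -
    have "{p \<in> space (gauss2 I). F (fst p) / 2 < F (comb I c (fst p) s (snd p))} \<in> sets (gauss2 I)"
      by measurable
    from gauss.measurable_emeasure_Pair[OF this]
    have "(\<lambda>x. measure (gauss I) (Pair x -` {p \<in> space (gauss2 I). F (fst p) / 2 < F (comb I c (fst p) s (snd p))}))
        \<in> borel_measurable (gauss I)"
      unfolding measure_def by (rule borel_measurable_enn2real)
    also have "?this \<longleftrightarrow> ?thesis"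
      by (intro measurable_cong arg_cong[of _ _ "measure (gauss I)"]) (auto simp: space_pair_measure)
    finally show ?thesis .
  qed
  show U_sets[measurable]: "U \<in> sets (gauss I)"
    unfolding U using meas by measurable
  define Q where "Q z = (LINT y|gauss I. F (comb I c z s y))" for z
  have [measurable]: "Q \<in> borel_measurable (gauss I)"
    unfolding Q_def by measurable
  have iF: "integrable (gauss I) (\<lambda>y. F (comb I c z s y))" if [measurable]: "z \<in> Rn I" for z
    using bnd[OF comb_in_space] by (intro integrable_gauss_bounded[of _ _ M]) auto
  have Qb: "0 \<le> Q z \<and> Q z \<le> M" if z: "z \<in> Rn I" for z
    using bnd[OF comb_in_space] iF[OF z] unfolding Q_def
    by (intro conjI integral_nonneg gauss.integral_le_const) auto
  \<comment> \<open>The noise operator preserves the mean, since the rotated vector is again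
    standard Gaussian.\<close>
  have QF: "(LINT z|gauss I. Q z) = (LINT x|gauss I. F x)"
  proof -
    have "(LINT z|gauss I. Q z) = (LINT p|gauss2 I. F (comb I c (fst p) s (snd p)))"
      unfolding Q_def using bnd[OF comb_in_space]
      by (subst gauss2_integral_fst) (auto intro!: integrable_gauss2_bounded[of _ _ M])
    also have "... = (LINT p|gauss2 I. F (fst p))"
      using gauss2_integral_rotation[OF I cs(1), of "\<lambda>p. F (fst p)"] by simp
    also have "... = (LINT x|gauss I. F x)"
      using bnd by (subst gauss2_integral_fst) (auto intro!: integrable_gauss2_bounded[of _ _ M] simp: gauss.prob_space)
    finally show ?thesis .
  qed
  have key: "F x * exp (- (s\<^sup>2 * (1 - s\<^sup>2) / 2 * (\<Sum>i\<in>I. (x i - y i)\<^sup>2))) \<le> 8 * Q (comb I (1 - s\<^sup>2) x (s\<^sup>2) y)"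
    if x: "x \<in> U" and y: "y \<in> Rn I" for x y
  proof -
    have xs[measurable]: "x \<in> Rn I" using x U by auto
    define z where "z = comb I (1 - s\<^sup>2) x (s\<^sup>2) y"
    have zs[measurable]: "z \<in> Rn I" by (simp add: z_def)
    \<comment> \<open>Chosen so that \<open>c * x + s * (w + v) = c * z + s * w\<close>: here
      \<open>z - x\<close> is \<open>s^2 * (y - x)\<close>, and the shift is that difference times
      \<open>c / s\<close>.\<close>
    define v where "v i = c * s * (y i - x i)" for i
    define B where "B = {w \<in> Rn I. F x / 2 < F (comb I c x s w)}"
    have [measurable]: "B \<in> sets (gauss I)" unfolding B_def by measurable
    have "3 / 4 \<le> measure (gauss I) B" using x U by (auto simp: B_def)
    from gauss_shift_lower_bound[OF I _ this, of v]
    have *: "exp (- (\<Sum>i\<in>I. (v i)^2) / 2) / 4 \<le> measure (gauss I) {w \<in> Rn I. comb I 1 w 1 v \<in> B}"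
      by simp
    have sh: "comb I c x s (comb I 1 w 1 v) = comb I c z s w" for w
    proof
      fix i
      show "comb I c x s (comb I 1 w 1 v) i = comb I c z s w i"
      proof (cases "i \<in> I")
        case True
        have "c * x i + s * (w i + v i) = c * ((1 - s\<^sup>2) * x i + s\<^sup>2 * y i) + s * w i"
          unfolding v_def by (simp add: power2_eq_square algebra_simps)
        then show ?thesis using True by (simp add: z_def)
      qed (simp add: comb_def)
    qed
    have "F x / 2 * (exp (- (\<Sum>i\<in>I. (v i)^2) / 2) / 4) \<le>
        F x / 2 * measure (gauss I) {w \<in> Rn I. comb I 1 w 1 v \<in> B}"
      using * bnd[OF xs] by (intro mult_left_mono) auto
    also have "{w \<in> Rn I. comb I 1 w 1 v \<in> B} = {w \<in> Rn I. F x / 2 < F (comb I c z s w)}"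
      by (auto simp: B_def sh)
    also have "F x / 2 * measure (gauss I) {w \<in> Rn I. F x / 2 < F (comb I c z s w)} =
       (LINT w|gauss I. F x / 2 * indicator {w \<in> Rn I. F x / 2 < F (comb I c z s w)} w)"
      by simp
    also have "... \<le> Q z"
      unfolding Q_def using bnd[OF xs] bnd[OF comb_in_space] iF[OF zs]
      by (intro integral_mono) (auto simp: indicator_def intro!: integrable_gauss_bounded[of _ _ M])
    finally have "F x * exp (- (\<Sum>i\<in>I. (v i)^2) / 2) \<le> 8 * Q z" by simp
    moreover have "(\<Sum>i\<in>I. (v i)\<^sup>2) / 2 = s\<^sup>2 * (1 - s\<^sup>2) / 2 * (\<Sum>i\<in>I. (x i - y i)\<^sup>2)"
      unfolding v_def s2(2)[symmetric]
      by (simp add: sum_distrib_left power_mult_distrib power2_commute[of "y i" "x i" for i] mult_ac)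
    ultimately show ?thesis by (simp add: z_def)
  qed
  define M' where "M' = max 1 (max (M powr (1 / c^2)) (8 * M))"
  have "(LINT x|gauss I. (F x * indicator U x) powr (1 / c\<^sup>2)) powr (1 - s\<^sup>2) * (LINT x|gauss I. 1) powr (s\<^sup>2) \<le>
      (LINT x|gauss I. 8 * Q x)"
  \<comment> \<open>The exponent \<open>1 / c^2\<close> is undone by the weight
    \<open>1 - s^2 = c^2\<close>, which leaves exactly the pointwise bound \<open>key\<close>. The
    second function is constantly 1.\<close>
  proof (rule prekopa_leindler_gauss[where K = M', OF I])
    fix x y assume xy: "x \<in> Rn I" "y \<in> Rn I"
    have "(F x * indicator U x) powr (1 / c^2) \<le> M powr (1 / c^2)"
      using bnd[OF xy(1)] c2 by (intro powr_mono2) (auto simp: indicator_def)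
    then show "0 \<le> (F x * indicator U x) powr (1 / c^2) \<and> (F x * indicator U x) powr (1 / c^2) \<le> M'"
      by (simp add: M'_def le_max_iff_disj)
    show "0 \<le> 8 * Q x \<and> 8 * Q x \<le> M'"
      using Qb[OF xy(1)] by (auto simp: M'_def le_max_iff_disj)
    have "((F x * indicator U x) powr (1 / c\<^sup>2)) powr (1 - s\<^sup>2) = F x * indicator U x"
      using bnd[OF xy(1)] c2 by (simp add: powr_powr s2(2)[symmetric])
    moreover have "F x * indicator U x * exp (- (s\<^sup>2 * (1 - s\<^sup>2) / 2 * (\<Sum>i\<in>I. (x i - y i)\<^sup>2))) \<le>
        8 * Q (comb I (1 - s\<^sup>2) x (s\<^sup>2) y)"
      using key[OF _ xy(2), of x] Qb[OF comb_in_space] by (auto simp: indicator_def)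
    ultimately show "((F x * indicator U x) powr (1 / c\<^sup>2)) powr (1 - s\<^sup>2) * 1 powr s\<^sup>2 *
         exp (- (s\<^sup>2 * (1 - s\<^sup>2) / 2 * (\<Sum>i\<in>I. (x i - y i)\<^sup>2))) \<le> 8 * Q (comb I (1 - s\<^sup>2) x (s\<^sup>2) y)"
      by simp
  next
    show "0 < s^2" "s^2 < 1" using c2 cs(1) by linarith+
  qed (auto simp: M'_def)
  then show "(LINT x|gauss I. (F x * indicator U x) powr (1 / c^2)) powr c^2 \<le> 8 * (LINT x|gauss I. F x)"
    by (simp add: QF gauss.prob_space s2(2)[symmetric])
qed

text \<open>Off the persistent set \<open>U\<close> the noise halves \<open>F\<close> with
  probability at least 1/4, which costs \<open>F x / 8\<close> in mean. On \<open>U\<close>, where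
  \<open>F x\<close> is at least \<kappa>, \<open>F x\<close> is at most
  \<open>\<kappa> powr (- \<tau>) * F x powr (1 + \<tau>)\<close>, and the persistence bound
  controls the integral of that power because \<open>1 + \<tau> = 1 / c^2\<close>. Thus \<tau> is
  the squared tangent of the noise angle.\<close>

lemma gauss_noise_lower_bound:
  assumes I: "finite I" and F[measurable]: "F \<in> borel_measurable (gauss I)"
    and bnd: "\<And>x. x \<in> Rn I \<Longrightarrow> 0 \<le> F x \<and> F x \<le> M"
    and cs: "c^2 + s^2 = 1" "0 < c" "0 < s" and \<tau>: "\<tau> = s^2 / c^2" and \<kappa>: "0 < \<kappa>"
  shows "(LINT x|gauss I. F x * indicator {x. \<kappa> \<le> F x} x) - \<kappa> powr (- \<tau>) * (8 * (LINT x|gauss I. F x)) powr (1 + \<tau>)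
    \<le> 8 * (LINT p|gauss2 I. \<bar>F (fst p) - F (comb I c (fst p) s (snd p))\<bar>)"
proof -
  have c2: "0 < c^2" "0 < s^2" using cs by auto
  have \<tau>1: "1 / c^2 = 1 + \<tau>" and \<tau>0: "0 < \<tau>"
    using cs c2 by (auto simp: \<tau> field_simps)
  define U where "U = {x \<in> Rn I. 3 / 4 \<le> measure (gauss I) {y \<in> Rn I. F x / 2 < F (comb I c x s y)}}"
  note U = gauss_persistent_set_bound[OF I F bnd cs U_def]
  have [measurable]: "U \<in> sets (gauss I)" by (rule U(2))
  define J where "J x = (LINT y|gauss I. \<bar>F x - F (comb I c x s y)\<bar>)" for x
  have iJ: "integrable (gauss I) (\<lambda>y. \<bar>F x - F (comb I c x s y)\<bar>)" if [measurable]: "x \<in> Rn I" for x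
  proof (rule integrable_gauss_bounded)
    fix y show "\<bar>\<bar>F x - F (comb I c x s y)\<bar>\<bar> \<le> M"
      using bnd[OF that] bnd[OF comb_in_space[of I c x s y]] by auto
  qed measurable
  have Jb: "F x * indicator (- U) x / 8 \<le> J x" if x[measurable]: "x \<in> Rn I" for x
  proof (cases "x \<in> U")
    case True
    then show ?thesis by (simp add: J_def)
  next
    case False
    let ?S = "{y \<in> Rn I. F x / 2 < F (comb I c x s y)}"
    have "measure (gauss I) ?S < 3 / 4" using False x by (auto simp: U_def)
    then have "1 / 4 \<le> measure (gauss I) (Rn I - ?S)"
      by (subst gauss.prob_compl) auto
    then have "F x / 2 * (1 / 4) \<le> F x / 2 * measure (gauss I) (Rn I - ?S)"
      using bnd[OF x] by (intro mult_left_mono) auto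
    also have "... = (LINT y|gauss I. F x / 2 * indicator (Rn I - ?S) y)"
      by simp
    also have "... \<le> J x"
      unfolding J_def using bnd[OF x] iJ[OF x]
      by (intro integral_mono) (auto simp: indicator_def intro!: integrable_gauss_bounded[of _ _ M])
    finally show ?thesis using False by simp
  qed
  have eJ: "(LINT p|gauss2 I. \<bar>F (fst p) - F (comb I c (fst p) s (snd p))\<bar>) = (LINT x|gauss I. J x)"
    unfolding J_def
  proof (subst gauss2_integral_fst)
    show "integrable (gauss2 I) (\<lambda>p. \<bar>F (fst p) - F (comb I c (fst p) s (snd p))\<bar>)"
    proof (rule integrable_gauss2_bounded)
      fix x y assume "x \<in> Rn I" "y \<in> Rn I"
      then show "\<bar>\<bar>F (fst (x, y)) - F (comb I c (fst (x, y)) s (snd (x, y)))\<bar>\<bar> \<le> M"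
        using bnd[of x] bnd[OF comb_in_space[of I c x s y]] by auto
    qed measurable
  qed simp
  have JM: "\<bar>J x\<bar> \<le> M" if x: "x \<in> Rn I" for x
  proof -
    have "J x \<le> M" unfolding J_def
    proof (rule gauss.integral_le_const[OF iJ[OF x]], rule AE_I2)
      fix y show "\<bar>F x - F (comb I c x s y)\<bar> \<le> M"
        using bnd[OF x] bnd[OF comb_in_space[of I c x s y]] by auto
    qed
    then show ?thesis by (simp add: J_def)
  qed
  have [measurable]: "J \<in> borel_measurable (gauss I)" unfolding J_def by measurable
  have M0: "0 \<le> M" using bnd[OF comb_in_space[of I 0 undefined 0 undefined]] by auto
  have pw: "F x * indicator {x. \<kappa> \<le> F x} x \<le> 8 * J x + \<kappa> powr (- \<tau>) * (F x * indicator U x) powr (1 / c^2)"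
    if x: "x \<in> Rn I" for x
  proof (cases "x \<in> U \<and> \<kappa> \<le> F x")
    case True
    have "F x = \<kappa> powr (- \<tau>) * \<kappa> powr \<tau> * F x" using \<kappa> by (simp add: powr_minus)
    also have "... \<le> \<kappa> powr (- \<tau>) * F x powr \<tau> * F x"
      using True \<kappa> \<tau>0 by (intro mult_right_mono mult_left_mono powr_mono2) auto
    also have "... = \<kappa> powr (- \<tau>) * F x powr (1 + \<tau>)"
      using True \<kappa> by (simp add: powr_add)
    finally have "F x \<le> \<kappa> powr (- \<tau>) * (F x * indicator U x) powr (1 / c^2)"
      using True by (simp add: \<tau>1)
    moreover have "0 \<le> J x" by (simp add: J_def)
    ultimately show ?thesis using True by simp
  next
    case False
    have "F x * indicator {x. \<kappa> \<le> F x} x \<le> F x * indicator (- U) x"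
      using False bnd[OF x] by (auto simp: indicator_def)
    also have "... \<le> 8 * J x" using Jb[OF x] by simp
    finally show ?thesis
      by (smt (verit) mult_nonneg_nonneg powr_ge_zero)
  qed
  have i2: "integrable (gauss I) (\<lambda>x. (F x * indicator U x) powr (1 / c^2))"
  proof (rule integrable_gauss_bounded)
    fix x assume x: "x \<in> Rn I"
    then show "\<bar>(F x * indicator U x) powr (1 / c^2)\<bar> \<le> M powr (1 / c^2)"
      using bnd[OF x] c2 by (auto intro!: powr_mono2 simp: indicator_def)
  qed measurable
  have iJ': "integrable (gauss I) J" by (rule integrable_gauss_bounded[OF _ JM]) measurable
  have "(LINT x|gauss I. F x * indicator {x. \<kappa> \<le> F x} x) \<le>
     (LINT x|gauss I. 8 * J x + \<kappa> powr (- \<tau>) * (F x * indicator U x) powr (1 / c^2))"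
  proof (rule integral_mono)
    have [measurable]: "(\<lambda>x. indicator {x. \<kappa> \<le> F x} x :: real) \<in> borel_measurable (gauss I)"
    proof -
      have "(\<lambda>x. if \<kappa> \<le> F x then 1 else 0 :: real) \<in> borel_measurable (gauss I)" by measurable
      then show ?thesis by (simp add: indicator_def)
    qed
    show "integrable (gauss I) (\<lambda>x. F x * indicator {x. \<kappa> \<le> F x} x)"
    proof (rule integrable_gauss_bounded)
      fix x assume "x \<in> Rn I"
      then show "\<bar>F x * indicator {x. \<kappa> \<le> F x} x\<bar> \<le> M" using bnd M0 by (auto simp: indicator_def)
    qed measurable
  qed (use pw i2 iJ' in auto)
  also have "... = 8 * (LINT x|gauss I. J x) + \<kappa> powr (- \<tau>) * (LINT x|gauss I. (F x * indicator U x) powr (1 / c^2))"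
    using i2 iJ' by simp
  also have "(LINT x|gauss I. (F x * indicator U x) powr (1 / c^2)) \<le> (8 * (LINT x|gauss I. F x)) powr (1 + \<tau>)"
  proof -
    let ?V = "LINT x|gauss I. (F x * indicator U x) powr (1 / c^2)"
    have "?V = (?V powr c^2) powr (1 / c^2)"
      using c2 by (simp add: powr_powr)
    also have "... \<le> (8 * (LINT x|gauss I. F x)) powr (1 / c^2)"
      using U(1) c2 by (intro powr_mono2) auto
    finally show ?thesis by (simp only: \<tau>1)
  qed
  finally show ?thesis
    by (simp add: eJ mult_left_mono)
qed

section \<open>The upper bound for the noise\<close>

lemma gauss1_tail:
  obtains C where "0 \<le> C" "\<And>R. 0 < R \<Longrightarrow> measure gauss1 {u. R < \<bar>u\<bar>} \<le> C / R ^ 4"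
proof
  \<comment> \<open>With steps of size \<open>a\<close> the box will have side of order
    \<open>1 / sqrt a\<close>. The fourth moment makes its complement of order \<open>a^2\<close>,
    which still vanishes after summing over order \<open>1 / a\<close> steps.\<close>
  have int: "integrable gauss1 (\<lambda>u. u ^ 4)"
    using integrable_std_normal_moment[of 4] by (subst integrable_density) auto
  let ?C = "LINT u|gauss1. u ^ 4"
  show "0 \<le> ?C" by simp
  fix R :: real assume R: "0 < R"
  have "measure gauss1 {u. R < \<bar>u\<bar>} \<le> measure gauss1 {u \<in> space gauss1. R ^ 4 \<le> u ^ 4}"
  proof (intro gauss1.finite_measure_mono subsetI)
    fix u assume "u \<in> {u. R < \<bar>u\<bar>}"
    then have "R ^ 4 \<le> \<bar>u\<bar> ^ 4" using R by (intro power_mono) auto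
    then show "u \<in> {u \<in> space gauss1. R ^ 4 \<le> u ^ 4}" by simp
  next
    have "{u. R ^ 4 \<le> u ^ 4} \<in> sets borel" by measurable
    then show "{u \<in> space gauss1. R ^ 4 \<le> u ^ 4} \<in> sets gauss1" by simp
  qed
  also have "... \<le> ?C / R ^ 4"
    using int R by (intro integral_Markov_inequality_measure[where A = "{}"]) auto
  finally show "measure gauss1 {u. R < \<bar>u\<bar>} \<le> ?C / R ^ 4" .
qed

lemma sets_gauss_box: "finite I \<Longrightarrow> {y \<in> Rn I. \<exists>i\<in>I. R < \<bar>y i\<bar>} \<in> sets (gauss I)"
  by (intro sets.sets_Collect_finite_Ex) measurable

lemma gauss_tail:
  assumes I: "finite I" and C: "\<And>R. 0 < R \<Longrightarrow> measure gauss1 {u. R < \<bar>u\<bar>} \<le> C / R ^ 4" and R: "0 < R"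
  shows "measure (gauss I) {y \<in> Rn I. \<exists>i\<in>I. R < \<bar>y i\<bar>} \<le> card I * (C / R ^ 4)"
proof -
  have *: "measure (gauss I) {y \<in> Rn I. R < \<bar>y i\<bar>} \<le> C / R ^ 4" if i: "i \<in> I" for i
  proof -
    have "measure gauss1 {u. R < \<bar>u\<bar>} = measure (distr (gauss I) gauss1 (\<lambda>y. y i)) {u. R < \<bar>u\<bar>}"
      unfolding gauss_def using distr_PiM_component[of I "\<lambda>_. gauss1" i] i gauss1.prob_space_axioms by simp
    also have "... = measure (gauss I) ((\<lambda>y. y i) -` {u. R < \<bar>u\<bar>} \<inter> Rn I)"
      using i by (intro measure_distr) auto
    also have "(\<lambda>y. y i) -` {u. R < \<bar>u\<bar>} \<inter> Rn I = {y \<in> Rn I. R < \<bar>y i\<bar>}" by auto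
    finally show ?thesis using C[OF R] by simp
  qed
  have "{y \<in> Rn I. \<exists>i\<in>I. R < \<bar>y i\<bar>} = (\<Union>i\<in>I. {y \<in> Rn I. R < \<bar>y i\<bar>})" by auto
  also have "measure (gauss I) ... \<le> (\<Sum>i\<in>I. measure (gauss I) {y \<in> Rn I. R < \<bar>y i\<bar>})"
    by (intro measure_UNION_le I) measurable
  also have "... \<le> (\<Sum>i\<in>I. C / R ^ 4)" by (intro sum_mono *)
  finally show ?thesis by simp
qed

lemma ed_comb: "ed I (comb I a x b y) (comb I a x b y') = \<bar>b\<bar> * ed I y y'"
proof -
  have "ed I (comb I a x b y) (comb I a x b y') = L2_set (\<lambda>i. b * (y i - y' i)) I"
    unfolding ed_def by (intro L2_set_cong) (auto simp: algebra_simps)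
  then show ?thesis
    by (simp add: ed_def L2_set_def power_mult_distrib sum_distrib_left[symmetric] real_sqrt_mult)
qed

definition noise :: "nat set \<Rightarrow> ((nat \<Rightarrow> real) \<Rightarrow> real) \<Rightarrow> real \<Rightarrow> real" where
  "noise I F \<theta> = (LINT p|gauss2 I. \<bar>F (fst p) - F (comb I (cos \<theta>) (fst p) (sin \<theta>) (snd p))\<bar>)"

text \<open>Rotating the pair by \<alpha> yields another independent standard pair, and rotating
  that pair by \<beta> reaches the angle \<open>\<alpha> + \<beta>\<close>; the triangle inequality
  does the rest.\<close>

lemma noise_add_le:
  assumes I: "finite I" and F[measurable]: "F \<in> borel_measurable (gauss I)"
    and bnd: "\<And>x. x \<in> Rn I \<Longrightarrow> 0 \<le> F x \<and> F x \<le> M"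
  shows "noise I F (\<alpha> + \<beta>) \<le> noise I F \<alpha> + noise I F \<beta>"
proof -
  let ?k = "\<lambda>\<beta> q. \<bar>F (fst q) - F (comb I (cos \<beta>) (fst q) (sin \<beta>) (snd q))\<bar>"
  let ?r = "\<lambda>p. (comb I (cos \<alpha>) (fst p) (sin \<alpha>) (snd p), comb I (- sin \<alpha>) (fst p) (cos \<alpha>) (snd p))"
  have int: "integrable (gauss2 I) (?k \<beta>)" for \<beta>
  proof (rule integrable_gauss2_bounded)
    fix x y assume x: "x \<in> Rn I"
    show "\<bar>\<bar>F (fst (x, y)) - F (comb I (cos \<beta>) (fst (x, y)) (sin \<beta>) (snd (x, y)))\<bar>\<bar> \<le> M"
      using bnd[OF x] bnd[OF comb_in_space[of I "cos \<beta>" x "sin \<beta>" y]] by auto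
  qed measurable
  have int': "integrable (gauss2 I) (\<lambda>p. ?k \<beta> (?r p))"
  proof (rule integrable_gauss2_bounded)
    fix x y
    show "\<bar>?k \<beta> (?r (x, y))\<bar> \<le> M"
      using bnd[OF comb_in_space[of I "cos \<alpha>" x "sin \<alpha>" y]]
        bnd[OF comb_in_space[of I "cos \<beta>" "comb I (cos \<alpha>) x (sin \<alpha>) y" "sin \<beta>" "comb I (- sin \<alpha>) x (cos \<alpha>) y"]] by auto
  qed measurable
  have r: "comb I (cos \<beta>) (fst (?r p)) (sin \<beta>) (snd (?r p)) = comb I (cos (\<alpha> + \<beta>)) (fst p) (sin (\<alpha> + \<beta>)) (snd p)" for p
    by (auto simp: comb_def fun_eq_iff cos_add sin_add algebra_simps)
  have "noise I F (\<alpha> + \<beta>) \<le> (LINT p|gauss2 I. ?k \<alpha> p + ?k \<beta> (?r p))"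
    unfolding noise_def
  proof (rule integral_mono)
    fix p
    show "?k (\<alpha> + \<beta>) p \<le> ?k \<alpha> p + ?k \<beta> (?r p)"
      unfolding r by simp
  qed (use int int' in auto)
  also have "... = noise I F \<alpha> + (LINT p|gauss2 I. ?k \<beta> (?r p))"
    unfolding noise_def by (rule Bochner_Integration.integral_add[OF int int'])
  also have "(LINT p|gauss2 I. ?k \<beta> (?r p)) = noise I F \<beta>"
    unfolding noise_def by (rule gauss2_integral_rotation[OF I]) (simp, measurable)
  finally show ?thesis .
qed

lemma comb_1_0: "x \<in> Rn I \<Longrightarrow> comb I 1 x 0 y = x"
  by (auto simp: comb_def space_gauss fun_eq_iff PiE_def extensional_def)

lemma noise_0: "noise I F 0 = 0"
proof -
  have "noise I F 0 = (LINT p|gauss2 I. 0)"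
    unfolding noise_def
    by (intro Bochner_Integration.integral_cong) (auto simp: space_pair_measure comb_1_0)
  then show ?thesis by simp
qed

lemma noise_mult_le:
  assumes I: "finite I" and F: "F \<in> borel_measurable (gauss I)"
    and bnd: "\<And>x. x \<in> Rn I \<Longrightarrow> 0 \<le> F x \<and> F x \<le> M"
  shows "noise I F (real n * \<alpha>) \<le> real n * noise I F \<alpha>"
proof (induction n)
  case (Suc n)
  have "noise I F (real n * \<alpha> + \<alpha>) \<le> noise I F (real n * \<alpha>) + noise I F \<alpha>"
    by (rule noise_add_le[OF I F bnd])
  with Suc show ?case by (simp add: algebra_simps)
qed (simp add: noise_0)

text \<open>Rotating the pair back by half the angle places the two points symmetrically, so that
  exchanging them amounts to changing the sign of the second vector.\<close>

lemma noise_double: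
  assumes I: "finite I" and F[measurable]: "F \<in> borel_measurable (gauss I)"
  shows "noise I F (2 * a) =
    (LINT p|gauss2 I. \<bar>F (comb I (cos a) (fst p) (- sin a) (snd p)) - F (comb I (cos a) (fst p) (sin a) (snd p))\<bar>)"
proof -
  let ?k = "\<lambda>q. \<bar>F (fst q) - F (comb I (cos (2 * a)) (fst q) (sin (2 * a)) (snd q))\<bar>"
  let ?r = "\<lambda>p. (comb I (cos a) (fst p) (- sin a) (snd p), comb I (- (- sin a)) (fst p) (cos a) (snd p))"
  have c: "cos (2 * a) * cos a + sin (2 * a) * sin a = cos a"
    using cos_diff[of "2 * a" a] by simp
  have s: "sin (2 * a) * cos a - cos (2 * a) * sin a = sin a"
    using sin_diff[of "2 * a" a] by simp
  have r: "comb I (cos (2 * a)) (fst (?r p)) (sin (2 * a)) (snd (?r p)) = comb I (cos a) (fst p) (sin a) (snd p)" for p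
  proof
    fix i
    have "cos (2 * a) * (cos a * x + (- sin a) * y) + sin (2 * a) * (sin a * x + cos a * y) =
       (cos (2 * a) * cos a + sin (2 * a) * sin a) * x + (sin (2 * a) * cos a - cos (2 * a) * sin a) * y" for x y
      by (simp add: algebra_simps)
    also have "... x y = cos a * x + sin a * y" for x y unfolding c s ..
    finally show "comb I (cos (2 * a)) (fst (?r p)) (sin (2 * a)) (snd (?r p)) i = comb I (cos a) (fst p) (sin a) (snd p) i"
      by (simp add: comb_def)
  qed
  have "(LINT p|gauss2 I. ?k p) = (LINT p|gauss2 I. ?k (?r p))"
    by (rule gauss2_integral_rotation[OF I, symmetric]) (simp, measurable)
  then show ?thesis unfolding noise_def r by simp
qed

text \<open>
  For fixed \<open>x\<close> the difference \<open>F (c x + s y) - F (c x - s y)\<close> is odd in \<open>y\<close>, so concentration bounds its mean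
  without any differentiability of \<open>F\<close>. Clamping the coordinates of \<open>y\<close> keeps it odd
  and makes the local Lipschitz bound applicable.
\<close>

lemma symmetric_increment_bound:
  fixes R a :: real
  assumes I: "finite I" and F[measurable]: "F \<in> borel_measurable (gauss I)"
    and bnd: "\<And>x. x \<in> Rn I \<Longrightarrow> 0 \<le> F x \<and> F x \<le> M"
    and G: "0 \<le> g"
    and lip: "\<And>y y'. y \<in> Rn I \<Longrightarrow> y' \<in> Rn I \<Longrightarrow> ed I x y \<le> \<rho> \<Longrightarrow> ed I x y' \<le> \<rho> \<Longrightarrow>
       F y - F y' \<le> g * ed I y y'"
    and x[measurable]: "x \<in> Rn I" and xR: "\<And>i. i \<in> I \<Longrightarrow> \<bar>x i\<bar> \<le> R"
    and R: "0 \<le> R" and a: "0 \<le> a" "a \<le> 1" and \<rho>: "card I * (2 * a * R) \<le> \<rho>"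
  shows "(LINT y|gauss I. \<bar>F (comb I (cos a) x (- sin a) y) - F (comb I (cos a) x (sin a) y)\<bar>) \<le>
     8 * a * g + M * measure (gauss I) {y \<in> Rn I. \<exists>i\<in>I. R < \<bar>y i\<bar>}"
proof -
  let ?T = "{y \<in> Rn I. \<exists>i\<in>I. R < \<bar>y i\<bar>}"
  define cl where "cl y = (\<lambda>i\<in>I. max (- R) (min R (y i)))" for y :: "nat \<Rightarrow> real"
  have cls: "cl y \<in> Rn I" for y by (simp add: cl_def space_gauss)
  have [measurable]: "cl \<in> measurable (gauss I) (gauss I)"
  proof -
    have "(\<lambda>y. \<lambda>i\<in>I. max (- R) (min R (y i))) \<in> measurable (gauss I) (Pi\<^sub>M I (\<lambda>_. gauss1))"
      by (rule measurable_restrict) simp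
    then show ?thesis by (simp add: gauss_def cl_def[abs_def])
  qed
  have s: "\<bar>sin a\<bar> \<le> a" using abs_sin_x_le_abs_x[of a] a by simp
  have c: "0 \<le> 1 - cos a" "1 - cos a \<le> a"
  proof -
    have "1 - cos a = 2 * (sin (a / 2))^2"
      using cos_double_sin[of "a / 2"] by simp
    also have "... \<le> 2 * (a / 2)^2"
      using abs_sin_x_le_abs_x[of "a / 2"] a by (intro mult_left_mono abs_le_square_iff[THEN iffD1]) auto
    also have "... \<le> a * 1"
      using a mult_left_mono[OF a(2) a(1)] by (simp add: power2_eq_square)
    finally show "1 - cos a \<le> a" by simp
  qed simp
  \<comment> \<open>Both \<open>1 - cos a\<close> and \<open>\<bar>sin a\<bar>\<close> are at most
    \<open>a\<close>, so each coordinate moves by at most \<open>2 * a * R\<close>. The crude sum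
    over coordinates enters only this smallness condition.\<close>
  have near: "ed I x (comb I (cos a) x b (cl y)) \<le> \<rho>" if b: "\<bar>b\<bar> \<le> a" for b y
  proof -
    have "ed I x (comb I (cos a) x b (cl y)) \<le> (\<Sum>i\<in>I. \<bar>x i - comb I (cos a) x b (cl y) i\<bar>)"
      unfolding ed_def by (rule L2_set_le_sum_abs)
    also have "... \<le> (\<Sum>i\<in>I. 2 * a * R)"
    proof (rule sum_mono)
      fix i assume i: "i \<in> I"
      have "\<bar>cl y i\<bar> \<le> R" using i R by (auto simp: cl_def)
      then have "\<bar>b * cl y i\<bar> \<le> a * R" unfolding abs_mult using b R a by (intro mult_mono) auto
      moreover have "\<bar>(1 - cos a) * x i\<bar> \<le> a * R"
        unfolding abs_mult using c a xR[OF i] by (intro mult_mono) auto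
      moreover have "x i - comb I (cos a) x b (cl y) i = (1 - cos a) * x i - b * cl y i"
        using i by (simp add: algebra_simps)
      ultimately show "\<bar>x i - comb I (cos a) x b (cl y) i\<bar> \<le> 2 * a * R" by linarith
    qed
    also have "... \<le> \<rho>" using \<rho> by simp
    finally show ?thesis .
  qed
  have cl_lip: "ed I (cl y) (cl y') \<le> ed I y y'" for y y'
  proof -
    have "(\<Sum>i\<in>I. (cl y i - cl y' i)^2) \<le> (\<Sum>i\<in>I. (y i - y' i)^2)"
      by (intro sum_mono abs_le_square_iff[THEN iffD1]) (auto simp: cl_def)
    then show ?thesis by (simp add: ed_def L2_set_def)
  qed
  define D where "D y = F (comb I (cos a) x (sin a) (cl y)) - F (comb I (cos a) x (- sin a) (cl y))" for y
  have [measurable]: "D \<in> borel_measurable (gauss I)" unfolding D_def by measurable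
  have DM: "\<bar>D y\<bar> \<le> M" for y
    using bnd[OF comb_in_space[of I "cos a" x "sin a" "cl y"]] bnd[OF comb_in_space[of I "cos a" x "- sin a" "cl y"]]
    by (auto simp: D_def)
  \<comment> \<open>Each of the two terms of \<open>D\<close> contributes Lipschitz constant
    \<open>a * g\<close>.\<close>
  have ED: "(LINT y|gauss I. \<bar>D y\<bar>) \<le> 4 * (2 * a * g)"
  proof (rule gauss_odd_lipschitz[OF I _ DM])
    fix y y' assume "y \<in> Rn I" "y' \<in> Rn I"
    have st: "F (comb I (cos a) x b (cl y)) - F (comb I (cos a) x b (cl y')) \<le> g * (a * ed I y y')"
      if b: "\<bar>b\<bar> \<le> a" for b y y'
    proof -
      have "F (comb I (cos a) x b (cl y)) - F (comb I (cos a) x b (cl y')) \<le> g * (\<bar>b\<bar> * ed I (cl y) (cl y'))"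
        unfolding ed_comb[of I "cos a" x b, symmetric] by (rule lip) (use near b in auto)
      also have "... \<le> g * (a * ed I y y')"
        using G b cl_lip a by (intro mult_left_mono mult_mono) auto
      finally show ?thesis .
    qed
    have sym: "ed I y' y = ed I y y'" by (simp add: ed_def L2_set_def power2_commute)
    have "D y - D y' \<le> 2 * (g * (a * ed I y y'))"
      using st[of "sin a" y y'] st[of "- sin a" y' y] s unfolding sym D_def by linarith
    then show "D y - D y' \<le> 2 * a * g * ed I y y'" by (simp add: mult_ac)
  next
    fix y
    have "comb I (cos a) x b (cl (comb I (- 1) y 0 y)) = comb I (cos a) x (- b) (cl y)" for b
    proof -
      have "cl (comb I (- 1) y 0 y) i = - cl y i" if "i \<in> I" for i
        using that R by (auto simp: cl_def min_def max_def)
      then show ?thesis by (auto simp: comb_def fun_eq_iff)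
    qed
    then show "D (comb I (- 1) y 0 y) = - D y" by (simp add: D_def)
  qed (use G a in auto)
  have mT: "?T \<in> sets (gauss I)" by (rule sets_gauss_box[OF I])
  have iD: "integrable (gauss I) (\<lambda>y. \<bar>D y\<bar>)"
    using DM by (intro integrable_gauss_bounded[of _ _ M]) auto
  have iT: "integrable (gauss I) (\<lambda>y. M * indicator ?T y :: real)"
    using mT by (intro integrable_mult_right integrable_real_indicator) (auto simp: gauss.emeasure_eq_measure)
  have "(LINT y|gauss I. \<bar>F (comb I (cos a) x (- sin a) y) - F (comb I (cos a) x (sin a) y)\<bar>) \<le>
      (LINT y|gauss I. \<bar>D y\<bar> + M * indicator ?T y)"
  proof (rule integral_mono)
    have FM: "\<bar>\<bar>F (comb I (cos a) x (- sin a) y) - F (comb I (cos a) x (sin a) y)\<bar>\<bar> \<le> M" for y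
      using bnd[OF comb_in_space[of I "cos a" x "sin a" y]] bnd[OF comb_in_space[of I "cos a" x "- sin a" y]]
      by auto
    show "integrable (gauss I) (\<lambda>y. \<bar>F (comb I (cos a) x (- sin a) y) - F (comb I (cos a) x (sin a) y)\<bar>)"
      by (rule integrable_gauss_bounded[OF _ FM]) measurable
    fix y assume y: "y \<in> Rn I"
    show "\<bar>F (comb I (cos a) x (- sin a) y) - F (comb I (cos a) x (sin a) y)\<bar> \<le> \<bar>D y\<bar> + M * indicator ?T y"
    proof (cases "y \<in> ?T")
      case True
      then show ?thesis using FM[of y] by auto
    next
      case False
      then have "\<forall>i\<in>I. \<bar>y i\<bar> \<le> R" using y by auto
      then have "cl y = y" using y
        by (auto simp: cl_def fun_eq_iff space_gauss PiE_def extensional_def abs_le_iff min_def max_def)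
      moreover have "indicator ?T y = (0 :: real)" using False by simp
      ultimately show ?thesis by (simp add: D_def abs_minus_commute del: indicator_eq_0_iff)
    qed
  qed (use iD iT in auto)
  also have "... = (LINT y|gauss I. \<bar>D y\<bar>) + M * measure (gauss I) ?T"
    using iD iT mT by simp
  finally show ?thesis using ED by simp
qed

text \<open>\<open>G x\<close> bounds the Lipschitz constant of \<open>F\<close> on the ball of
  radius \<rho> around \<open>x\<close>, in place of a gradient. With \<open>n\<close> increments of
  angle \<open>2 * a = \<theta> / n\<close>, the main terms \<open>8 * a * E G\<close> add up to
  \<open>4 * \<theta> * E G\<close> for every \<open>n\<close>, while the localization errors
  disappear in the limit.\<close>

theorem noise_upper_bound:
  assumes I: "finite I" and F[measurable]: "F \<in> borel_measurable (gauss I)"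
    and bnd: "\<And>x. x \<in> Rn I \<Longrightarrow> 0 \<le> F x \<and> F x \<le> M"
    and G[measurable]: "G \<in> borel_measurable (gauss I)"
    and Gb: "\<And>x. x \<in> Rn I \<Longrightarrow> 0 \<le> G x \<and> G x \<le> K"
    and \<rho>: "0 < \<rho>"
    and lip: "\<And>x y y'. x \<in> Rn I \<Longrightarrow> y \<in> Rn I \<Longrightarrow> y' \<in> Rn I \<Longrightarrow>
       ed I x y \<le> \<rho> \<Longrightarrow> ed I x y' \<le> \<rho> \<Longrightarrow> F y - F y' \<le> G x * ed I y y'"
    and \<theta>: "0 < \<theta>"
  shows "noise I F \<theta> \<le> 4 * \<theta> * (LINT x|gauss I. G x)"
proof -
  obtain C where C: "0 \<le> C" "\<And>R. 0 < R \<Longrightarrow> measure gauss1 {u. R < \<bar>u\<bar>} \<le> C / R ^ 4"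
    using gauss1_tail by blast
  define EG where "EG = (LINT x|gauss I. G x)"
  have M0: "0 \<le> M" using bnd[OF comb_in_space[of I 0 undefined 0 undefined]] by auto
  have iG: "integrable (gauss I) G"
    using Gb by (intro integrable_gauss_bounded[of _ _ K]) auto
  have step: "noise I F (2 * a) \<le> 8 * a * EG + 2 * M * (card I * (C / R ^ 4))"
    if a: "0 \<le> a" "a \<le> 1" and R: "0 < R" and sm: "card I * (2 * a * R) \<le> \<rho>" for a R :: real
  proof -
    define T where "T = {y \<in> Rn I. \<exists>i\<in>I. R < \<bar>y i\<bar>}"
    have T[measurable]: "T \<in> sets (gauss I)" unfolding T_def by (rule sets_gauss_box[OF I])
    have iT: "integrable (gauss I) (\<lambda>y. M * indicator T y :: real)"
      using T by (intro integrable_mult_right integrable_real_indicator) (auto simp: gauss.emeasure_eq_measure)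
    let ?d = "\<lambda>x y. \<bar>F (comb I (cos a) x (- sin a) y) - F (comb I (cos a) x (sin a) y)\<bar>"
    have dM: "\<bar>?d x y\<bar> \<le> M" for x y
      using bnd[OF comb_in_space[of I "cos a" x "sin a" y]] bnd[OF comb_in_space[of I "cos a" x "- sin a" y]]
      by auto
    have id: "integrable (gauss I) (?d x)" if [measurable]: "x \<in> Rn I" for x
      by (rule integrable_gauss_bounded[OF _ dM]) measurable
    have dM': "(LINT y|gauss I. ?d x y) \<le> M" if x: "x \<in> Rn I" for x
      using dM by (intro gauss.integral_le_const[OF id[OF x]]) auto
    have "noise I F (2 * a) = (LINT x|gauss I. LINT y|gauss I. ?d x y)"
      unfolding noise_double[OF I F] by (subst gauss2_integral_fst)
        (auto intro!: integrable_gauss2_bounded[of _ _ M] simp: dM[simplified])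
    \<comment> \<open>Points \<open>x\<close> outside the box are charged the trivial bound
      \<open>M\<close>; inside, concentration in the second variable applies.\<close>
    also have "... \<le> (LINT x|gauss I. (8 * a * G x + M * measure (gauss I) T) + M * indicator T x)"
    proof (rule integral_mono)
      show "integrable (gauss I) (\<lambda>x. LINT y|gauss I. ?d x y)"
        using dM' by (intro integrable_gauss_bounded[of _ _ M]) auto
      show "integrable (gauss I) (\<lambda>x. (8 * a * G x + M * measure (gauss I) T) + M * indicator T x)"
        using iG iT by simp
      fix x assume x: "x \<in> Rn I"
      show "(LINT y|gauss I. ?d x y) \<le> (8 * a * G x + M * measure (gauss I) T) + M * indicator T x"
      proof (cases "x \<in> T")
        case True
        have "0 \<le> 8 * a * G x + M * measure (gauss I) T" using a Gb[OF x] M0 by auto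
        then show ?thesis using dM'[OF x] True by simp
      next
        case False
        then have xR: "\<bar>x i\<bar> \<le> R" if "i \<in> I" for i using that x by (auto simp: T_def)
        have "(LINT y|gauss I. ?d x y) \<le> 8 * a * G x + M * measure (gauss I) T"
          unfolding T_def using Gb[OF x] R
          by (intro symmetric_increment_bound[OF I F bnd _ lip[OF x] x xR _ a sm]) auto
        then show ?thesis using False by simp
      qed
    qed
    also have "... = 8 * a * EG + 2 * M * measure (gauss I) T"
      using iG iT by (simp add: gauss.prob_space EG_def)
    also have "... \<le> 8 * a * EG + 2 * M * (card I * (C / R ^ 4))"
      using gauss_tail[OF I C(2) R] M0 unfolding T_def by (intro add_left_mono mult_left_mono) auto
    finally show ?thesis .
  qed
  have ev: "\<forall>\<^sub>F n in sequentially. noise I F \<theta> \<le> 4 * \<theta> * EG + (M * card I * C * \<theta>^2 / 2) / real n"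
  proof -
    have "(\<lambda>n. \<theta> / (2 * real n)) \<longlonglongrightarrow> 0" by real_asymp
    then have e1: "\<forall>\<^sub>F n in sequentially. \<theta> / (2 * real n) < 1"
      by (rule order_tendstoD) simp
    have "(\<lambda>n. card I * (2 * sqrt (\<theta> / (2 * real n)))) \<longlonglongrightarrow> card I * (2 * sqrt 0)"
      using \<open>(\<lambda>n. \<theta> / (2 * real n)) \<longlonglongrightarrow> 0\<close> by (intro tendsto_intros)
    then have e2: "\<forall>\<^sub>F n in sequentially. card I * (2 * sqrt (\<theta> / (2 * real n))) < \<rho>"
      by (rule order_tendstoD) (use \<rho> in simp)
    show ?thesis
      using e1 e2 eventually_gt_at_top[of 0]
    proof eventually_elim
      case (elim n)
      define a where "a = \<theta> / (2 * real n)"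
      have a: "0 < a" "a \<le> 1" using elim \<theta> by (auto simp: a_def)
      \<comment> \<open>Then \<open>a * R = sqrt a\<close> tends to 0, so increments eventually stay
        within \<rho>, while the error per step is of order \<open>a^2\<close> and the total over
        \<open>n\<close> steps is of order \<open>1 / n\<close>.\<close>
      define R where "R = 1 / sqrt a"
      have R: "0 < R" using a by (simp add: R_def)
      have "a * R = sqrt a" using a by (simp add: R_def real_div_sqrt)
      then have sm: "card I * (2 * a * R) \<le> \<rho>" using elim(2) by (simp add: a_def[symmetric] mult.assoc)
      have "sqrt a ^ 4 = (sqrt a ^ 2) ^ 2" by (simp flip: power_mult)
      then have "1 / R ^ 4 = a^2" using a by (simp add: R_def power_divide)
      then have R4: "C / R ^ 4 = C * a^2" by (metis times_divide_eq_right mult.right_neutral)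
      have n\<theta>: "\<theta> = real n * (2 * a)" using elim by (simp add: a_def)
      have "noise I F \<theta> \<le> real n * noise I F (2 * a)"
        unfolding n\<theta> by (rule noise_mult_le[OF I F bnd])
      also have "... \<le> real n * (8 * a * EG + 2 * M * (card I * (C / R ^ 4)))"
        using step[OF _ a(2) R sm] a by (intro mult_left_mono) auto
      also have "... = 4 * \<theta> * EG + (M * card I * C * \<theta>^2 / 2) / real n"
        unfolding R4 using elim by (simp add: a_def field_simps power2_eq_square)
      finally show ?case .
    qed
  qed
  have "(\<lambda>n. 4 * \<theta> * EG + (M * card I * C * \<theta>^2 / 2) / real n) \<longlonglongrightarrow> 4 * \<theta> * EG"
    by real_asymp
  from tendsto_lowerbound[OF this ev] show ?thesis by (simp add: EG_def)
qed

section \<open>Log-Lipschitz perturbations\<close>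

lemma ed_commute: "ed I x y = ed I y x"
  by (simp add: ed_def L2_set_def power2_commute)

lemma ed_triangle: "ed I x z \<le> ed I x y + ed I y z"
  using L2_set_triangle_ineq[of "\<lambda>i. x i - y i" "\<lambda>i. y i - z i" I] by (simp add: ed_def)

lemma ed_self [simp]: "ed I x x = 0"
  by (simp add: ed_def L2_set_def)

text \<open>Preimages of open sets are open in the Euclidean metric, hence measurable by
  \<open>sets_std_gaussian\<close>. Measurability of \<open>W\<close> will come from its gradient
  bound in this way.\<close>

lemma borel_measurable_gauss_lipschitz:
  fixes F :: "(nat \<Rightarrow> real) \<Rightarrow> real"
  assumes lip: "\<And>x y. x \<in> Rn {..<d} \<Longrightarrow> y \<in> Rn {..<d} \<Longrightarrow> F x - F y \<le> L * ed {..<d} x y"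
  shows "F \<in> borel_measurable (gauss {..<d})"
proof (rule borel_measurableI)
  fix S :: "real set" assume S: "open S"
  let ?E = "Rn {..<d}"
  interpret M: Metric_space ?E "ed {..<d}"
    unfolding space_gauss ed_def by (rule Metric_space_eucl)
  have top: "mtopology_of (eucl d) = M.mtopology"
    by (simp add: mtopology_of_def space_gauss ed_def[abs_def])
  have "openin M.mtopology (F -` S \<inter> ?E)"
    unfolding M.openin_mtopology
  proof (intro conjI allI impI)
    fix x assume "x \<in> F -` S \<inter> ?E"
    then obtain r where x: "x \<in> ?E" and r: "r > 0" "\<And>u. dist u (F x) < r \<Longrightarrow> u \<in> S"
      using S by (auto simp: open_dist)
    have "M.mball x (r / (\<bar>L\<bar> + 1)) \<subseteq> F -` S \<inter> ?E"
    proof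
      fix y assume "y \<in> M.mball x (r / (\<bar>L\<bar> + 1))"
      then have y: "y \<in> ?E" "ed {..<d} x y < r / (\<bar>L\<bar> + 1)" by auto
      have "\<bar>F y - F x\<bar> \<le> L * ed {..<d} x y"
        using lip[OF x y(1)] lip[OF y(1) x] by (simp add: ed_commute abs_le_iff)
      also have "... \<le> (\<bar>L\<bar> + 1) * ed {..<d} x y"
        by (intro mult_right_mono) auto
      also have "... < r" using y(2) by (simp add: pos_less_divide_eq mult.commute)
      finally show "y \<in> F -` S \<inter> ?E" using y r by (auto simp: dist_real_def)
    qed
    then show "\<exists>r>0. M.mball x r \<subseteq> F -` S \<inter> ?E"
      using r(1) by (intro exI[of _ "r / (\<bar>L\<bar> + 1)"]) auto
  qed auto
  then have "F -` S \<inter> ?E \<in> borel_sets_of (eucl d)"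
    unfolding borel_sets_of_def top by (intro sigma_sets.Basic) simp
  then show "F -` S \<inter> ?E \<in> sets (gauss {..<d})"
    using sets_std_gaussian[of d] by (simp add: std_gaussian_eq)
qed

lemma has_gradient_segment_derivative:
  assumes x: "x \<in> Rn {..<d}" and y: "y \<in> Rn {..<d}"
    and g: "has_gradient d W g (comb {..<d} (1 - t) x t y)"
  shows "((\<lambda>t. W (comb {..<d} (1 - t) x t y)) has_field_derivative (\<Sum>i<d. g i * (y i - x i))) (at t)"
\<comment> \<open>The difference quotient is rescaled by the distance of \<open>x\<close> and
  \<open>y\<close>, so the degenerate segment is treated apart.\<close>
proof (cases "x = y")
  case True
  have "comb {..<d} (1 - t) x t y = x" for t
    using x True by (auto simp: comb_def fun_eq_iff space_gauss PiE_def extensional_def algebra_simps)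
  then show ?thesis using True by simp
next
  case False
  let ?E = "Rn {..<d}"
  interpret M: Metric_space ?E "ed {..<d}"
    unfolding space_gauss ed_def by (rule Metric_space_eucl)
  have top: "mtopology_of (eucl d) = M.mtopology"
    by (simp add: mtopology_of_def space_gauss ed_def[abs_def])
  let ?z = "\<lambda>t. comb {..<d} (1 - t) x t y"
  let ?S = "\<Sum>i<d. g i * (y i - x i)"
  have D: "0 < ed {..<d} x y" using M.mdist_pos_less[OF False x y] .
  have diff: "?z t' i - ?z t i = (t' - t) * (y i - x i)" if "i < d" for i t'
    using that by (simp add: algebra_simps)
  have dist: "ed {..<d} (?z t') (?z t) = \<bar>t' - t\<bar> * ed {..<d} x y" for t'
  proof -
    have "ed {..<d} (?z t') (?z t) = L2_set (\<lambda>i. (t' - t) * (y i - x i)) {..<d}"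
      unfolding ed_def by (intro L2_set_cong) (simp_all add: algebra_simps)
    also have "... = \<bar>t' - t\<bar> * L2_set (\<lambda>i. y i - x i) {..<d}"
      by (simp add: L2_set_def power_mult_distrib sum_distrib_left[symmetric] real_sqrt_mult)
    finally show ?thesis by (simp add: ed_commute[of _ x y]) (simp add: ed_def)
  qed
  have grad: "\<exists>\<delta>>0. \<forall>w\<in>?E. 0 < ed {..<d} w (?z t) \<and> ed {..<d} w (?z t) < \<delta> \<longrightarrow>
      \<bar>(W w - W (?z t) - (\<Sum>i<d. g i * (w i - ?z t i))) / ed {..<d} w (?z t)\<bar> < e" if "e > 0" for e
  proof -
    have "eventually (\<lambda>w. dist ((W w - W (?z t) - (\<Sum>i<d. g i * (w i - ?z t i))) / mdist (eucl d) w (?z t)) 0 < e)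
       (atin (mtopology_of (eucl d)) (?z t))"
      using g[unfolded has_gradient_def] that by (rule tendstoD)
    then show ?thesis
      unfolding top M.eventually_atin_metric
      by (auto simp: M.commute ed_def dist_real_def)
  qed
  show ?thesis
    unfolding DERIV_def
  proof (rule LIM_I)
    fix r :: real assume r: "0 < r"
    then obtain \<delta> where \<delta>: "\<delta> > 0" and near: "\<And>w. w \<in> ?E \<Longrightarrow> 0 < ed {..<d} w (?z t) \<Longrightarrow> ed {..<d} w (?z t) < \<delta> \<Longrightarrow>
      \<bar>(W w - W (?z t) - (\<Sum>i<d. g i * (w i - ?z t i))) / ed {..<d} w (?z t)\<bar> < r / ed {..<d} x y"
      using grad[of "r / ed {..<d} x y"] D by auto
    show "\<exists>s>0. \<forall>h. h \<noteq> 0 \<and> norm (h - 0) < s \<longrightarrow> norm ((W (?z (t + h)) - W (?z t)) / h - ?S) < r"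
    proof (intro exI[of _ "\<delta> / ed {..<d} x y"] conjI allI impI)
      show "0 < \<delta> / ed {..<d} x y" using \<delta> D by simp
      fix h :: real assume h: "h \<noteq> 0 \<and> norm (h - 0) < \<delta> / ed {..<d} x y"
      have dh: "ed {..<d} (?z (t + h)) (?z t) = \<bar>h\<bar> * ed {..<d} x y" using dist[of "t + h"] by simp
      have "(\<Sum>i<d. g i * (?z (t + h) i - ?z t i)) = h * ?S"
        using diff[of _ "t + h"] by (simp add: sum_distrib_left mult_ac)
      then have "\<bar>(W (?z (t + h)) - W (?z t) - h * ?S) / (\<bar>h\<bar> * ed {..<d} x y)\<bar> < r / ed {..<d} x y"
        using near[of "?z (t + h)"] h D unfolding dh by (simp add: field_simps)
      then have "\<bar>W (?z (t + h)) - W (?z t) - h * ?S\<bar> / \<bar>h\<bar> < r"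
        using D by (simp add: abs_mult divide_less_cancel flip: divide_divide_eq_left)
      moreover have "(W (?z (t + h)) - W (?z t)) / h - ?S = (W (?z (t + h)) - W (?z t) - h * ?S) / h"
        using h by (simp add: field_simps)
      ultimately show "norm ((W (?z (t + h)) - W (?z t)) / h - ?S) < r"
        by (simp add: abs_divide)
    qed
  qed
qed

text \<open>The gradient exists at every point but may be discontinuous, so the mean value theorem
  on the segment is applied, followed by Cauchy-Schwarz.\<close>

lemma bounded_gradient_lipschitz:
  assumes grad: "\<And>x. x \<in> Rn {..<d} \<Longrightarrow> \<exists>g. has_gradient d W g x \<and> L2_set g {..<d} \<le> L"
    and x: "x \<in> Rn {..<d}" and y: "y \<in> Rn {..<d}"
  shows "W y - W x \<le> L * ed {..<d} y x"
proof -
  let ?z = "\<lambda>t. comb {..<d} (1 - t) x t y"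
  have "\<forall>t. \<exists>g. has_gradient d W g (?z t) \<and> L2_set g {..<d} \<le> L"
    using grad[OF comb_in_space] by blast
  from choice[OF this] obtain g
    where "\<forall>t. has_gradient d W (g t) (?z t) \<and> L2_set (g t) {..<d} \<le> L" ..
  then have g: "\<And>t. has_gradient d W (g t) (?z t)" "\<And>t. L2_set (g t) {..<d} \<le> L" by blast+
  have "\<exists>t>0. t < 1 \<and> W (?z 1) - W (?z 0) = (1 - 0) * (\<Sum>i<d. g t i * (y i - x i))"
    using has_gradient_segment_derivative[OF x y g(1)] by (intro MVT2) (rule zero_less_one)
  then obtain t where t: "W (?z 1) - W (?z 0) = (1 - 0) * (\<Sum>i<d. g t i * (y i - x i))"
    by blast
  have "?z 0 = x" "?z 1 = y"
    using x y by (auto simp: comb_def fun_eq_iff space_gauss PiE_def extensional_def)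
  then have "W y - W x = (\<Sum>i<d. g t i * (y i - x i))" using t by simp
  also have "... \<le> (\<Sum>i<d. \<bar>g t i\<bar> * \<bar>y i - x i\<bar>)"
    by (intro sum_mono) (metis abs_ge_self abs_mult)
  also have "... \<le> L2_set (g t) {..<d} * ed {..<d} y x"
    unfolding ed_def by (rule L2_set_mult_ineq)
  also have "... \<le> L * ed {..<d} y x"
    using g(2) by (intro mult_right_mono) auto
  finally show ?thesis .
qed

text \<open>The first two bounds follow by integrating the nonnegative functions
  \<open>(exp V - m)^2\<close> and \<open>(1 - u * exp (- V))^2 * exp V\<close>, where
  \<open>m\<close> and \<open>u\<close> are the optimal constants.\<close>

lemma gauss_jensen:
  fixes V :: "(nat \<Rightarrow> real) \<Rightarrow> real"
  assumes V[measurable]: "V \<in> borel_measurable (gauss I)" and bnd: "\<And>x. x \<in> Rn I \<Longrightarrow> \<bar>V x\<bar> \<le> K"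
  shows "(LINT x|gauss I. exp (V x))^2 \<le> (LINT x|gauss I. exp (2 * V x))"
    and "1 / (LINT x|gauss I. exp (- V x)) \<le> (LINT x|gauss I. exp (V x))"
    and "0 < (LINT x|gauss I. exp (- V x))"
proof -
  have i: "integrable (gauss I) (\<lambda>x. exp (a * V x))" for a
  proof (rule integrable_gauss_bounded)
    fix x assume x: "x \<in> Rn I"
    have "\<bar>a * V x\<bar> \<le> \<bar>a\<bar> * K"
      unfolding abs_mult using bnd[OF x] by (intro mult_left_mono) auto
    then have "a * V x \<le> \<bar>a\<bar> * K" by linarith
    then show "\<bar>exp (a * V x)\<bar> \<le> exp (\<bar>a\<bar> * K)" by simp
  qed measurable
  note i1 = i[of 1, simplified] i[of 2] i[of "- 1", simplified]
  have N: "exp (- K) \<le> (LINT x|gauss I. exp (- V x))"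
    by (rule gauss.integral_ge_const) (use i1 bnd in \<open>auto simp: abs_le_iff\<close>)
  then show pos: "0 < (LINT x|gauss I. exp (- V x))"
    using exp_gt_zero[of "- K"] by linarith
  define m where "m = (LINT x|gauss I. exp (V x))"
  have "(LINT x|gauss I. 2 * m * exp (V x) - m\<^sup>2) \<le> (LINT x|gauss I. exp (2 * V x))"
  proof (rule integral_mono)
    fix x
    have "0 \<le> (exp (V x) - m)^2" by simp
    then show "2 * m * exp (V x) - m\<^sup>2 \<le> exp (2 * V x)"
      unfolding exp_double by (simp add: power2_eq_square algebra_simps)
  qed (use i1 in auto)
  then show "(LINT x|gauss I. exp (V x))^2 \<le> (LINT x|gauss I. exp (2 * V x))"
    using i1 by (simp add: gauss.prob_space m_def power2_eq_square)
  define u where "u = 1 / (LINT x|gauss I. exp (- V x))"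
  have "(LINT x|gauss I. 2 * u - u\<^sup>2 * exp (- V x)) \<le> (LINT x|gauss I. exp (V x))"
  proof (rule integral_mono)
    fix x
    have "0 \<le> (1 - u * exp (- V x))^2 * exp (V x)" by simp
    also have "... = exp (V x) - 2 * u * (exp (- V x) * exp (V x)) + u^2 * exp (- V x) * (exp (- V x) * exp (V x))"
      by (simp add: power2_eq_square algebra_simps)
    also have "exp (- V x) * exp (V x) = 1" by (simp flip: exp_add)
    finally show "2 * u - u\<^sup>2 * exp (- V x) \<le> exp (V x)" by simp
  qed (use i1 in auto)
  moreover have "(LINT x|gauss I. 2 * u - u\<^sup>2 * exp (- V x)) = u"
    using i1 pos by (simp add: gauss.prob_space u_def power2_eq_square)
  ultimately show "1 / (LINT x|gauss I. exp (- V x)) \<le> (LINT x|gauss I. exp (V x))"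
    by (simp add: u_def)
qed

text \<open>The gradient of \<open>W\<close> enters the rest of the proof only through this
  Lipschitz bound.\<close>

locale log_lipschitz_perturbation =
  fixes d :: nat and L :: real and W :: "(nat \<Rightarrow> real) \<Rightarrow> real"
  assumes L: "0 \<le> L"
    and lip: "x \<in> Rn {..<d} \<Longrightarrow> y \<in> Rn {..<d} \<Longrightarrow> W x - W y \<le> L * ed {..<d} x y"
    and prob: "prob_space (density (gauss {..<d}) (\<lambda>x. ennreal (exp (- W x))))"
begin

abbreviation "\<gamma> \<equiv> gauss {..<d}"

definition "\<mu> = density \<gamma> (\<lambda>x. ennreal (exp (- W x)))"

sublocale G: prob_space \<gamma> by (rule prob_space_gauss)
sublocale Mu: prob_space \<mu> unfolding \<mu>_def by (rule prob)

lemma W_measurable [measurable]: "W \<in> borel_measurable \<gamma>"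
  by (rule borel_measurable_gauss_lipschitz[OF lip])

lemma sets_mu [simp]: "sets \<mu> = sets \<gamma>" and space_mu [simp]: "space \<mu> = space \<gamma>"
  by (simp_all add: \<mu>_def)

lemma integrable_density: "integrable \<gamma> (\<lambda>x. exp (- W x))"
  and integral_density: "(LINT x|\<gamma>. exp (- W x)) = 1"
proof -
  have "(\<integral>\<^sup>+x. ennreal (exp (- W x)) \<partial>\<gamma>) = emeasure \<mu> (space \<mu>)"
    by (simp add: \<mu>_def emeasure_density cong: nn_integral_cong)
  also have "... = 1" by (rule Mu.emeasure_space_1)
  finally have 1: "(\<integral>\<^sup>+x. ennreal (exp (- W x)) \<partial>\<gamma>) = ennreal 1" by simp
  then show "integrable \<gamma> (\<lambda>x. exp (- W x))"
    by (intro integrableI_nn_integral_finite[of _ _ 1]) auto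
  from 1 show "(LINT x|\<gamma>. exp (- W x)) = 1"
    by (subst integral_eq_nn_integral) auto
qed

lemma measure_mu:
  assumes [measurable]: "S \<in> sets \<gamma>"
  shows "measure \<mu> S = (LINT x|\<gamma>. exp (- W x) * indicator S x)"
    and "integrable \<gamma> (\<lambda>x. exp (- W x) * indicator S x)"
proof -
  show *: "integrable \<gamma> (\<lambda>x. exp (- W x) * indicator S x)"
    using integrable_real_mult_indicator[OF assms integrable_density] by simp
  have "emeasure \<mu> S = (\<integral>\<^sup>+x. ennreal (exp (- W x) * indicator S x) \<partial>\<gamma>)"
    unfolding \<mu>_def by (subst emeasure_density) (auto intro!: nn_integral_cong simp: ennreal_mult' indicator_def)
  also have "... = ennreal (LINT x|\<gamma>. exp (- W x) * indicator S x)"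
    by (rule nn_integral_eq_integral[OF *]) simp
  finally show "measure \<mu> S = (LINT x|\<gamma>. exp (- W x) * indicator S x)"
    by (simp add: measure_def)
qed

text \<open>Two-sided truncation keeps the Lipschitz constant and supplies the boundedness assumed
  by the concentration lemma.\<close>

definition "trunc n x = max (- real n) (min (real n) (W x))"

lemma trunc_measurable [measurable]: "trunc n \<in> borel_measurable \<gamma>"
  unfolding trunc_def[abs_def] by measurable

lemma trunc_bounded: "\<bar>trunc n x\<bar> \<le> real n"
  by (auto simp: trunc_def)

lemma trunc_lipschitz: "x \<in> space \<gamma> \<Longrightarrow> y \<in> space \<gamma> \<Longrightarrow> trunc n x - trunc n y \<le> L * ed {..<d} x y"
proof -
  assume xy: "x \<in> space \<gamma>" "y \<in> space \<gamma>"
  have "0 \<le> L * ed {..<d} x y" using L by simp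
  then show ?thesis using lip[OF xy] by (auto simp: trunc_def min_def max_def)
qed

lemma trunc_eventually: "\<forall>\<^sub>F n in sequentially. trunc n x = W x"
proof -
  obtain N where N: "\<bar>W x\<bar> \<le> real N" using real_arch_simple by blast
  show ?thesis
    using eventually_ge_at_top[of N]
  proof eventually_elim
    case (elim n)
    then have "\<bar>W x\<bar> \<le> real n" using N by linarith
    then show ?case by (auto simp: trunc_def)
  qed
qed

text \<open>Concentration for the \<open>2 * L\<close>-Lipschitz function \<open>2 * W\<close> gives
  \<open>exp ((2 * L)^2)\<close> for a product of two moments; the factor 4 compensates a lower
  bound 1/4 for the other moment.\<close>

definition "expC = 4 * exp (4 * L^2)"

lemma expC_pos: "0 < expC" by (simp add: expC_def)

text \<open>
  Concentration bounds only the product of the moments of \<open>exp (2 * W)\<close> and \<open>exp (- 2 * W)\<close>. The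
  normalization of \<open>\<mu>\<close> bounds each factor from below by Jensen's inequality, hence the other from above.
\<close>

lemma trunc_moments:
  "\<forall>\<^sub>F n in sequentially. (LINT x|\<gamma>. exp (2 * trunc n x)) \<le> expC \<and> (LINT x|\<gamma>. exp (- 2 * trunc n x)) \<le> expC"
proof -
  have "(\<lambda>n. LINT x|\<gamma>. exp (- trunc n x)) \<longlonglongrightarrow> (LINT x|\<gamma>. exp (- W x))"
  proof (rule integral_dominated_convergence[where w = "\<lambda>x. 1 + exp (- W x)"])
    show "integrable \<gamma> (\<lambda>x. 1 + exp (- W x))" using integrable_density by simp
    show "AE x in \<gamma>. (\<lambda>n. exp (- trunc n x)) \<longlonglongrightarrow> exp (- W x)"
    proof (rule AE_I2)
      fix x
      have "\<forall>\<^sub>F n in sequentially. exp (- W x) = exp (- trunc n x)"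
        using trunc_eventually[of x] by eventually_elim simp
      then show "(\<lambda>n. exp (- trunc n x)) \<longlonglongrightarrow> exp (- W x)"
        by (rule Lim_transform_eventually[OF tendsto_const])
    qed
    fix n
    show "AE x in \<gamma>. norm (exp (- trunc n x)) \<le> 1 + exp (- W x)"
    proof (rule AE_I2)
      fix x
      have "- trunc n x \<le> max 0 (- W x)" by (auto simp: trunc_def)
      then have "exp (- trunc n x) \<le> exp (max 0 (- W x))" by simp
      also have "... \<le> 1 + exp (- W x)" by (auto simp: max_def)
      finally show "norm (exp (- trunc n x)) \<le> 1 + exp (- W x)" by simp
    qed
  qed measurable
  then have lim: "(\<lambda>n. LINT x|\<gamma>. exp (- trunc n x)) \<longlonglongrightarrow> 1" by (simp add: integral_density)
  \<comment> \<open>The normalization to 1 holds only in the limit. Staying between 1/2 and 2 is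
    enough for both moments to be at least 1/4.\<close>
  have "\<forall>\<^sub>F n in sequentially. 1/2 < (LINT x|\<gamma>. exp (- trunc n x))" "\<forall>\<^sub>F n in sequentially. (LINT x|\<gamma>. exp (- trunc n x)) < 2"
    by (rule order_tendstoD[OF lim]; simp)+
  then show ?thesis
  proof eventually_elim
    case (elim n)
    define A B P N where "A = (LINT x|\<gamma>. exp (2 * trunc n x))" "B = (LINT x|\<gamma>. exp (- 2 * trunc n x))"
      "P = (LINT x|\<gamma>. exp (trunc n x))" "N = (LINT x|\<gamma>. exp (- trunc n x))"
    note defs = this
    have "A * (LINT x|\<gamma>. exp (- (2 * trunc n x))) \<le> exp ((2 * L)^2)"
      unfolding defs
    proof (rule gauss_exp_lipschitz[where K = "2 * real n"])
      show "2 * trunc n x - 2 * trunc n y \<le> 2 * L * ed {..<d} x y" if "x \<in> space \<gamma>" "y \<in> space \<gamma>" for x y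
        using trunc_lipschitz[OF that, of n] by simp
    qed (use trunc_bounded[of n] in \<open>auto simp: abs_mult\<close>)
    then have AB: "A * B \<le> exp (4 * L^2)" by (simp add: defs power_mult_distrib)
    have PA: "P^2 \<le> A" and PN: "1 / N \<le> P"
      using gauss_jensen(1,2)[of "trunc n" "{..<d}" "real n"] trunc_bounded[of n] by (auto simp: defs)
    have NB: "N^2 \<le> B"
      using gauss_jensen(1)[of "\<lambda>x. - trunc n x" "{..<d}" "real n"] trunc_bounded[of n] by (auto simp: defs)
    have N: "1/2 < N" "N < 2" using elim by (auto simp: defs)
    have "(1/2)^2 \<le> N^2" using N by (intro power_mono) auto
    then have B: "1/4 \<le> B" using NB by (simp add: power2_eq_square)
    have "1/2 \<le> 1 / N" using N by (simp add: field_simps)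
    then have "(1/2)^2 \<le> P^2" using PN by (intro power_mono) auto
    then have A: "1/4 \<le> A" using PA by (simp add: power2_eq_square)
    have "A * (1/4) \<le> A * B" using A B by (intro mult_left_mono) auto
    moreover have "(1/4) * B \<le> A * B" using A B by (intro mult_right_mono) auto
    ultimately have "A \<le> expC" "B \<le> expC" using AB by (auto simp: expC_def)
    then show ?case by (simp add: defs)
  qed
qed

text \<open>Fatou's lemma transfers the uniform bounds from the truncations to
  \<open>W\<close>.\<close>

lemma exp_moment:
  assumes a: "a = 2 \<or> a = - 2"
  shows "integrable \<gamma> (\<lambda>x. exp (a * W x))" and "(LINT x|\<gamma>. exp (a * W x)) \<le> expC"
proof -
  have "(\<integral>\<^sup>+x. ennreal (exp (a * W x)) \<partial>\<gamma>) = (\<integral>\<^sup>+x. liminf (\<lambda>n. ennreal (exp (a * trunc n x))) \<partial>\<gamma>)"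
  proof (rule nn_integral_cong)
    fix x
    have "\<forall>\<^sub>F n in sequentially. ennreal (exp (a * W x)) = ennreal (exp (a * trunc n x))"
      using trunc_eventually[of x] by eventually_elim simp
    then have "(\<lambda>n. ennreal (exp (a * trunc n x))) \<longlonglongrightarrow> ennreal (exp (a * W x))"
      by (rule Lim_transform_eventually[OF tendsto_const])
    then show "ennreal (exp (a * W x)) = liminf (\<lambda>n. ennreal (exp (a * trunc n x)))"
      by (rule lim_imp_Liminf[OF sequentially_bot, symmetric])
  qed
  also have "... \<le> liminf (\<lambda>n. \<integral>\<^sup>+x. ennreal (exp (a * trunc n x)) \<partial>\<gamma>)"
    by (rule nn_integral_liminf) measurable
  also have "... \<le> liminf (\<lambda>n::nat. ennreal expC)"
  proof (rule Liminf_mono)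
    show "\<forall>\<^sub>F n in sequentially. (\<integral>\<^sup>+x. ennreal (exp (a * trunc n x)) \<partial>\<gamma>) \<le> ennreal expC"
      using trunc_moments
    proof eventually_elim
      case (elim n)
      have "integrable \<gamma> (\<lambda>x. exp (a * trunc n x))"
      proof (rule integrable_gauss_bounded)
        fix x
        have "a * trunc n x \<le> 2 * real n" using a trunc_bounded[of n x] by (auto simp: abs_le_iff)
        then show "\<bar>exp (a * trunc n x)\<bar> \<le> exp (2 * real n)" by simp
      qed measurable
      then have "(\<integral>\<^sup>+x. ennreal (exp (a * trunc n x)) \<partial>\<gamma>) = ennreal (LINT x|\<gamma>. exp (a * trunc n x))"
        by (rule nn_integral_eq_integral) simp
      then show ?case using elim a by (auto intro: ennreal_leI)
    qed
  qed
  also have "... = ennreal expC" by (simp add: Liminf_const)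
  finally have le: "(\<integral>\<^sup>+x. ennreal (exp (a * W x)) \<partial>\<gamma>) \<le> ennreal expC" .
  then have "(\<integral>\<^sup>+x. ennreal (exp (a * W x)) \<partial>\<gamma>) < \<infinity>"
    by (rule order.strict_trans1) simp
  then show int: "integrable \<gamma> (\<lambda>x. exp (a * W x))"
    by (intro integrableI_bounded) auto
  show "(LINT x|\<gamma>. exp (a * W x)) \<le> expC"
    using le expC_pos by (subst (asm) nn_integral_eq_integral[OF int]) auto
qed

end

section \<open>Separated sets\<close>

definition set_ed :: "nat \<Rightarrow> (nat \<Rightarrow> real) set \<Rightarrow> (nat \<Rightarrow> real) \<Rightarrow> real" where
  "set_ed d A x = (INF a\<in>A. ed {..<d} x a)"

lemma bdd_below_ed: "bdd_below ((\<lambda>a. ed I x a) ` A)"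
  by (intro bdd_belowI[of _ 0]) auto

lemma set_ed_le: "a \<in> A \<Longrightarrow> set_ed d A x \<le> ed {..<d} x a"
  unfolding set_ed_def using bdd_below_ed by (rule cINF_lower)

lemma set_ed_lipschitz:
  assumes "A \<noteq> {}"
  shows "set_ed d A x \<le> set_ed d A y + ed {..<d} x y"
proof -
  have "set_ed d A x - ed {..<d} x y \<le> set_ed d A y"
    unfolding set_ed_def[of d A y]
  proof (rule cINF_greatest[OF assms])
    fix a assume "a \<in> A"
    then show "set_ed d A x - ed {..<d} x y \<le> ed {..<d} y a"
      using set_ed_le[of a A d x] ed_triangle[of "{..<d}" x a y] by linarith
  qed
  then show ?thesis by simp
qed

lemma borel_measurable_set_ed:
  assumes "A \<noteq> {}"
  shows "set_ed d A \<in> borel_measurable (gauss {..<d})"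
proof (rule borel_measurable_gauss_lipschitz)
  show "set_ed d A x - set_ed d A y \<le> 1 * ed {..<d} x y" for x y
    using set_ed_lipschitz[OF assms, of d x y] by simp
qed

text \<open>The function is constant not only on \<open>A\<close> and on \<open>B\<close> but up to
  distance \<open>t / 4\<close> from them. On small balls centred in either set it therefore has no
  slope, and all its slope is charged to the layer between; the price is slope \<open>2 / t\<close>
  instead of \<open>1 / t\<close>.\<close>

definition separates :: "nat \<Rightarrow> (nat \<Rightarrow> real) set \<Rightarrow> (nat \<Rightarrow> real) set \<Rightarrow> real \<Rightarrow> ((nat \<Rightarrow> real) \<Rightarrow> real) \<Rightarrow> bool" where
  "separates d A B t h \<longleftrightarrow> h \<in> borel_measurable (gauss {..<d}) \<and> (\<forall>x. 0 \<le> h x \<and> h x \<le> 1) \<and>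
    (\<forall>x y. h x - h y \<le> 2 / t * ed {..<d} x y) \<and>
    (\<forall>x y. x \<in> A \<longrightarrow> ed {..<d} x y \<le> t / 4 \<longrightarrow> h y = 1) \<and>
    (\<forall>x y. x \<in> B \<longrightarrow> ed {..<d} x y \<le> t / 4 \<longrightarrow> h y = 0)"

lemma separatesD:
  assumes "separates d A B t h"
  shows "h \<in> borel_measurable (gauss {..<d})" "\<And>x. 0 \<le> h x \<and> h x \<le> 1"
    "\<And>x y. h x - h y \<le> 2 / t * ed {..<d} x y"
    "\<And>x y. x \<in> A \<Longrightarrow> ed {..<d} x y \<le> t / 4 \<Longrightarrow> h y = 1"
    "\<And>x y. x \<in> B \<Longrightarrow> ed {..<d} x y \<le> t / 4 \<Longrightarrow> h y = 0"
  using assms by (simp_all add: separates_def)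

lemma separating_cutoff:
  assumes A: "A \<noteq> {}" and t: "0 < t"
    and sep: "\<And>a b. a \<in> A \<Longrightarrow> b \<in> B \<Longrightarrow> t \<le> ed {..<d} a b"
  obtains h where "separates d A B t h"
proof
  let ?dA = "set_ed d A"
  note low = set_ed_le[of _ A d] and dlip = set_ed_lipschitz[OF A, of d]
  \<comment> \<open>The ramp descends from 1 at distance \<open>t / 4\<close> from \<open>A\<close>
    to 0 at distance \<open>3 * t / 4\<close>.\<close>
  define h where "h x = max 0 (min 1 (3 / 2 - 2 / t * ?dA x))" for x
  have h01: "0 \<le> h x \<and> h x \<le> 1" for x by (simp add: h_def)
  have hl: "h x - h y \<le> 2 / t * ed {..<d} x y" for x y
  proof -
    have "2 / t * ?dA y \<le> 2 / t * (?dA x + ed {..<d} x y)"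
      using dlip[of y x] t by (intro mult_left_mono) (auto simp: ed_commute[of _ x y])
    moreover have "0 \<le> 2 / t * ed {..<d} x y" using t by simp
    ultimately show ?thesis unfolding h_def distrib_left by (auto simp: min_def max_def)
  qed
  have hA: "h y = 1" if "x \<in> A" "ed {..<d} x y \<le> t / 4" for x y
  proof -
    have "?dA y \<le> t / 4" using low[OF that(1), of y] that(2) by (simp add: ed_commute[of _ x y])
    then have "2 / t * ?dA y \<le> 2 / t * (t / 4)" using t by (intro mult_left_mono) auto
    moreover have "2 / t * (t / 4) = 1 / 2" using t by simp
    ultimately have "1 \<le> 3 / 2 - 2 / t * ?dA y" by linarith
    then show ?thesis by (simp add: h_def min_absorb1)
  qed
  have hB: "h y = 0" if x: "x \<in> B" "ed {..<d} x y \<le> t / 4" for x y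
  proof -
    have "t \<le> ?dA x"
      unfolding set_ed_def using A sep[OF _ x(1)] by (intro cINF_greatest) (auto simp: ed_commute[of _ x])
    then have "3 * t / 4 \<le> ?dA y" using dlip[of x y] x(2) by linarith
    then have "2 / t * (3 * t / 4) \<le> 2 / t * ?dA y" using t by (intro mult_left_mono) auto
    then show ?thesis using t by (simp add: h_def)
  qed
  show "separates d A B t h"
    unfolding separates_def using borel_measurable_gauss_lipschitz[OF hl] h01 hl hA hB by blast
qed

text \<open>A local product rule feeds \<open>noise_upper_bound\<close>. On balls of radius \<rho>,
  \<open>w'\<close> dominates the weight \<open>w\<close> and \<open>l\<close> its Lipschitz
  constant. The product has local Lipschitz constant 0 around points of \<open>B\<close>,
  \<open>l\<close> around points of \<open>A\<close>, and \<open>l + 2 / t * w'\<close> around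
  points of the layer.\<close>

lemma noise_separated_upper_bound:
  assumes sep: "separates d A B t h"
    and t: "0 < t" and AB[measurable]: "A \<in> sets (gauss {..<d})" "B \<in> sets (gauss {..<d})"
    and C: "C = Rn {..<d} - A - B"
    and w[measurable]: "w \<in> borel_measurable (gauss {..<d})" and wb: "\<And>x. 0 \<le> w x \<and> w x \<le> K"
    and w'[measurable]: "w' \<in> borel_measurable (gauss {..<d})" and w'b: "\<And>x. 0 \<le> w' x \<and> w' x \<le> K'"
    and l[measurable]: "l \<in> borel_measurable (gauss {..<d})" and lb: "\<And>x. 0 \<le> l x \<and> l x \<le> K'"
    and \<rho>: "0 < \<rho>" "\<rho> \<le> t / 4"
    and w_w': "\<And>x y. x \<in> Rn {..<d} \<Longrightarrow> y \<in> Rn {..<d} \<Longrightarrow> ed {..<d} x y \<le> \<rho> \<Longrightarrow> w y \<le> w' x"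
    and w_l: "\<And>x y z. x \<in> Rn {..<d} \<Longrightarrow> y \<in> Rn {..<d} \<Longrightarrow> z \<in> Rn {..<d} \<Longrightarrow>
      ed {..<d} x y \<le> \<rho> \<Longrightarrow> ed {..<d} x z \<le> \<rho> \<Longrightarrow> w y - w z \<le> l x * ed {..<d} y z"
    and \<theta>: "0 < \<theta>"
  shows "noise {..<d} (\<lambda>x. h x * w x) \<theta> \<le>
    4 * \<theta> * ((LINT x|gauss {..<d}. l x * indicator (Rn {..<d} - B) x) + 2 / t * (LINT x|gauss {..<d}. w' x * indicator C x))"
proof -
  let ?E = "Rn {..<d}"
  note h = separatesD[OF sep]
  have [measurable]: "C \<in> sets (gauss {..<d})" unfolding C by measurable
  note [measurable] = h(1)
  let ?G = "\<lambda>x. l x * indicator (?E - B) x + 2 / t * (w' x * indicator C x)"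
  have K': "0 \<le> K'" using lb[of undefined] by linarith
  have i1: "integrable (gauss {..<d}) (\<lambda>x. l x * indicator (?E - B) x)"
  proof (rule integrable_gauss_bounded)
    fix x show "\<bar>l x * indicator (?E - B) x\<bar> \<le> K'" using lb[of x] K' by (auto simp: indicator_def)
  qed measurable
  have i2: "integrable (gauss {..<d}) (\<lambda>x. w' x * indicator C x)"
  proof (rule integrable_gauss_bounded)
    fix x show "\<bar>w' x * indicator C x\<bar> \<le> K'" using w'b[of x] K' by (auto simp: indicator_def)
  qed measurable
  have "noise {..<d} (\<lambda>x. h x * w x) \<theta> \<le> 4 * \<theta> * (LINT x|gauss {..<d}. ?G x)"
  proof (rule noise_upper_bound[OF _ _ _ _ _ \<rho>(1) _ \<theta>])
    fix x
    show "0 \<le> h x * w x \<and> h x * w x \<le> K"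
    proof
      have "h x * w x \<le> 1 * w x" using h(2)[of x] wb[of x] by (intro mult_right_mono) auto
      then show "h x * w x \<le> K" using wb[of x] by simp
    qed (use h(2)[of x] wb[of x] in simp)
    have "l x * indicator (?E - B) x \<le> K'" "w' x * indicator C x \<le> K'"
      using lb[of x] w'b[of x] K' by (auto simp: indicator_def)
    moreover from this(2) have "2 / t * (w' x * indicator C x) \<le> 2 / t * K'" using t by (intro mult_left_mono) auto
    ultimately have "?G x \<le> K' + 2 / t * K'" by linarith
    then show "0 \<le> ?G x \<and> ?G x \<le> K' + 2 / t * K'"
      using lb[of x] w'b[of x] t by auto
    fix y z assume x: "x \<in> ?E" and yz: "y \<in> ?E" "z \<in> ?E" "ed {..<d} x y \<le> \<rho>" "ed {..<d} x z \<le> \<rho>"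
    have near: "ed {..<d} x y \<le> t / 4" "ed {..<d} x z \<le> t / 4" using yz \<rho> by auto
    have e: "0 \<le> ed {..<d} y z" by simp
    consider "x \<in> B" | "x \<in> A" "x \<notin> B" | "x \<in> C" using x by (auto simp: C)
    then show "h y * w y - h z * w z \<le> ?G x * ed {..<d} y z"
    proof cases
      case 1
      then have "h y = 0" "h z = 0" using h(5)[OF 1] near by auto
      then show ?thesis using lb[of x] w'b[of x] t by simp
    next
      case 2
      then have "h y = 1" "h z = 1" "x \<notin> C" using h(4)[OF 2(1)] near by (auto simp: C)
      then show ?thesis using w_l[OF x yz] 2 x by simp
    next
      case 3
      have "h y * w y - h z * w z = h y * (w y - w z) + (h y - h z) * w z" by (simp add: algebra_simps)
      also have "... \<le> 1 * (l x * ed {..<d} y z) + (2 / t * ed {..<d} y z) * w' x"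
      proof (rule add_mono)
        have "h y * (w y - w z) \<le> h y * (l x * ed {..<d} y z)"
          using w_l[OF x yz] h(2)[of y] by (intro mult_left_mono) auto
        also have "... \<le> 1 * (l x * ed {..<d} y z)"
          using h(2)[of y] lb[of x] by (intro mult_right_mono) auto
        finally show "h y * (w y - w z) \<le> 1 * (l x * ed {..<d} y z)" .
        have "(h y - h z) * w z \<le> (2 / t * ed {..<d} y z) * w z"
          using h(3)[of y z] wb[of z] by (intro mult_right_mono) auto
        also have "... \<le> (2 / t * ed {..<d} y z) * w' x"
          using w_w'[OF x yz(2,4)] t by (intro mult_left_mono) auto
        finally show "(h y - h z) * w z \<le> (2 / t * ed {..<d} y z) * w' x" .
      qed
      also have "... = ?G x * ed {..<d} y z" using 3 by (simp add: C algebra_simps)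
      finally show ?thesis .
    qed
  qed simp_all
  also have "(LINT x|gauss {..<d}. ?G x) = (LINT x|gauss {..<d}. l x * indicator (?E - B) x) + 2 / t * (LINT x|gauss {..<d}. w' x * indicator C x)"
    using i1 i2 by simp
  finally show ?thesis .
qed

section \<open>Comparison of \<mu> with the Gaussian measure\<close>

context log_lipschitz_perturbation
begin

text \<open>Where the density is below \<kappa>, it equals its cube times
  \<open>exp (2 * W)\<close>. The power 3 matters: with \<kappa> the square root of \<open>p\<close>
  the bound is of order \<open>p * sqrt p\<close>, negligible against \<open>p\<close>.\<close>

lemma mu_superlevel:
  assumes T: "0 < \<kappa>"
  shows "measure \<mu> {x \<in> space \<gamma>. exp (- W x) < \<kappa>} \<le> expC * \<kappa> ^ 3"
proof -
  let ?S = "{x \<in> space \<gamma>. exp (- W x) < \<kappa>}"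
  have [measurable]: "?S \<in> sets \<gamma>" by measurable
  have "measure \<mu> ?S = (LINT x|\<gamma>. exp (- W x) * indicator ?S x)" by (rule measure_mu) measurable
  also have "... \<le> (LINT x|\<gamma>. \<kappa> ^ 3 * exp (2 * W x))"
  proof (rule integral_mono)
    fix x
    have "exp (- W x) \<le> \<kappa> ^ 3 * exp (2 * W x)" if "exp (- W x) < \<kappa>"
    proof -
      have "exp (- W x) = exp (- W x) ^ 3 * exp (2 * W x)"
        by (simp flip: exp_of_nat_mult exp_add)
      also have "... \<le> \<kappa> ^ 3 * exp (2 * W x)"
        using that by (intro mult_right_mono power_mono) auto
      finally show ?thesis .
    qed
    then show "exp (- W x) * indicator ?S x \<le> \<kappa> ^ 3 * exp (2 * W x)"
      using T by (auto simp: indicator_def)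
  qed (use measure_mu(2)[of ?S] exp_moment(1)[of 2] in auto)
  also have "... \<le> \<kappa> ^ 3 * expC"
    using exp_moment(2)[of 2] T by (simp add: mult_left_mono)
  finally show ?thesis by (simp add: mult.commute)
qed

lemma gauss_superlevel: "measure \<gamma> {x \<in> space \<gamma>. T < W x} \<le> expC * exp (- 2 * T)"
proof -
  have "measure \<gamma> {x \<in> space \<gamma>. T < W x} \<le> measure \<gamma> {x \<in> space \<gamma>. exp (2 * T) \<le> exp (2 * W x)}"
    by (rule G.finite_measure_mono) auto
  also have "... \<le> (LINT x|\<gamma>. exp (2 * W x)) / exp (2 * T)"
    using exp_moment(1)[of 2] by (intro integral_Markov_inequality_measure[where A = "{}"]) auto
  also have "... \<le> expC / exp (2 * T)"
    using exp_moment(2)[of 2] by (intro divide_right_mono) auto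
  finally show ?thesis by (simp add: exp_minus field_simps)
qed

text \<open>Cauchy-Schwarz for the density and the indicator, by integrating the expanded square of
  \<open>1 - q * exp (- W)\<close>; \<open>q\<close> is the optimal multiplier once the second
  moment is replaced by \<open>expC\<close>.\<close>

lemma gauss_ge_mu:
  assumes S[measurable]: "S \<in> sets \<gamma>"
  shows "(measure \<mu> S)^2 / expC \<le> measure \<gamma> S"
proof -
  define q where "q = measure \<mu> S / expC"
  have 0: "0 \<le> q" using expC_pos by (simp add: q_def)
  have iS: "integrable \<gamma> (\<lambda>x. indicator S x :: real)"
  proof (rule integrable_gauss_bounded)
    fix x show "\<bar>indicator S x :: real\<bar> \<le> 1" by (simp add: indicator_def)
  qed measurable
  have "(LINT x|\<gamma>. 2 * q * (exp (- W x) * indicator S x) - q\<^sup>2 * exp (- 2 * W x)) \<le> (LINT x|\<gamma>. indicator S x)"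
  proof (rule integral_mono)
    fix x
    have "0 \<le> (1 - q * exp (- W x))^2" "0 \<le> (q * exp (- W x))^2" by simp_all
    moreover have "exp (- 2 * W x) = exp (- W x) * exp (- W x)" by (simp flip: exp_add)
    ultimately show "2 * q * (exp (- W x) * indicator S x) - q\<^sup>2 * exp (- 2 * W x) \<le> indicator S x"
      by (auto simp: indicator_def power2_eq_square algebra_simps)
  qed (use measure_mu(2)[OF S] exp_moment(1)[of "- 2"] iS in auto)
  moreover have "(LINT x|\<gamma>. 2 * q * (exp (- W x) * indicator S x) - q\<^sup>2 * exp (- 2 * W x)) =
      2 * q * measure \<mu> S - q\<^sup>2 * (LINT x|\<gamma>. exp (- 2 * W x))"
    using measure_mu[OF S] exp_moment(1)[of "- 2"] by (subst Bochner_Integration.integral_diff) auto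
  moreover have "q^2 * (LINT x|\<gamma>. exp (- 2 * W x)) \<le> q^2 * expC"
    using exp_moment(2)[of "- 2"] by (intro mult_left_mono) auto
  moreover have "2 * q * measure \<mu> S - q\<^sup>2 * expC = (measure \<mu> S)\<^sup>2 / expC"
    using expC_pos by (simp add: q_def power2_eq_square field_simps)
  ultimately show ?thesis by simp
qed

end

lemma exp_minus_diff_le:
  fixes u v :: real
  assumes "v - u \<le> e" "0 \<le> e" "exp (- u) \<le> k"
  shows "exp (- u) - exp (- v) \<le> k * e"
proof -
  have "exp (- u) - exp (- v) = exp (- u) * (1 - exp (- (v - u)))"
    by (simp add: algebra_simps flip: exp_add)
  also have "... \<le> exp (- u) * e"
  proof (rule mult_left_mono)
    show "1 - exp (- (v - u)) \<le> e" using exp_ge_add_one_self[of "- (v - u)"] assms(1) by linarith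
  qed simp
  also have "... \<le> k * e" using assms by (intro mult_right_mono) auto
  finally show ?thesis .
qed

lemma arctan_parameters:
  assumes "0 < \<tau>"
  shows "(cos (arctan (sqrt \<tau>)))^2 + (sin (arctan (sqrt \<tau>)))^2 = 1" "0 < cos (arctan (sqrt \<tau>))"
    "0 < sin (arctan (sqrt \<tau>))" "\<tau> = (sin (arctan (sqrt \<tau>)))^2 / (cos (arctan (sqrt \<tau>)))^2"
    "0 < arctan (sqrt \<tau>)" "arctan (sqrt \<tau>) \<le> sqrt \<tau>"
proof -
  show "0 < cos (arctan (sqrt \<tau>))" using assms by (simp add: cos_arctan add_pos_nonneg)
  show "0 < sin (arctan (sqrt \<tau>))" using assms by (simp add: sin_arctan add_pos_nonneg)
  have "(tan (arctan (sqrt \<tau>)))^2 = \<tau>" using assms by (simp add: tan_arctan)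
  then show "\<tau> = (sin (arctan (sqrt \<tau>)))^2 / (cos (arctan (sqrt \<tau>)))^2"
    by (simp add: tan_def power_divide)
  show "0 < arctan (sqrt \<tau>)" "arctan (sqrt \<tau>) \<le> sqrt \<tau>"
    using assms by (auto simp: arctan_le_self)
qed simp

section \<open>Isoperimetry for separated sets\<close>

context log_lipschitz_perturbation
begin

text \<open>The noise estimates need bounded functions, so \<open>W\<close> is cut off from below;
  the cutoff level may depend on \<open>W\<close> and the set because no constant in the conclusion
  involves it.\<close>

lemma truncated_mass:
  assumes S[measurable]: "S \<in> sets \<gamma>" and r: "r < measure \<mu> S"
  obtains m :: nat where "r \<le> (LINT x|\<gamma>. exp (- max (- real m) (W x)) * indicator S x)"
proof -
  have "(\<lambda>m. LINT x|\<gamma>. exp (- max (- real m) (W x)) * indicator S x) \<longlonglongrightarrow> (LINT x|\<gamma>. exp (- W x) * indicator S x)"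
  proof (rule integral_dominated_convergence[where w = "\<lambda>x. exp (- W x)"])
    show "AE x in \<gamma>. (\<lambda>m. exp (- max (- real m) (W x)) * indicator S x) \<longlonglongrightarrow> exp (- W x) * indicator S x"
    proof (rule AE_I2)
      fix x
      obtain N where N: "- W x \<le> real N" using real_arch_simple by blast
      have "\<forall>\<^sub>F m in sequentially. exp (- W x) * indicator S x = exp (- max (- real m) (W x)) * indicator S x"
        using eventually_ge_at_top[of N]
      proof eventually_elim
        case (elim m)
        then have "- real m \<le> W x" using N by linarith
        then show ?case by (simp add: max_absorb2)
      qed
      then show "(\<lambda>m. exp (- max (- real m) (W x)) * indicator S x) \<longlonglongrightarrow> exp (- W x) * indicator S x"
        by (rule Lim_transform_eventually[OF tendsto_const])
    qed
    show "AE x in \<gamma>. norm (exp (- max (- real m) (W x)) * indicator S x) \<le> exp (- W x)" for m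
      by (rule AE_I2) (auto simp: indicator_def)
  qed (use integrable_density in auto)
  then have "(\<lambda>m. LINT x|\<gamma>. exp (- max (- real m) (W x)) * indicator S x) \<longlonglongrightarrow> measure \<mu> S"
    by (simp add: measure_mu(1)[OF S])
  from order_tendstoD(1)[OF this r] have "\<exists>m. r < (LINT x|\<gamma>. exp (- max (- real m) (W x)) * indicator S x)"
    by (meson eventually_happens sequentially_bot)
  then show ?thesis using that by (meson less_imp_le)
qed

text \<open>
  The noise angle is of order \<open>1 / sqrt (ln (1 / p))\<close>, just large enough for the noise to carry a fixed
  fraction of the mass of \<open>A\<close> away. The loss \<open>L * p\<close> caused by the weight \<open>exp (- W)\<close>
  is then negligible against \<open>p * sqrt (ln (1 / p))\<close>.
\<close>

lemma small_set_isoperimetry: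
  assumes A[measurable]: "A \<in> sets \<gamma>" and B[measurable]: "B \<in> sets \<gamma>" and t: "0 < t"
    and sep: "\<And>a b. a \<in> A \<Longrightarrow> b \<in> B \<Longrightarrow> t \<le> ed {..<d} a b"
    and C: "C = space \<gamma> - A - B" and p: "p = measure \<mu> A" "0 < p" "p < 1"
    and Cp: "measure \<mu> C \<le> p" and ell: "ell = ln (1 / p)" "32 \<le> ell"
    and pL: "sqrt p * expC \<le> 1 / 8" and eL: "3072 * L \<le> sqrt ell"
  shows "p * sqrt ell / 3072 \<le> measure \<mu> C / t"
proof -
  have Ene: "A \<noteq> {}" using p by auto
  have C_sets[measurable]: "C \<in> sets \<gamma>" unfolding C by measurable
  obtain h where sh: "separates d A B t h" using separating_cutoff[OF Ene t sep] by metis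
  note h = separatesD[OF sh]
  note [measurable] = h(1)
  have hA: "h x = 1" if "x \<in> A" for x using h(4)[OF that, of x] t by simp
  have hB: "h x = 0" if "x \<in> B" for x using h(5)[OF that, of x] t by simp
  obtain m :: nat where m: "7 / 8 * p \<le> (LINT x|\<gamma>. exp (- max (- real m) (W x)) * indicator A x)"
    using truncated_mass[OF A, of "7 / 8 * p"] p by auto
  define w where "w x = exp (- max (- real m) (W x))" for x
  have [measurable]: "w \<in> borel_measurable \<gamma>" unfolding w_def by measurable
  have wb: "0 \<le> w x \<and> w x \<le> exp (real m)" for x by (simp add: w_def)
  have wW: "w x \<le> exp (- W x)" for x by (simp add: w_def)
  have iw: "integrable \<gamma> (\<lambda>x. w x * indicator S x)" if [measurable]: "S \<in> sets \<gamma>" for S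
  proof (rule integrable_gauss_bounded)
    fix x show "\<bar>w x * indicator S x\<bar> \<le> exp (real m)" using wb[of x] by (auto simp: indicator_def)
  qed measurable
  have wmu: "(LINT x|\<gamma>. w x * indicator S x) \<le> measure \<mu> S" if S[measurable]: "S \<in> sets \<gamma>" for S
    unfolding measure_mu(1)[OF S] using iw[OF S] measure_mu(2)[OF S] wW
    by (intro integral_mono) (auto simp: indicator_def)
  define F where "F x = h x * w x" for x
  have [measurable]: "F \<in> borel_measurable \<gamma>" unfolding F_def by measurable
  have Fw: "F x \<le> w x" for x
    using h(2)[of x] wb[of x] mult_right_mono[of "h x" 1 "w x"] by (simp add: F_def)
  have F0: "0 \<le> F x" for x using h(2)[of x] wb[of x] by (simp add: F_def)
  have iF: "integrable \<gamma> F"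
  proof (rule integrable_gauss_bounded)
    fix x show "\<bar>F x\<bar> \<le> exp (real m)" using F0[of x] Fw[of x] wb[of x] by simp
  qed measurable
  have BC: "measure \<mu> (space \<gamma> - B) \<le> 2 * p"
  proof -
    have "space \<gamma> - B \<subseteq> A \<union> C" by (auto simp: C)
    then have "measure \<mu> (space \<gamma> - B) \<le> measure \<mu> (A \<union> C)"
      by (intro Mu.finite_measure_mono) auto
    also have "... \<le> measure \<mu> A + measure \<mu> C" by (intro measure_Un_le) auto
    finally show ?thesis using Cp p by simp
  qed
  have intF: "(LINT x|\<gamma>. F x) \<le> 2 * p"
  proof -
    have "(LINT x|\<gamma>. F x) \<le> (LINT x|\<gamma>. w x * indicator (space \<gamma> - B) x)"
    proof (rule integral_mono)
      fix x assume "x \<in> space \<gamma>"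
      then show "F x \<le> w x * indicator (space \<gamma> - B) x"
        using Fw[of x] hB[of x] by (auto simp: F_def indicator_def)
    qed (use iF iw in auto)
    also have "... \<le> measure \<mu> (space \<gamma> - B)" by (rule wmu) measurable
    finally show ?thesis using BC by simp
  qed
  have intF0: "0 \<le> (LINT x|\<gamma>. F x)" using F0 by simp
  \<comment> \<open>A compromise: the mass of \<mu> where the density is below \<kappa> is at most
    \<open>p / 8\<close>, while the factor \<open>\<kappa> powr (- \<tau>)\<close> spends only half
    of the gain \<open>p powr \<tau>\<close>.\<close>
  define \<kappa> where "\<kappa> = sqrt p"
  have \<kappa>: "0 < \<kappa>" "\<kappa> < 1" using p by (auto simp: \<kappa>_def)
  let ?low = "{x \<in> space \<gamma>. exp (- W x) < \<kappa>}"
  have large: "3 / 4 * p \<le> (LINT x|\<gamma>. F x * indicator {x. \<kappa> \<le> F x} x)"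
  proof -
    have [measurable]: "(\<lambda>x. F x * indicator {x. \<kappa> \<le> F x} x) \<in> borel_measurable \<gamma>"
    proof -
      have "(\<lambda>x. if \<kappa> \<le> F x then F x else 0) \<in> borel_measurable \<gamma>" by measurable
      also have "(\<lambda>x. if \<kappa> \<le> F x then F x else 0) = (\<lambda>x. F x * indicator {x. \<kappa> \<le> F x} x)"
        by (auto simp: indicator_def)
      finally show ?thesis .
    qed
    have iF\<kappa>: "integrable \<gamma> (\<lambda>x. F x * indicator {x. \<kappa> \<le> F x} x)"
    proof (rule integrable_gauss_bounded)
      fix x show "\<bar>F x * indicator {x. \<kappa> \<le> F x} x\<bar> \<le> exp (real m)"
        using F0[of x] Fw[of x] wb[of x] by (auto simp: indicator_def)
    qed measurable
    have "\<kappa> ^ 3 = p * sqrt p" using p by (simp add: \<kappa>_def power3_eq_cube)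
    then have "measure \<mu> ?low \<le> p * (sqrt p * expC)"
      using mu_superlevel[OF \<kappa>(1)] by (simp add: mult_ac)
    also have "... \<le> p * (1 / 8)" using pL p by (intro mult_left_mono) auto
    finally have low: "measure \<mu> ?low \<le> p / 8" by simp
    have "(LINT x|\<gamma>. w x * indicator A x) \<le> (LINT x|\<gamma>. F x * indicator {x. \<kappa> \<le> F x} x + exp (- W x) * indicator ?low x)"
    proof (rule integral_mono)
      fix x assume x: "x \<in> space \<gamma>"
      show "w x * indicator A x \<le> F x * indicator {x. \<kappa> \<le> F x} x + exp (- W x) * indicator ?low x"
      proof (cases "x \<in> A")
        case xA: True
        then have Fx: "F x = w x" by (simp add: F_def hA)
        show ?thesis
        proof (cases "\<kappa> \<le> w x")
          case True
          then show ?thesis using Fx xA by (simp add: indicator_def)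
        next
          case False
          \<comment> \<open>A weight below 1 means that \<open>W x\<close> is positive, where the
            cutoff from below is inactive.\<close>
          then have "w x < 1" using \<kappa> by simp
          then have "0 < max (- real m) (W x)" by (simp add: w_def)
          then have "w x = exp (- W x)" by (simp add: w_def max_def split: if_splits)
          then show ?thesis using False x F0[of x] by (simp add: indicator_def)
        qed
      next
        case False
        then show ?thesis using F0[of x] by (simp add: indicator_def)
      qed
    next
      show "integrable \<gamma> (\<lambda>x. F x * indicator {x. \<kappa> \<le> F x} x + exp (- W x) * indicator ?low x)"
        using iF\<kappa> measure_mu(2)[of ?low] by simp
    qed (use iw in auto)
    also have "... = (LINT x|\<gamma>. F x * indicator {x. \<kappa> \<le> F x} x) + measure \<mu> ?low"
      using iF\<kappa> measure_mu[of ?low] by simp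
    finally show ?thesis using low m unfolding w_def by simp
  qed
  \<comment> \<open>The gain left over is \<open>p powr (\<tau> / 2) = exp (- 16)\<close>, small
    enough to beat the factor \<open>16^2 = 256\<close>.\<close>
  define \<tau> where "\<tau> = 32 / ell"
  have \<tau>: "0 < \<tau>" "\<tau> \<le> 1" "\<tau> * ell = 32" using ell by (auto simp: \<tau>_def)
  have lnp: "ln p = - ell" using p ell by (simp add: ln_div)
  have small: "\<kappa> powr (- \<tau>) * (8 * (LINT x|\<gamma>. F x)) powr (1 + \<tau>) \<le> p / 4"
  proof -
    have "(8 * (LINT x|\<gamma>. F x)) powr (1 + \<tau>) \<le> (16 * p) powr (1 + \<tau>)"
      using intF intF0 \<tau> by (intro powr_mono2) auto
    also have "... = 16 powr (1 + \<tau>) * (p * p powr \<tau>)"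
      using p by (simp add: powr_mult powr_add)
    also have "... \<le> 16 powr 2 * (p * p powr \<tau>)"
      using \<tau> p by (intro mult_right_mono powr_mono) auto
    finally have 1: "(8 * (LINT x|\<gamma>. F x)) powr (1 + \<tau>) \<le> 256 * (p * p powr \<tau>)" by simp
    have "ln \<kappa> = - ell / 2" using p lnp by (simp add: \<kappa>_def ln_sqrt)
    then have "\<kappa> powr (- \<tau>) = exp (\<tau> * ell / 2)" using \<kappa> by (simp add: powr_def)
    moreover have "p powr \<tau> = exp (- (\<tau> * ell))" using p lnp by (simp add: powr_def)
    ultimately have "\<kappa> powr (- \<tau>) * (256 * (p * p powr \<tau>)) = 256 * p * (exp 16 * exp (- 32))"
      using \<tau>(3) by simp
    also have "exp 16 * exp (- 32) = exp (- 16 :: real)" by (simp flip: exp_add)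
    also have "exp (- 16 :: real) \<le> 1 / 2 ^ 16"
    proof -
      have "(2::real) ^ 16 \<le> exp 1 ^ 16" using exp_ge_add_one_self[of 1] by (intro power_mono) auto
      also have "... = exp 16" by (simp flip: exp_of_nat_mult)
      finally show ?thesis by (simp add: exp_minus field_simps)
    qed
    finally have 2: "\<kappa> powr (- \<tau>) * (256 * (p * p powr \<tau>)) \<le> 256 * p * (1 / 2 ^ 16)"
      using p by simp
    have "\<kappa> powr (- \<tau>) * (8 * (LINT x|\<gamma>. F x)) powr (1 + \<tau>) \<le> \<kappa> powr (- \<tau>) * (256 * (p * p powr \<tau>))"
      using 1 by (intro mult_left_mono) auto
    also note 2
    also have "256 * p * (1 / 2 ^ 16) \<le> p / 4" using p by simp
    finally show ?thesis .
  qed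
  define \<theta> where "\<theta> = arctan (sqrt \<tau>)"
  note \<theta> = arctan_parameters[OF \<tau>(1), folded \<theta>_def]
  have "3 / 4 * p - p / 4 \<le> 8 * noise {..<d} F \<theta>"
  proof -
    have "(LINT x|\<gamma>. F x * indicator {x. \<kappa> \<le> F x} x) - \<kappa> powr (- \<tau>) * (8 * (LINT x|\<gamma>. F x)) powr (1 + \<tau>)
       \<le> 8 * noise {..<d} F \<theta>"
      unfolding noise_def
    proof (rule gauss_noise_lower_bound[OF _ _ _ \<theta>(1-4) \<kappa>(1)])
      show "0 \<le> F x \<and> F x \<le> exp (real m)" for x using F0[of x] Fw[of x] wb[of x] by simp
    qed simp_all
    then show ?thesis using large small by linarith
  qed
  then have lower: "p / 16 \<le> noise {..<d} F \<theta>" by simp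
  \<comment> \<open>On balls of this radius \<open>W\<close> changes by at most 1/2 and the weight
    by at most a factor 2; hence \<open>2 * w\<close> as local bound and \<open>2 * L * w\<close> as
    local Lipschitz constant below. The summand 1 covers \<open>L = 0\<close>.\<close>
  define \<rho> where "\<rho> = min (t / 4) (1 / (2 * (L + 1)))"
  have \<rho>: "0 < \<rho>" "\<rho> \<le> t / 4" using t L by (auto simp: \<rho>_def)
  have L\<rho>: "exp (L * \<rho>) \<le> 2"
  proof -
    have "L * \<rho> \<le> (L + 1) * (1 / (2 * (L + 1)))" unfolding \<rho>_def using L t by (intro mult_mono) auto
    also have "... = 1 / 2" using L by simp
    finally have "exp (L * \<rho>) \<le> exp (1 / 2)" by simp
    moreover have "exp (1 / 2 :: real) ^ 2 \<le> 2 ^ 2" using exp_le by (simp flip: exp_of_nat_mult)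
    then have "exp (1 / 2 :: real) \<le> 2" by (rule power2_le_imp_le) simp
    ultimately show ?thesis by linarith
  qed
  have Vlip: "max (- real m) (W x) - max (- real m) (W y) \<le> L * ed {..<d} x y"
    if xy: "x \<in> space \<gamma>" "y \<in> space \<gamma>" for x y
  proof -
    have "0 \<le> L * ed {..<d} x y" using L by simp
    then show ?thesis using lip[OF xy] by (auto simp: max_def)
  qed
  have w2: "w y \<le> 2 * w x" if "x \<in> space \<gamma>" "y \<in> space \<gamma>" "ed {..<d} x y \<le> \<rho>" for x y
  proof -
    have "L * ed {..<d} x y \<le> L * \<rho>" using that L by (intro mult_left_mono) auto
    then have "w y \<le> exp (L * \<rho> + - max (- real m) (W x))"
      using Vlip[OF that(1,2)] by (simp add: w_def)
    also have "... = exp (L * \<rho>) * w x" by (simp only: exp_add w_def)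
    also have "... \<le> 2 * w x" using L\<rho> wb[of x] by (intro mult_right_mono) auto
    finally show ?thesis .
  qed
  have "noise {..<d} F \<theta> \<le> 4 * \<theta> * ((LINT x|\<gamma>. (2 * L * w x) * indicator (space \<gamma> - B) x) +
      2 / t * (LINT x|\<gamma>. (2 * w x) * indicator C x))"
    unfolding F_def
  proof (rule noise_separated_upper_bound[OF sh t A B C _ wb _ _ _ _ \<rho>, where K' = "2 * exp (real m) * (1 + L)"])
    fix x
    have "w x * 2 * 1 \<le> exp (real m) * 2 * (1 + L)" using wb[of x] L by (intro mult_mono) auto
    then show "0 \<le> 2 * w x \<and> 2 * w x \<le> 2 * exp (real m) * (1 + L)" using wb[of x] by (simp add: mult_ac)
    have "w x * 2 * L \<le> exp (real m) * 2 * (1 + L)" using wb[of x] L by (intro mult_mono) auto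
    then show "0 \<le> 2 * L * w x \<and> 2 * L * w x \<le> 2 * exp (real m) * (1 + L)" using wb[of x] L by (simp add: mult_ac)
  next
    fix x y z assume xyz: "x \<in> space \<gamma>" "y \<in> space \<gamma>" "z \<in> space \<gamma>" "ed {..<d} x y \<le> \<rho>" "ed {..<d} x z \<le> \<rho>"
    have "w y - w z \<le> (2 * w x) * (L * ed {..<d} y z)"
      unfolding w_def
      by (rule exp_minus_diff_le)
         (use Vlip[OF xyz(3,2)] L w2[OF xyz(1,2,4)] in \<open>auto simp: w_def ed_commute[of _ z y]\<close>)
    then show "w y - w z \<le> 2 * L * w x * ed {..<d} y z" by (simp add: mult_ac)
  qed (use w2 \<theta> in auto)
  also have "... \<le> 4 * \<theta> * (2 * L * (2 * p) + 2 / t * (2 * measure \<mu> C))"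
  proof (intro mult_left_mono add_mono)
    have "(LINT x|\<gamma>. (2 * L * w x) * indicator (space \<gamma> - B) x) = 2 * L * (LINT x|\<gamma>. w x * indicator (space \<gamma> - B) x)"
      by (simp add: mult.assoc)
    also have "... \<le> 2 * L * (2 * p)"
      using wmu[of "space \<gamma> - B"] BC L by (intro mult_left_mono) auto
    finally show "(LINT x|\<gamma>. (2 * L * w x) * indicator (space \<gamma> - B) x) \<le> 2 * L * (2 * p)" .
    show "(LINT x|\<gamma>. (2 * w x) * indicator C x) \<le> 2 * measure \<mu> C"
      using wmu[of C] by (simp add: mult.assoc)
  qed (use t \<theta> in auto)
  also have "... = 16 * \<theta> * (L * p + measure \<mu> C / t)" by (simp add: algebra_simps)
  finally have "p / 16 \<le> 16 * \<theta> * (L * p + measure \<mu> C / t)" using lower by linarith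
  also have "... \<le> 16 * (6 / sqrt ell) * (L * p + measure \<mu> C / t)"
  proof (intro mult_right_mono mult_left_mono)
    have "sqrt \<tau> = sqrt 32 / sqrt ell" by (simp add: \<tau>_def real_sqrt_divide)
    also have "sqrt 32 \<le> 6" by (rule real_le_lsqrt) auto
    finally show "\<theta> \<le> 6 / sqrt ell" using \<theta>(6) ell by (simp add: divide_right_mono)
  qed (use L p t in auto)
  finally have "p * sqrt ell / 16 \<le> 16 * 6 * (L * p + measure \<mu> C / t)"
    using ell by (simp add: field_simps)
  \<comment> \<open>The factors 16, 16 and 6 multiply to 1536, and the assumption on
    \<open>ell\<close> lets the loss \<open>L * p\<close> consume half of
    \<open>p * sqrt ell / 1536\<close>; this is the origin of 3072.\<close>
  moreover have "3072 * (L * p) \<le> p * sqrt ell" using mult_right_mono[OF eL, of p] p by (simp add: mult_ac)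
  moreover have "y / 3072 \<le> x" if "y / 16 \<le> 16 * 6 * (z + x)" "3072 * z \<le> y" for x y z :: real
  proof -
    have "y / 16 \<le> 96 * z + 96 * x" using that(1) by (simp add: distrib_left)
    then show ?thesis using that(2) by linarith
  qed
  ultimately show ?thesis by blast
qed

lemma gauss_ge_of_mu_ge:
  assumes "S \<in> sets \<gamma>" "0 \<le> q" "q \<le> measure \<mu> S"
  shows "q^2 / expC \<le> measure \<gamma> S"
proof -
  have "q^2 / expC \<le> (measure \<mu> S)^2 / expC"
    using assms expC_pos by (intro divide_right_mono power_mono) auto
  then show ?thesis using gauss_ge_mu[OF assms(1)] by linarith
qed

text \<open>
  Here the weight \<open>exp (- W)\<close> would lose too much. It is replaced by a cutoff of \<open>W\<close> at height
  \<open>M\<close>, whose gradient is at most \<open>L / M\<close>, and the noise is an independent copy.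
\<close>

lemma large_set_isoperimetry:
  assumes A[measurable]: "A \<in> sets \<gamma>" and B[measurable]: "B \<in> sets \<gamma>" and t: "0 < t"
    and sep: "\<And>a b. a \<in> A \<Longrightarrow> b \<in> B \<Longrightarrow> t \<le> ed {..<d} a b"
    and C: "C = space \<gamma> - A - B" and q: "0 < q" "q \<le> measure \<mu> A" "q \<le> measure \<mu> B"
    and g: "g = q^2 / expC" and M: "1 \<le> M" "2 * expC / g \<le> M" "8 * pi * L / g^2 \<le> M"
  shows "g^2 / (16 * pi * exp (2 * M + 1)) \<le> measure \<mu> C / t"
proof -
  have Ene: "A \<noteq> {}" using q by auto
  have g0: "0 < g" using q expC_pos by (simp add: g)
  have gA: "g \<le> measure \<gamma> A" and gB: "g \<le> measure \<gamma> B"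
    unfolding g using q by (auto intro!: gauss_ge_of_mu_ge)
  have AB: "x \<notin> B" if "x \<in> A" for x using sep[OF that, of x] t by auto
  have C_sets[measurable]: "C \<in> sets \<gamma>" unfolding C by measurable
  obtain h where sh: "separates d A B t h" using separating_cutoff[OF Ene t sep] by metis
  note h = separatesD[OF sh]
  note [measurable] = h(1)
  have hA: "h x = 1" if "x \<in> A" for x using h(4)[OF that, of x] t by simp
  have hB: "h x = 0" if "x \<in> B" for x using h(5)[OF that, of x] t by simp
  \<comment> \<open>Equal to 1 where \<open>W\<close> is at most \<open>M\<close> and to 0 where it
    is at least \<open>2 * M\<close>, hence with Lipschitz constant \<open>L / M\<close>.\<close>
  define w where "w x = max 0 (min 1 (2 - W x / M))" for x
  have [measurable]: "w \<in> borel_measurable \<gamma>" unfolding w_def by measurable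
  have wb: "0 \<le> w x \<and> w x \<le> 1" for x by (simp add: w_def)
  define F where "F x = h x * w x" for x
  have [measurable]: "F \<in> borel_measurable \<gamma>" unfolding F_def by measurable
  have F01: "0 \<le> F x \<and> F x \<le> 1" for x
    using h(2)[of x] wb[of x] by (auto simp: F_def intro: mult_le_one)
  have low: "measure \<gamma> {x \<in> space \<gamma>. M < W x} \<le> g / 2"
  proof -
    have "measure \<gamma> {x \<in> space \<gamma>. M < W x} \<le> expC * exp (- 2 * M)" by (rule gauss_superlevel)
    also have "... \<le> expC * (1 / M)"
    proof (intro mult_left_mono)
      have "M \<le> exp (2 * M)" using exp_ge_add_one_self[of "2 * M"] M(1) by linarith
      then show "exp (- 2 * M) \<le> 1 / M" using M(1) by (simp add: exp_minus field_simps)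
    qed (use expC_pos in simp)
    also have "... \<le> g / 2" using M g0 by (simp add: field_simps)
    finally show ?thesis .
  qed
  have intFA: "g / 2 \<le> (LINT x|\<gamma>. F x * indicator A x)"
  proof -
    have [measurable]: "{x \<in> space \<gamma>. M < W x} \<in> sets \<gamma>" by measurable
    have "g - g / 2 \<le> measure \<gamma> A - measure \<gamma> {x \<in> space \<gamma>. M < W x}" using low gA by linarith
    also have "... = (LINT x|\<gamma>. indicator A x - indicator {x \<in> space \<gamma>. M < W x} x)"
      by (subst Bochner_Integration.integral_diff) (auto simp: G.emeasure_eq_measure)
    also have "... \<le> (LINT x|\<gamma>. F x * indicator A x)"
    proof (rule integral_mono)
      show "integrable \<gamma> (\<lambda>x. F x * indicator A x)"
      proof (rule integrable_gauss_bounded)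
        fix x show "\<bar>F x * indicator A x\<bar> \<le> 1" using F01[of x] by (simp add: indicator_def)
      qed measurable
      fix x assume x: "x \<in> space \<gamma>"
      have "w x = 1" if "W x \<le> M"
      proof -
        have "W x / M \<le> 1" using that M(1) by simp
        then show ?thesis by (simp add: w_def)
      qed
      then show "indicator A x - indicator {x \<in> space \<gamma>. M < W x} x \<le> F x * indicator A x"
        using F01[of x] x hA[of x] by (auto simp: indicator_def F_def)
    qed (auto simp: G.emeasure_eq_measure)
    finally show ?thesis by simp
  qed
  \<comment> \<open>At the angle \<open>pi / 2\<close> the rotated vector is the independent second
    one. On \<open>A \<times> B\<close> the difference is all of \<open>F x\<close>, as
    \<open>F\<close> vanishes on \<open>B\<close>.\<close>
  have lower: "g / 2 * g \<le> noise {..<d} F (pi / 2)"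
  proof -
    have c: "comb {..<d} 0 x 1 y = y" if "y \<in> space \<gamma>" for x y
      using that by (auto simp: comb_def space_gauss fun_eq_iff PiE_def extensional_def)
    have int: "integrable (gauss2 {..<d}) (\<lambda>p. F (fst p) * indicator A (fst p) * indicator B (snd p))"
    proof (rule integrable_gauss2_bounded)
      fix x y show "\<bar>F (fst (x, y)) * indicator A (fst (x, y)) * indicator B (snd (x, y))\<bar> \<le> 1"
        using F01[of x] by (simp add: indicator_def)
    qed measurable
    have "g / 2 * g \<le> (LINT x|\<gamma>. F x * indicator A x) * measure \<gamma> B"
      using intFA gB g0 by (intro mult_mono) auto
    also have "... = (LINT x|\<gamma>. LINT y|\<gamma>. (F x * indicator A x) * indicator B y)"
      by simp
    also have "... = (LINT p|gauss2 {..<d}. (F (fst p) * indicator A (fst p)) * indicator B (snd p))"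
      by (simp add: gauss2_integral_fst[OF int])
    also have "... \<le> noise {..<d} F (pi / 2)"
      unfolding noise_def
    proof (rule integral_mono)
      show "integrable (gauss2 {..<d}) (\<lambda>p. F (fst p) * indicator A (fst p) * indicator B (snd p))" by (rule int)
      show "integrable (gauss2 {..<d}) (\<lambda>p. \<bar>F (fst p) - F (comb {..<d} (cos (pi / 2)) (fst p) (sin (pi / 2)) (snd p))\<bar>)"
      proof (rule integrable_gauss2_bounded)
        fix x y show "\<bar>\<bar>F (fst (x, y)) - F (comb {..<d} (cos (pi / 2)) (fst (x, y)) (sin (pi / 2)) (snd (x, y)))\<bar>\<bar> \<le> 1"
          using F01[of x] F01[of "comb {..<d} (cos (pi / 2)) x (sin (pi / 2)) y"] by auto
      qed measurable
      fix p assume "p \<in> space (gauss2 {..<d})"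
      then have p: "snd p \<in> space \<gamma>" by (auto simp: space_pair_measure)
      have "F (snd p) = 0" if "snd p \<in> B" using hB[OF that] by (simp add: F_def)
      then show "F (fst p) * indicator A (fst p) * indicator B (snd p) \<le>
          \<bar>F (fst p) - F (comb {..<d} (cos (pi / 2)) (fst p) (sin (pi / 2)) (snd p))\<bar>"
        using F01[of "fst p"] by (auto simp: indicator_def c[OF p])
    qed
    finally show ?thesis .
  qed
  \<comment> \<open>Now \<open>W\<close> varies by at most 1 on such balls, so the cutoff vanishes
    near every point with \<open>W\<close> above \<open>2 * M + 1\<close>.\<close>
  define \<rho> where "\<rho> = min (t / 4) (1 / (L + 1))"
  have \<rho>: "0 < \<rho>" "\<rho> \<le> t / 4" using t L by (auto simp: \<rho>_def)
  have L\<rho>: "L * \<rho> \<le> 1"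
  proof -
    have "L * \<rho> \<le> (L + 1) * (1 / (L + 1))" unfolding \<rho>_def using L t by (intro mult_mono) auto
    then show ?thesis using L by simp
  qed
  let ?S = "{x \<in> space \<gamma>. W x \<le> 2 * M + 1}"
  have [measurable]: "?S \<in> sets \<gamma>" by measurable
  have "noise {..<d} F (pi / 2) \<le> 4 * (pi / 2) * ((LINT x|\<gamma>. L / M * indicator (space \<gamma> - B) x) +
      2 / t * (LINT x|\<gamma>. indicator ?S x * indicator C x))"
    unfolding F_def
  proof (rule noise_separated_upper_bound[OF sh t A B C _ wb _ _ _ _ \<rho>, where K' = "1 + L / M"])
    fix x
    show "0 \<le> (indicator ?S x :: real) \<and> indicator ?S x \<le> 1 + L / M" "0 \<le> L / M \<and> L / M \<le> 1 + L / M"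
      using L M(1) by (auto simp: indicator_def)
  next
    fix x y assume xy: "x \<in> space \<gamma>" "y \<in> space \<gamma>" "ed {..<d} x y \<le> \<rho>"
    have "w y = 0" if "2 * M + 1 < W x"
    proof -
      have "L * ed {..<d} x y \<le> L * \<rho>" using xy L by (intro mult_left_mono) auto
      then have "2 * M \<le> W y" using lip[OF xy(1,2)] that L\<rho> by linarith
      then have "2 \<le> W y / M" using M(1) by (simp add: field_simps)
      then show ?thesis by (simp add: w_def)
    qed
    then show "w y \<le> indicator ?S x" using wb[of y] xy by (auto simp: indicator_def)
  next
    fix x y z assume yz: "y \<in> space \<gamma>" "z \<in> space \<gamma>"
    have "(W z - W y) / M \<le> L * ed {..<d} z y / M"
      using lip[OF yz(2,1)] M(1) by (intro divide_right_mono) auto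
    moreover have "0 \<le> L * ed {..<d} z y / M" using L M(1) by simp
    moreover have "L / M * ed {..<d} y z = L * ed {..<d} z y / M" by (simp add: ed_commute)
    ultimately show "w y - w z \<le> L / M * ed {..<d} y z"
      by (auto simp: w_def min_def max_def diff_divide_distrib)
  qed simp_all
  also have "... \<le> 4 * (pi / 2) * (L / M + 2 / t * (exp (2 * M + 1) * measure \<mu> C))"
  proof (intro mult_left_mono add_mono)
    have "(LINT x|\<gamma>. L / M * indicator (space \<gamma> - B) x) = L / M * measure \<gamma> (space \<gamma> - B)" by simp
    also have "... \<le> L / M * 1" using L M(1) by (intro mult_left_mono) auto
    finally show "(LINT x|\<gamma>. L / M * indicator (space \<gamma> - B) x) \<le> L / M" by simp
    \<comment> \<open>Return from the Gaussian measure to \<mu>: on the support of the cutoff the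
      density is at least \<open>exp (- (2 * M + 1))\<close>.\<close>
    have "(LINT x|\<gamma>. indicator ?S x * indicator C x) \<le> (LINT x|\<gamma>. exp (2 * M + 1) * (exp (- W x) * indicator C x))"
    proof (rule integral_mono)
      show "integrable \<gamma> (\<lambda>x. indicator ?S x * indicator C x :: real)"
      proof (rule integrable_gauss_bounded)
        fix x show "\<bar>indicator ?S x * indicator C x :: real\<bar> \<le> 1" by (simp add: indicator_def)
      qed measurable
      fix x
      have "1 \<le> exp (2 * M + 1) * exp (- W x)" if "W x \<le> 2 * M + 1"
        using that by (simp flip: exp_add)
      then show "indicator ?S x * indicator C x \<le> exp (2 * M + 1) * (exp (- W x) * indicator C x)"
        by (auto simp: indicator_def)
    qed (use measure_mu(2)[OF C_sets] in auto)
    also have "... = exp (2 * M + 1) * measure \<mu> C" by (simp add: measure_mu(1)[OF C_sets])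
    finally show "(LINT x|\<gamma>. indicator ?S x * indicator C x) \<le> exp (2 * M + 1) * measure \<mu> C" .
  qed (use t in auto)
  also have "... = 2 * pi * (L / M) + 4 * pi * exp (2 * M + 1) * (measure \<mu> C / t)"
    by (simp add: algebra_simps)
  finally have "g / 2 * g \<le> 2 * pi * (L / M) + 4 * pi * exp (2 * M + 1) * (measure \<mu> C / t)"
    using lower by linarith
  \<comment> \<open>The third lower bound on \<open>M\<close> makes the gradient of the cutoff
    consume at most half of \<open>g^2 / 2\<close>.\<close>
  moreover have "2 * pi * (L / M) \<le> g^2 / 4"
    using M g0 by (simp add: field_simps)
  moreover have "g / 2 * g = g^2 / 2" by (simp add: power2_eq_square)
  ultimately have "g^2 / 4 \<le> 4 * pi * exp (2 * M + 1) * (measure \<mu> C / t)" by linarith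
  then show ?thesis by (simp add: field_simps)
qed

end

section \<open>The Gaussian isoperimetric profile\<close>

lemma real_distribution_gauss1: "real_distribution gauss1"
  unfolding real_distribution_def real_distribution_axioms_def
  using gauss1.prob_space_axioms by simp

lemma std_normal_cdf_eq: "std_normal_cdf x = measure gauss1 {..x}"
proof -
  have int: "integrable lborel (\<lambda>t. \<phi> t * indicator {..x} t)"
    by (intro integrable_real_mult_indicator integrable_normal_density) auto
  have "emeasure gauss1 {..x} = (\<integral>\<^sup>+t. ennreal (\<phi> t * indicator {..x} t) \<partial>lborel)"
    by (subst emeasure_density) (auto intro!: nn_integral_cong simp: indicator_def)
  also have "... = ennreal (LINT t|lborel. \<phi> t * indicator {..x} t)"
    by (rule nn_integral_eq_integral[OF int]) simp
  finally have "measure gauss1 {..x} = (LINT t|lborel. \<phi> t * indicator {..x} t)"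
    by (simp add: measure_def)
  then show ?thesis
    by (simp add: std_normal_cdf_def set_lebesgue_integral_def mult.commute)
qed

lemma measure_gauss1_interval_le:
  assumes "a \<le> b"
  shows "measure gauss1 {a<..b} \<le> b - a"
proof -
  have "emeasure gauss1 {a<..b} = (\<integral>\<^sup>+t. ennreal (\<phi> t) * indicator {a<..b} t \<partial>lborel)"
    by (rule emeasure_density) auto
  also have "... \<le> (\<integral>\<^sup>+t. indicator {a<..b} t \<partial>lborel)"
    using std_normal_density_le_1 by (intro nn_integral_mono) (auto simp: indicator_def)
  also have "... = ennreal (b - a)" using assms by simp
  finally show ?thesis using assms by (simp add: gauss1.emeasure_eq_measure)
qed

text \<open>The profile evaluates the density at \<open>inv std_normal_cdf p\<close>, which is a
  preimage of \<open>p\<close> once \<open>p\<close> is known to be attained. This is the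
  intermediate value theorem, with continuity from the density bound 1.\<close>

lemma std_normal_cdf_surj:
  assumes p: "0 < p" "p < 1"
  shows "\<exists>x. std_normal_cdf x = p"
proof -
  interpret R: real_distribution gauss1 by (rule real_distribution_gauss1)
  have cdf: "std_normal_cdf x = cdf gauss1 x" for x by (simp add: std_normal_cdf_eq cdf_def)
  have diff: "std_normal_cdf y - std_normal_cdf x = measure gauss1 {x<..y}" if "x \<le> y" for x y
  proof -
    have "measure gauss1 ({..y} - {..x}) = measure gauss1 {..y} - measure gauss1 {..x}"
      using that by (intro gauss1.finite_measure_Diff) auto
    moreover have "{..y} - {..x} = {x<..y}" by auto
    ultimately show ?thesis by (simp add: std_normal_cdf_eq)
  qed
  have lip: "\<bar>std_normal_cdf y - std_normal_cdf x\<bar> \<le> \<bar>y - x\<bar>" for x y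
  proof (cases "x \<le> y")
    case True
    then show ?thesis using diff[OF True] measure_gauss1_interval_le[OF True] by simp
  next
    case False
    then have "y \<le> x" by simp
    then show ?thesis
      using diff[of y x] measure_gauss1_interval_le[of y x] measure_nonneg[of gauss1 "{y<..x}"] by linarith
  qed
  have cont: "continuous_on S std_normal_cdf" for S
    unfolding continuous_on_iff
  proof (intro ballI allI impI)
    fix x e :: real assume "0 < e"
    then show "\<exists>r>0. \<forall>x'\<in>S. dist x' x < r \<longrightarrow> dist (std_normal_cdf x') (std_normal_cdf x) < e"
      using lip by (intro exI[of _ e]) (auto simp: dist_real_def intro: order.strict_trans1)
  qed
  have "\<forall>\<^sub>F x in at_bot. cdf gauss1 x < p"
    using order_tendstoD(2)[OF R.cdf_lim_at_bot] p by simp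
  then obtain a where a: "std_normal_cdf a < p"
    unfolding cdf[symmetric] by (meson eventually_happens trivial_limit_at_bot_linorder)
  have "\<forall>\<^sub>F x in at_top. p < cdf gauss1 x"
    using order_tendstoD(1)[OF R.cdf_lim_at_top_prob] p by simp
  then obtain b where b: "p < std_normal_cdf b"
    unfolding cdf[symmetric] by (meson eventually_happens trivial_limit_at_top_linorder)
  have "a \<le> b"
  proof (rule ccontr)
    assume "\<not> a \<le> b"
    then have "b \<le> a" by simp
    from diff[OF this] show False using a b measure_nonneg[of gauss1 "{b<..a}"] by linarith
  qed
  then show ?thesis
    using IVT'[of std_normal_cdf a p b] a b cont by auto
qed

lemma std_normal_cdf_minus: "std_normal_cdf (- x) = 1 - std_normal_cdf x"
proof -
  have "emeasure gauss1 {..- x} = (\<integral>\<^sup>+t. ennreal (\<phi> t) * indicator {..- x} t \<partial>lborel)"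
    by (rule emeasure_density) auto
  also have "... = ennreal \<bar>- 1\<bar> * (\<integral>\<^sup>+t. ennreal (\<phi> (0 + - 1 * t)) * indicator {..- x} (0 + - 1 * t) \<partial>lborel)"
    by (rule nn_integral_real_affine) auto
  also have "... = (\<integral>\<^sup>+t. ennreal (\<phi> t) * indicator {x..} t \<partial>lborel)"
    by (simp add: std_normal_density_def indicator_def)
  also have "... = emeasure gauss1 {x..}"
    by (rule emeasure_density[symmetric]) auto
  finally have 1: "measure gauss1 {..- x} = measure gauss1 {x..}" by (simp add: measure_def)
  have "emeasure gauss1 {x} = (\<integral>\<^sup>+t. ennreal (\<phi> t) * indicator {x} t \<partial>lborel)"
    by (rule emeasure_density) auto
  also have "... = 0"
    by (subst nn_integral_0_iff_AE) (auto simp: indicator_def intro: AE_I'[OF finite_imp_null_set_lborel[of "{x}"]])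
  finally have 0: "measure gauss1 {x} = 0" by (simp add: measure_def)
  have "measure gauss1 {x..} = measure gauss1 ({x} \<union> {x<..})"
    by (rule arg_cong[of _ _ "measure gauss1"]) auto
  also have "... = measure gauss1 {x} + measure gauss1 {x<..}"
    by (rule gauss1.finite_measure_Union) auto
  also have "measure gauss1 {x<..} = measure gauss1 (space gauss1 - {..x})"
    by (rule arg_cong[of _ _ "measure gauss1"]) auto
  also have "... = 1 - measure gauss1 {..x}" by (rule gauss1.prob_compl) simp
  finally show ?thesis using 0 1 by (simp add: std_normal_cdf_eq)
qed

text \<open>Shift the tail to the negative half-line: there the Cameron-Martin factor
  \<open>exp (a * x - a^2 / 2)\<close> is at most \<open>exp (- (a^2 / 2))\<close>.\<close>

lemma std_normal_cdf_tail_upper: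
  assumes a: "0 \<le> a"
  shows "std_normal_cdf (- a) \<le> exp (- (a^2 / 2))"
proof -
  have "emeasure gauss1 {..- a} = (\<integral>\<^sup>+x. indicator {..- a} x \<partial>gauss1)" by simp
  also have "... = (\<integral>\<^sup>+x. indicator {..0} (x + a) \<partial>gauss1)"
    by (intro nn_integral_cong) (auto simp: indicator_def)
  also have "... = (\<integral>\<^sup>+x. indicator {..0} x * ennreal (exp (a * x - a\<^sup>2 / 2)) \<partial>gauss1)"
    by (rule nn_integral_gauss1_shift) simp
  also have "... \<le> (\<integral>\<^sup>+x. ennreal (exp (- (a^2 / 2))) \<partial>gauss1)"
    using a by (intro nn_integral_mono) (auto simp: indicator_def mult_nonneg_nonpos intro!: ennreal_leI)
  also have "... = ennreal (exp (- (a^2 / 2)))"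
    using gauss1.emeasure_space_1 by simp
  finally show ?thesis by (simp add: std_normal_cdf_eq gauss1.emeasure_eq_measure)
qed

text \<open>The tail contains an interval of length \<open>1 / (a + 1)\<close> ending at
  \<open>- a\<close>, on which the exponent falls by at most 3/2.\<close>

lemma std_normal_cdf_tail_lower:
  assumes a: "0 \<le> a"
  shows "\<phi> a \<le> exp (3 / 2) * (a + 1) * std_normal_cdf (- a)"
proof -
  define \<delta> where "\<delta> = 1 / (a + 1)"
  have \<delta>: "0 < \<delta>" "\<delta> \<le> 1" "a * \<delta> \<le> 1" using a by (auto simp: \<delta>_def)
  have dens: "\<phi> a * exp (- (3 / 2)) \<le> \<phi> x" if x: "x \<in> {- a - \<delta>..- a}" for x
  proof -
    have "x^2 \<le> (a + \<delta>)^2" using x a by (intro abs_le_square_iff[THEN iffD1]) auto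
    also have "... = a^2 + 2 * (a * \<delta>) + \<delta>^2" by (simp add: power2_eq_square algebra_simps)
    also have "... \<le> a^2 + 3" using \<delta> power_le_one[of \<delta> 2] by simp
    finally have "exp (- a\<^sup>2 / 2) * exp (- (3 / 2)) \<le> exp (- x\<^sup>2 / 2)"
      by (simp flip: exp_add)
    then have "1 / sqrt (2 * pi) * (exp (- a\<^sup>2 / 2) * exp (- (3 / 2))) \<le> 1 / sqrt (2 * pi) * exp (- x\<^sup>2 / 2)"
      by (rule mult_left_mono) simp
    then show ?thesis by (simp add: std_normal_density_def mult.assoc)
  qed
  have "ennreal (\<phi> a * exp (- (3 / 2)) * \<delta>) =
     (\<integral>\<^sup>+x. ennreal (\<phi> a * exp (- (3 / 2))) * indicator {- a - \<delta>..- a} x \<partial>lborel)"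
    using \<delta> by (simp add: nn_integral_cmult ennreal_mult)
  also have "... \<le> (\<integral>\<^sup>+x. ennreal (\<phi> x) * indicator {..- a} x \<partial>lborel)"
  proof (rule nn_integral_mono)
    fix x
    show "ennreal (\<phi> a * exp (- (3 / 2))) * indicator {- a - \<delta>..- a} x \<le>
      ennreal (\<phi> x) * indicator {..- a} x"
      using dens[of x] by (cases "x \<in> {- a - \<delta>..- a}") (auto intro: ennreal_leI)
  qed
  also have "... = emeasure gauss1 {..- a}" by (rule emeasure_density[symmetric]) auto
  also have "... = ennreal (std_normal_cdf (- a))"
    by (simp add: std_normal_cdf_eq gauss1.emeasure_eq_measure)
  finally have "\<phi> a * exp (- (3 / 2)) * \<delta> \<le> std_normal_cdf (- a)"
    by (subst (asm) ennreal_le_iff) (auto simp: std_normal_cdf_eq)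
  then have "exp (3 / 2) * (a + 1) * (\<phi> a * exp (- (3 / 2)) * \<delta>) \<le> exp (3 / 2) * (a + 1) * std_normal_cdf (- a)"
    using a by (intro mult_left_mono) auto
  moreover have "exp (3 / 2) * (a + 1) * (\<phi> a * exp (- (3 / 2)) * \<delta>) =
     \<phi> a * (exp (3 / 2) * exp (- (3 / 2))) * ((a + 1) * \<delta>)" by (simp only: mult_ac)
  moreover have "exp (3 / 2) * exp (- (3 / 2)) = (1 :: real)" by (simp flip: exp_add)
  moreover have "(a + 1) * \<delta> = 1" using a by (simp add: \<delta>_def)
  ultimately show ?thesis by simp
qed

text \<open>The upper tail bound gives \<open>a \<le> sqrt 2 * ?s\<close>, and
  \<open>q \<le> 1 / 2\<close> gives \<open>1 \<le> sqrt 2 * ?s\<close>. Hence \<open>a + 1\<close>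
  in the lower tail bound becomes \<open>2 * sqrt 2 * ?s\<close>, and 16 dominates the product of
  the constants.\<close>

lemma std_normal_density_le:
  assumes a: "0 \<le> a" and q: "q = std_normal_cdf (- a)" and half: "q \<le> 1 / 2" and q0: "0 < q"
  shows "\<phi> a \<le> 16 * q * sqrt (ln (1 / q))"
proof -
  let ?s = "sqrt (ln (1 / q))"
  have "ln q \<le> ln (exp (- (a^2 / 2)))"
    using std_normal_cdf_tail_upper[OF a] q0 unfolding q[symmetric] by (intro ln_mono) auto
  then have "a^2 \<le> 2 * ln (1 / q)" using q0 by (simp add: ln_div)
  then have a_le: "a \<le> sqrt 2 * ?s" by (simp add: real_le_rsqrt flip: real_sqrt_mult)
  have "ln 2 \<le> ln (1 / q)" using half q0 by (intro ln_mono) (auto simp: field_simps)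
  moreover have "2 / 3 \<le> ln (2 :: real)" by (rule ln2_ge_two_thirds)
  ultimately have "1 \<le> 2 * ln (1 / q)" by linarith
  then have one_le: "1 \<le> sqrt 2 * ?s" by (simp flip: real_sqrt_mult)
  have "exp (3 / 2 :: real) * (2 * sqrt 2) \<le> 16"
  proof (rule power2_le_imp_le)
    have "(exp (3 / 2 :: real))^2 = exp 1 ^ 3" by (simp flip: exp_of_nat_mult)
    also have "... \<le> 3 ^ 3" using exp_le by (intro power_mono) auto
    finally show "(exp (3 / 2 :: real) * (2 * sqrt 2))^2 \<le> 16^2" by (simp add: power_mult_distrib)
  qed simp
  have "\<phi> a \<le> exp (3 / 2) * (a + 1) * q"
    using std_normal_cdf_tail_lower[OF a] by (simp add: q)
  also have "... \<le> exp (3 / 2) * (2 * (sqrt 2 * ?s)) * q"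
    using a_le one_le q0 by (intro mult_right_mono mult_left_mono) auto
  also have "... = (exp (3 / 2) * (2 * sqrt 2)) * (q * ?s)" by (simp add: mult_ac)
  also have "... \<le> 16 * (q * ?s)"
  proof (rule mult_right_mono)
    show "0 \<le> q * ?s" using q0 half by (auto simp: field_simps)
  qed fact
  finally show ?thesis by (simp add: mult.assoc)
qed

text \<open>Evenness of the density and the reflection formula for the distribution function reduce
  everything to the lighter tail, of mass \<open>q\<close>.\<close>

lemma gauss_iso_le:
  assumes p: "0 < p" "p < 1" and q: "q = min p (1 - p)"
  shows "gauss_iso p \<le> 16 * q * sqrt (ln (1 / q))" "gauss_iso p \<le> 1"
proof -
  define x where "x = inv std_normal_cdf p"
  have x: "std_normal_cdf x = p"
    unfolding x_def using std_normal_cdf_surj[OF p] by (metis f_inv_into_f rangeI)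
  have iso: "gauss_iso p = \<phi> x" using p by (simp add: gauss_iso_def x_def)
  have abs: "\<phi> x = \<phi> \<bar>x\<bar>" by (simp add: std_normal_density_def)
  have "measure gauss1 {..- \<bar>x\<bar>} \<le> measure gauss1 {..\<bar>x\<bar>}"
    by (intro gauss1.finite_measure_mono) auto
  then have half: "std_normal_cdf (- \<bar>x\<bar>) \<le> 1 / 2"
    using std_normal_cdf_minus[of "\<bar>x\<bar>"] by (simp add: std_normal_cdf_eq)
  have "q = std_normal_cdf (- \<bar>x\<bar>)"
  proof (cases "0 \<le> x")
    case True
    then show ?thesis using half std_normal_cdf_minus[of x] x q by (auto simp: min_def)
  next
    case False
    then show ?thesis using half x q by (auto simp: min_def)
  qed
  then show "gauss_iso p \<le> 16 * q * sqrt (ln (1 / q))"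
    unfolding iso abs using half p q by (intro std_normal_density_le) auto
  show "gauss_iso p \<le> 1" unfolding iso by (rule std_normal_density_le_1)
qed

section \<open>The isoperimetric inequality\<close>

lemma enlargement_eucl:
  assumes "A \<noteq> {}"
  shows "enlargement (eucl d) A t = {x \<in> Rn {..<d}. set_ed d A x \<le> t}"
proof -
  have "(INF a\<in>A. ereal (mdist (eucl d) x a)) = ereal (set_ed d A x)" for x
  proof -
    have "ereal (set_ed d A x) = (INF r\<in>(\<lambda>a. ed {..<d} x a) ` A. ereal r)"
      unfolding set_ed_def using assms bdd_below_ed by (intro ereal_Inf') auto
    then show ?thesis by (simp add: image_image ed_def)
  qed
  then show ?thesis by (simp add: enlargement_def space_gauss)
qed

lemma sqrt_ln_mono:
  assumes "0 < (q'::real)" "q' \<le> q" "q < 1"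
  shows "sqrt (ln (1 / q)) \<le> sqrt (ln (1 / q'))"
  using assms by (intro real_sqrt_le_mono ln_mono) (auto simp: frac_le)

context log_lipschitz_perturbation
begin

text \<open>Arguing by contradiction keeps the layer small: since the claimed bound is at most 1,
  its failure forces the layer to have mass below \<open>t\<close>, hence at most half of the
  lighter side. The complement \<open>B\<close> of the enlargement then still has mass comparable to
  \<open>1 - p\<close>.\<close>

lemma isoperimetry_enlargement:
  assumes A[measurable]: "A \<in> sets \<gamma>" and p: "p = measure \<mu> A" "0 < p" "p < 1"
    and r: "0 < r" "r < 1" "32 \<le> ln (1 / r)" "sqrt r * expC \<le> 1 / 8" "3072 * L \<le> sqrt (ln (1 / r))"
    and M: "g = (r / 2)^2 / expC" "1 \<le> M" "2 * expC / g \<le> M" "8 * pi * L / g^2 \<le> M"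
    and \<alpha>: "0 < \<alpha>" "\<alpha> \<le> 1" "\<alpha> \<le> 1 / (32 * 3072)" "\<alpha> \<le> g^2 / (16 * pi * exp (2 * M + 1))"
    and t: "0 < t" "t < min p (1 - p) / 2"
  shows "\<alpha> * gauss_iso p \<le> measure \<mu> (enlargement (eucl d) A t - A) / t"
proof (rule ccontr)
  let ?C = "enlargement (eucl d) A t - A"
  assume "\<not> ?thesis"
  then have less: "measure \<mu> ?C / t < \<alpha> * gauss_iso p" by simp
  have Ane: "A \<noteq> {}" using p by auto
  note enl = enlargement_eucl[OF Ane, of d t]
  define B where "B = space \<gamma> - enlargement (eucl d) A t"
  note [measurable] = borel_measurable_set_ed[OF Ane, of d]
  have enl_sets[measurable]: "enlargement (eucl d) A t \<in> sets \<gamma>" unfolding enl by measurable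
  have B_sets[measurable]: "B \<in> sets \<gamma>" unfolding B_def by measurable
  have Asub: "A \<subseteq> space \<gamma>" using A by (rule sets.sets_into_space)
  have A_enl: "A \<subseteq> enlargement (eucl d) A t"
  proof
    fix a assume a: "a \<in> A"
    then show "a \<in> enlargement (eucl d) A t" using set_ed_le[OF a, of d a] Asub t by (auto simp: enl)
  qed
  have sep: "t \<le> ed {..<d} a b" if "a \<in> A" "b \<in> B" for a b
    using that set_ed_le[OF that(1), of d b] by (auto simp: B_def enl ed_commute[of _ a b])
  then have sep': "t \<le> ed {..<d} b a" if "b \<in> B" "a \<in> A" for a b
    using that by (simp add: ed_commute[of _ b a])
  have C: "?C = space \<gamma> - A - B" "?C = space \<gamma> - B - A"
    using enl by (auto simp: B_def)
  define q where "q = min p (1 - p)"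
  have q: "0 < q" "q < 1" "q \<le> 1 / 2" using p by (auto simp: q_def min_def)
  note iso = gauss_iso_le[OF p(2,3) q_def]
  have "\<alpha> * gauss_iso p \<le> 1 * 1" using \<alpha> iso(2) p
    by (intro mult_mono) (auto simp: gauss_iso_def)
  then have "measure \<mu> ?C / t < 1" using less by linarith
  then have "measure \<mu> ?C < t" using t by simp
  then have Cq: "measure \<mu> ?C \<le> q / 2" using t by (simp add: q_def)
  have muB: "measure \<mu> B = 1 - p - measure \<mu> ?C"
  proof -
    have "measure \<mu> (enlargement (eucl d) A t) = measure \<mu> A + measure \<mu> ?C"
      using Mu.finite_measure_Diff[of "enlargement (eucl d) A t" A] A_enl by simp
    moreover have "measure \<mu> B = 1 - measure \<mu> (enlargement (eucl d) A t)"
      using Mu.prob_compl[of "enlargement (eucl d) A t"] by (simp add: B_def)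
    ultimately show ?thesis using p by simp
  qed
  \<comment> \<open>\<open>A'\<close> is the lighter side. Its mass may be as low as
    \<open>q / 2\<close> when it is \<open>B\<close>, which accounts for the extra factor 2; the
    smallness conditions pass from \<open>r\<close> to any smaller mass.\<close>
  have small: "q * sqrt (ln (1 / q)) / (2 * 3072) \<le> measure \<mu> ?C / t" if qr: "q \<le> r"
  proof -
    have *: "q * sqrt (ln (1 / q)) / (2 * 3072) \<le> measure \<mu> ?C / t"
      if A': "A' \<in> sets \<gamma>" and B': "B' \<in> sets \<gamma>" and C': "?C = space \<gamma> - A' - B'"
        and s: "\<And>a b. a \<in> A' \<Longrightarrow> b \<in> B' \<Longrightarrow> t \<le> ed {..<d} a b" and m: "q / 2 \<le> measure \<mu> A'" "measure \<mu> A' \<le> q"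
      for A' B'
    proof -
      let ?q = "measure \<mu> A'"
      have q'0: "0 < ?q" "?q < 1" "?q \<le> r" using m q qr by linarith+
      have sl: "sqrt (ln (1 / r)) \<le> sqrt (ln (1 / ?q))"
        by (rule sqrt_ln_mono) (use q'0 r in auto)
      have "?q * sqrt (ln (1 / ?q)) / 3072 \<le> measure \<mu> ?C / t"
      proof (rule small_set_isoperimetry[OF A' B' t(1) s C' refl q'0(1,2) _ refl])
        show "measure \<mu> ?C \<le> ?q" using Cq m by linarith
        show "32 \<le> ln (1 / ?q)" using sl r by simp
        have "sqrt ?q * expC \<le> sqrt r * expC" using q'0 expC_pos by (intro mult_right_mono) auto
        then show "sqrt ?q * expC \<le> 1 / 8" using r by linarith
        show "3072 * L \<le> sqrt (ln (1 / ?q))" using sl r by linarith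
      qed
      moreover have "q / 2 * sqrt (ln (1 / q)) / 3072 \<le> ?q * sqrt (ln (1 / ?q)) / 3072"
      proof (intro divide_right_mono mult_mono m sqrt_ln_mono)
        show "0 \<le> sqrt (ln (1 / q))" using q by simp
      qed (use q'0 q m in auto)
      moreover have "q * sqrt (ln (1 / q)) / (2 * 3072) = q / 2 * sqrt (ln (1 / q)) / 3072" by simp
      ultimately show ?thesis by linarith
    qed
    show ?thesis
    proof (cases "p \<le> 1 - p")
      case True
      then show ?thesis using p q by (intro *[OF A B_sets C(1) sep]) (auto simp: q_def)
    next
      case False
      then have "q = 1 - p" by (simp add: q_def)
      then show ?thesis using muB Cq by (intro *[OF B_sets A C(2) sep']) auto
    qed
  qed
  show False
  proof (cases "q \<le> r")
    case True
    \<comment> \<open>The factor 32 combines 16 from the profile bound with the 2 of the previous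
      estimate.\<close>
    have "\<alpha> * gauss_iso p \<le> 1 / (32 * 3072) * (16 * q * sqrt (ln (1 / q)))"
      using \<alpha> iso(1) p by (intro mult_mono) (auto simp: gauss_iso_def)
    also have "... = q * sqrt (ln (1 / q)) / (2 * 3072)" by simp
    finally show False using small[OF True] less by linarith
  next
    case False
    then have rp: "r \<le> p" "r \<le> 1 - p" by (auto simp: q_def)
    have C2: "measure \<mu> ?C \<le> (1 - p) / 2" using Cq by (simp add: q_def)
    have "r / 2 \<le> p" using rp(1) p(2) by linarith
    moreover have "r / 2 \<le> 1 - p - measure \<mu> ?C" using rp(2) C2 by (simp add: field_simps)
    ultimately have "r / 2 \<le> measure \<mu> A" "r / 2 \<le> measure \<mu> B" by (simp_all only: muB p(1))
    then have "g^2 / (16 * pi * exp (2 * M + 1)) \<le> measure \<mu> ?C / t"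
      using r by (intro large_set_isoperimetry[OF A B_sets t(1) sep C(1) _ _ _ M]) auto
    moreover have "\<alpha> * gauss_iso p \<le> \<alpha> * 1" using \<alpha> iso(2) by (intro mult_left_mono) auto
    ultimately show False using \<alpha> less by linarith
  qed
qed

lemma isoperimetry:
  assumes A: "A \<in> sets \<gamma>"
    and r: "0 < r" "r < 1" "32 \<le> ln (1 / r)" "sqrt r * expC \<le> 1 / 8" "3072 * L \<le> sqrt (ln (1 / r))"
    and M: "g = (r / 2)^2 / expC" "1 \<le> M" "2 * expC / g \<le> M" "8 * pi * L / g^2 \<le> M"
    and \<alpha>: "0 < \<alpha>" "\<alpha> \<le> 1" "\<alpha> \<le> 1 / (32 * 3072)" "\<alpha> \<le> g^2 / (16 * pi * exp (2 * M + 1))"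
  shows "ereal (\<alpha> * gauss_iso (measure \<mu> A)) \<le> boundary_measure (eucl d) \<mu> A"
  unfolding boundary_measure_def
proof (rule Liminf_bounded)
  let ?p = "measure \<mu> A"
  show "\<forall>\<^sub>F t in at_right 0. ereal (\<alpha> * gauss_iso ?p) \<le> ereal (measure \<mu> (enlargement (eucl d) A t - A) / t)"
  proof (cases "0 < ?p \<and> ?p < 1")
    case True
    have "\<forall>\<^sub>F t in at_right 0. t \<in> {0<..<min ?p (1 - ?p) / 2}"
      using True by (intro eventually_at_right_real) auto
    then show ?thesis
    proof eventually_elim
      case (elim t)
      then show ?case
        using isoperimetry_enlargement[OF A refl _ _ r M \<alpha>, of t] True by simp
    qed
  next
    \<comment> \<open>For null sets and sets of full measure the profile vanishes and the quotients
      are nonnegative.\<close>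
    case False
    then have "gauss_iso ?p = 0" by (simp only: gauss_iso_def if_False)
    then show ?thesis
      by (auto simp: eventually_at_right_field intro!: exI[of _ 1])
  qed
qed

end

theorem theorem8:
  shows "\<forall>L::real. L \<ge> 0 \<longrightarrow> (\<exists>\<alpha>::real. \<alpha> > 0 \<and>
    (\<forall>(d::nat) (W :: (nat \<Rightarrow> real) \<Rightarrow> real) (\<mu> :: (nat \<Rightarrow> real) measure).
       d \<ge> 1 \<longrightarrow>
       \<mu> = density (std_gaussian d) (\<lambda>x. ennreal (exp (- W x))) \<longrightarrow>
       prob_space \<mu> \<longrightarrow>
       (\<forall>x\<in>mspace (eucl d). \<exists>g\<in>mspace (eucl d). has_gradient d W g x \<and> L2_set g {..<d} \<le> L) \<longrightarrow>
       (\<forall>A\<in>borel_sets_of (eucl d).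
          boundary_measure (eucl d) \<mu> A \<ge> ereal (\<alpha> * gauss_iso (measure \<mu> A)))))"
proof (intro allI impI, goal_cases)
  case L: (1 L)
  \<comment> \<open>The value of \<open>expC\<close>, written out because all constants must be
    fixed from \<open>L\<close> before \<open>d\<close> and \<open>W\<close> are introduced.\<close>
  define e where "e = 4 * exp (4 * L^2)"
  have e: "0 < e" by (simp add: e_def)
  \<comment> \<open>The logarithm of \<open>1 / r\<close>: each summand secures one condition on the
    threshold \<open>r\<close>, the last one the bound
    \<open>sqrt r \<le> 1 / (8 * e)\<close>.\<close>
  define l where "l = 32 + (3072 * L)^2 + 2 * \<bar>ln (8 * e)\<bar>"
  define r where "r = exp (- l)"
  have lr: "ln (1 / r) = l" by (simp add: r_def ln_div)
  have l0: "0 < l" "32 \<le> l" "(3072 * L)^2 \<le> l" "2 * ln (8 * e) \<le> l"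
    unfolding l_def using zero_le_power2[of "3072 * L"] abs_ge_self[of "ln (8 * e)"] abs_ge_zero[of "ln (8 * e)"]
    by linarith+
  have r: "0 < r" "r < 1" "32 \<le> ln (1 / r)" using l0 unfolding lr by (auto simp: r_def)
  have r4: "sqrt r * e \<le> 1 / 8"
  proof -
    have "sqrt r = exp (- l / 2)"
      by (rule real_sqrt_unique) (auto simp: r_def simp flip: exp_of_nat_mult)
    also have "\<dots> \<le> exp (- ln (8 * e))" using l0 by simp
    also have "\<dots> = 1 / (8 * e)" using e by (simp add: exp_minus inverse_eq_divide)
    finally show ?thesis using e by (simp add: field_simps)
  qed
  have r5: "3072 * L \<le> sqrt (ln (1 / r))"
    unfolding lr using l0 by (intro real_le_rsqrt)
  define g where "g = (r / 2)^2 / e"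
  have g0: "0 < g" using e r by (simp add: g_def)
  define M where "M = 1 + 2 * e / g + 8 * pi * L / g^2"
  have M: "1 \<le> M" "2 * e / g \<le> M" "8 * pi * L / g^2 \<le> M"
    using e g0 L by (auto simp: M_def)
  define \<alpha> where "\<alpha> = min (1 / (32 * 3072)) (g^2 / (16 * pi * exp (2 * M + 1)))"
  have \<alpha>: "0 < \<alpha>" "\<alpha> \<le> 1" "\<alpha> \<le> 1 / (32 * 3072)" "\<alpha> \<le> g^2 / (16 * pi * exp (2 * M + 1))"
    using g0 by (auto simp: \<alpha>_def min_le_iff_disj)
  show ?case
  proof (intro exI[of _ \<alpha>] conjI allI impI ballI)
    fix d :: nat and W :: "(nat \<Rightarrow> real) \<Rightarrow> real" and \<mu> :: "(nat \<Rightarrow> real) measure" and A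
    assume \<mu>: "\<mu> = density (std_gaussian d) (\<lambda>x. ennreal (exp (- W x)))" and prob: "prob_space \<mu>"
      and grad: "\<forall>x\<in>mspace (eucl d). \<exists>g\<in>mspace (eucl d). has_gradient d W g x \<and> L2_set g {..<d} \<le> L"
      and A: "A \<in> borel_sets_of (eucl d)"
    interpret P: log_lipschitz_perturbation d L W
    proof (rule log_lipschitz_perturbation.intro)
      show "prob_space (density (gauss {..<d}) (\<lambda>x. ennreal (exp (- W x))))"
        using prob by (simp add: \<mu> std_gaussian_eq)
      show "W x - W y \<le> L * ed {..<d} x y" if "x \<in> Rn {..<d}" "y \<in> Rn {..<d}" for x y
        using grad that(2,1) by (intro bounded_gradient_lipschitz) (auto simp: space_gauss)
    qed (fact L)
    have eC: "P.expC = e" by (simp add: P.expC_def e_def)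
    have "A \<in> sets (gauss {..<d})" using A sets_std_gaussian[of d] by (simp add: std_gaussian_eq)
    from P.isoperimetry[OF this r _ r5 _ M(1) _ M(3) \<alpha>] r4 M(2)
    show "ereal (\<alpha> * gauss_iso (measure \<mu> A)) \<le> boundary_measure (eucl d) \<mu> A"
      by (simp add: eC g_def P.\<mu>_def \<mu> std_gaussian_eq)
  qed (fact \<alpha>)
qed

end
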